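(* Every Abhyankar valuation has linear growth. That is, if $K$ is the function field of a normal projective variety over $k$ and $v$ is an Abhyankar real valuation on $K$, then $a_{\max}(\|L\|,v)<+\infty$ for every big line bundle $L$ on every normal projective model $X$ of $K$.
   Context: $k$ is an algebraically closed field of arbitrary characteristic; an algebraic variety is an integral $k$-scheme of finite type. A real valuation $v$ on a variety $X$ is a valuation $v:K^*\to\mathbb{R}$ on the function field $K$, trivial on $k$, of real rank $1$ (in particular nontrivial), with a center $c_X(v)\in X$ (a scheme point such that $v\ge0$ on $\mathcal{O}_{X,c_X(v)}$ and $v>0$ on its maximal ideal; automatic when $X$ is projective). Its rational rank $\mathrm{rat.rk}(v)$ is the maximal number of $\mathbb{Q}$-linearly independent elements in $v(K^* )$, and its transcendence degree $\mathrm{tr.deg}(v)$ is the transcendence degree over $k$ of the residue field $\{v\ge0\}/\{v>0\}$. One always has $\mathrm{rat.rk}(v)+\mathrm{tr.deg}(v)\le\dim X$, and $v$ is an Abhyankar valuation if equality holds. For a line bundle $L$ on $X$ and $0\ne s\in H^0(L)$, $v(s)$ is the value of $v$ on $s$ computed in a local trivialization of $L$ at $c_X(v)$. Let $a_{\max}(mL,v)$ be the largest value of $v$ on nonzero sections of $mL$; for $L$ big, $a_{\max}(\|L\|,v):=\lim_{m\to\infty}m^{-1}a_{\max}(mL,v)\in(0,+\infty]$ exists. The valuation $v$ has linear growth if $a_{\max}(\|L\|,v)<+\infty$ for some (equivalently any) big line bundle $L$ on some (equivalently any) normal projective model of $K$. *)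

theory Defs
  imports
    "HOL-Analysis.Analysis"
    "HOL-Algebra.Algebraic_Closure_Type"
    "HOL-Algebra.QuotRing"
    "HOL-Library.Poly_Mapping"
    "HOL-Library.Function_Algebras"
    "HOL-Library.Extended_Nat"
begin

text \<open>
  The ground field \<open>k\<close> is a type \<open>'k\<close> of class \<open>alg_closed_field\<close>, the function field \<open>K\<close> is a
  type \<open>'a\<close> of class \<open>field\<close>, and \<open>K\<close> is an extension of \<open>k\<close> through a ring homomorphism
  \<open>\<iota> :: 'k \<Rightarrow> 'a\<close>. The record \<open>ring_of_type_algebra\<close> turns the type \<open>'a\<close> into a ring in the sense
  of HOL-Algebra; it is used for subrings, prime ideals and quotients.
\<close>

definition field_extension :: "('k::alg_closed_field \<Rightarrow> 'a::field) \<Rightarrow> bool" where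
  "field_extension \<iota> \<longleftrightarrow> \<iota> \<in> ring_hom ring_of_type_algebra ring_of_type_algebra"

abbreviation ring_on :: "'a::field set \<Rightarrow> 'a ring" where
  "ring_on A \<equiv> ring_of_type_algebra \<lparr> carrier := A \<rparr>"


section \<open>Transcendence degree\<close>

text \<open>
  A polynomial with coefficients in \<open>'k\<close> and variables indexed by \<open>'f\<close> is an element of
  \<open>('f \<Rightarrow>\<^sub>0 nat) \<Rightarrow>\<^sub>0 'k\<close>. Elements of an algebra are used as names of the variables for which
  they are substituted.
\<close>

definition poly_value :: "'f ring \<Rightarrow> ('k::zero \<Rightarrow> 'f) \<Rightarrow> (('f \<Rightarrow>\<^sub>0 nat) \<Rightarrow>\<^sub>0 'k) \<Rightarrow> 'f" where
  "poly_value R \<phi> P =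
     finsum R (\<lambda>\<alpha>. \<phi> (Poly_Mapping.lookup P \<alpha>) \<otimes>\<^bsub>R\<^esub>
         finprod R (\<lambda>t. t [^]\<^bsub>R\<^esub> Poly_Mapping.lookup \<alpha> t) (Poly_Mapping.keys \<alpha>))
       (Poly_Mapping.keys P)"

definition algebraically_independent :: "'f ring \<Rightarrow> ('k::zero \<Rightarrow> 'f) \<Rightarrow> 'f set \<Rightarrow> bool" where
  "algebraically_independent R \<phi> S \<longleftrightarrow> S \<subseteq> carrier R \<and>
     (\<forall>P. P \<noteq> 0 \<and> (\<forall>\<alpha>\<in>Poly_Mapping.keys P. Poly_Mapping.keys \<alpha> \<subseteq> S) \<longrightarrow>
        poly_value R \<phi> P \<noteq> \<zero>\<^bsub>R\<^esub>)"

definition transcendence_degree :: "'f ring \<Rightarrow> ('k::zero \<Rightarrow> 'f) \<Rightarrow> enat" where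
  "transcendence_degree R \<phi> =
     (SUP S\<in>{S. finite S \<and> algebraically_independent R \<phi> S}. enat (card S))"

text \<open>The dimension of a variety over \<open>k\<close> with function field \<open>K\<close> is taken to be the
  transcendence degree of \<open>K\<close> over \<open>k\<close>.\<close>

definition function_field_dim :: "('k::zero \<Rightarrow> 'a::field) \<Rightarrow> enat" where
  "function_field_dim \<iota> = transcendence_degree (ring_of_type_algebra :: 'a ring) \<iota>"


section \<open>Real valuations\<close>

text \<open>The value \<open>v 0\<close> is irrelevant throughout.\<close>

definition real_valuation :: "('k::zero \<Rightarrow> 'a::field) \<Rightarrow> ('a \<Rightarrow> real) \<Rightarrow> bool" where
  "real_valuation \<iota> v \<longleftrightarrow>
     (\<forall>x y. x \<noteq> 0 \<and> y \<noteq> 0 \<longrightarrow> v (x * y) = v x + v y) \<and>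
     (\<forall>x y. x \<noteq> 0 \<and> y \<noteq> 0 \<and> x + y \<noteq> 0 \<longrightarrow> min (v x) (v y) \<le> v (x + y)) \<and>
     (\<forall>c. c \<noteq> 0 \<longrightarrow> v (\<iota> c) = 0) \<and>
     (\<exists>x. x \<noteq> 0 \<and> v x \<noteq> 0)"

definition valuation_ring :: "('a::field \<Rightarrow> real) \<Rightarrow> 'a set" where
  "valuation_ring v = {x. x = 0 \<or> v x \<ge> 0}"

definition valuation_ideal :: "('a::field \<Rightarrow> real) \<Rightarrow> 'a set" where
  "valuation_ideal v = {x. x = 0 \<or> v x > 0}"

definition residue_field :: "('a::field \<Rightarrow> real) \<Rightarrow> 'a set ring" where
  "residue_field v = ring_on (valuation_ring v) Quot valuation_ideal v"

definition residue_class :: "('a::field \<Rightarrow> real) \<Rightarrow> 'a \<Rightarrow> 'a set" where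
  "residue_class v x = valuation_ideal v +>\<^bsub>ring_on (valuation_ring v)\<^esub> x"

definition residual_trdeg :: "('k::zero \<Rightarrow> 'a::field) \<Rightarrow> ('a \<Rightarrow> real) \<Rightarrow> enat" where
  "residual_trdeg \<iota> v = transcendence_degree (residue_field v) (\<lambda>c. residue_class v (\<iota> c))"

definition rational_rank :: "('a::field \<Rightarrow> real) \<Rightarrow> enat" where
  "rational_rank v =
     (SUP B\<in>{B. finite B \<and> B \<subseteq> v ` (UNIV - {0}) \<and>
               \<not> module.dependent (\<lambda>(q::rat) (x::real). of_rat q * x) B}. enat (card B))"

definition abhyankar :: "('k::zero \<Rightarrow> 'a::field) \<Rightarrow> ('a \<Rightarrow> real) \<Rightarrow> bool" where
  "abhyankar \<iota> v \<longleftrightarrow> real_valuation \<iota> v \<and>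
     rational_rank v + residual_trdeg \<iota> v = function_field_dim \<iota>"


section \<open>Varieties with function field \<open>K\<close>\<close>

text \<open>
  On an integral scheme the restriction maps between nonempty open sets are injective, and so are
  the maps to the stalk at the generic point. Hence the structure sheaf is recorded as a family of
  subrings \<open>regular Y U\<close> of \<open>K\<close>, for \<open>U\<close> nonempty and open, restriction maps being inclusions.
  The value of \<open>regular Y\<close> on other sets is irrelevant.
\<close>

record ('p, 'a) ringed_space =
  space_of :: "'p topology"
  regular :: "'p set \<Rightarrow> 'a set"

abbreviation nonempty_open :: "('p, 'a) ringed_space \<Rightarrow> 'p set \<Rightarrow> bool" where
  "nonempty_open Y U \<equiv> openin (space_of Y) U \<and> U \<noteq> {}"

definition stalk :: "('p, 'a) ringed_space \<Rightarrow> 'p \<Rightarrow> 'a set" where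
  "stalk Y p = (\<Union>U\<in>{U. openin (space_of Y) U \<and> p \<in> U}. regular Y U)"

definition non_units :: "'a::field set \<Rightarrow> 'a set" where
  "non_units A = {f \<in> A. f = 0 \<or> inverse f \<notin> A}"

definition k_subalgebra :: "('k \<Rightarrow> 'a::field) \<Rightarrow> 'a set \<Rightarrow> bool" where
  "k_subalgebra \<iota> A \<longleftrightarrow> subring A ring_of_type_algebra \<and> range \<iota> \<subseteq> A"

definition spectrum :: "'a::field set \<Rightarrow> 'a set topology" where
  "spectrum A = topology_generated_by
     {{P. primeideal P (ring_on A) \<and> f \<notin> P} | f. f \<in> A}"

text \<open>
  \<open>U\<close> is affine if the canonical morphism from \<open>U\<close> to the spectrum of \<open>regular Y U\<close> is an
  isomorphism: it is a homeomorphism, and it identifies the sections over the basic open subset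
  where \<open>f\<close> is invertible with the localization of \<open>regular Y U\<close> at \<open>f\<close>.
\<close>

definition prime_of_point :: "('p, 'a::field) ringed_space \<Rightarrow> 'p set \<Rightarrow> 'p \<Rightarrow> 'a set" where
  "prime_of_point Y U p = regular Y U \<inter> non_units (stalk Y p)"

definition affine_open :: "('p, 'a::field) ringed_space \<Rightarrow> 'p set \<Rightarrow> bool" where
  "affine_open Y U \<longleftrightarrow> nonempty_open Y U \<and>
     homeomorphic_map (subtopology (space_of Y) U) (spectrum (regular Y U)) (prime_of_point Y U) \<and>
     (\<forall>f\<in>regular Y U. f \<noteq> 0 \<longrightarrow>
        regular Y {p \<in> U. f \<notin> prime_of_point Y U p} = {a / f ^ n | a n. a \<in> regular Y U})"

text \<open>
  Integral schemes over \<open>k\<close> with function field \<open>K\<close>. The third and the fourth condition say that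
  \<open>regular Y\<close> is a sheaf, the last one that \<open>K\<close> is the stalk at the generic point.
\<close>

definition integral_scheme ::
    "('k \<Rightarrow> 'a::field) \<Rightarrow> ('p, 'a) ringed_space \<Rightarrow> bool" where
  "integral_scheme \<iota> Y \<longleftrightarrow>
     (\<forall>U V. nonempty_open Y U \<and> nonempty_open Y V \<longrightarrow> U \<inter> V \<noteq> {}) \<and>
     (\<forall>U. nonempty_open Y U \<longrightarrow> k_subalgebra \<iota> (regular Y U)) \<and>
     (\<forall>U V. nonempty_open Y U \<and> nonempty_open Y V \<and> U \<subseteq> V \<longrightarrow> regular Y V \<subseteq> regular Y U) \<and>
     (\<forall>\<U>. \<U> \<noteq> {} \<and> (\<forall>U\<in>\<U>. nonempty_open Y U) \<longrightarrow>
        (\<Inter>U\<in>\<U>. regular Y U) \<subseteq> regular Y (\<Union>\<U>)) \<and>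
     topspace (space_of Y) \<noteq> {} \<and>
     (\<forall>p\<in>topspace (space_of Y). \<exists>U. affine_open Y U \<and> p \<in> U) \<and>
     (\<Union>U\<in>{U. nonempty_open Y U}. regular Y U) = UNIV"

text \<open>The generated \<open>k\<close>-algebra is \<open>k_subalgebra \<iota> hull S\<close>.\<close>

definition algebraic_variety ::
    "('k \<Rightarrow> 'a::field) \<Rightarrow> ('p, 'a) ringed_space \<Rightarrow> bool" where
  "algebraic_variety \<iota> Y \<longleftrightarrow> integral_scheme \<iota> Y \<and>
     (\<exists>\<U>. finite \<U> \<and> \<Union>\<U> = topspace (space_of Y) \<and>
        (\<forall>U\<in>\<U>. affine_open Y U \<and>
           (\<exists>S. finite S \<and> regular Y U = k_subalgebra \<iota> hull S)))"

text \<open>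
  A morphism over \<open>k\<close> from \<open>Y\<close> to a projective space of dimension \<open>N\<close> is determined by the
  homogeneous coordinates \<open>x 0, \<dots>, x N\<close> in \<open>K\<close> of the image of the generic point. The preimage of
  the \<open>i\<close>-th standard chart is then empty if \<open>x i = 0\<close>, and otherwise it is the set of points at
  which all \<open>x j / x i\<close> are regular. Such coordinates define a morphism if these preimages
  cover \<open>Y\<close>, and the morphism is a closed immersion if moreover each nonempty preimage is affine
  and its ring of regular functions is the image of the coordinate ring of the chart, that is,
  the algebra generated by the \<open>x j / x i\<close>.
\<close>

definition chart ::
    "('p, 'a::field) ringed_space \<Rightarrow> nat \<Rightarrow> (nat \<Rightarrow> 'a) \<Rightarrow> nat \<Rightarrow> 'p set" where
  "chart Y N x i =
     (if x i = 0 then {} else {p \<in> topspace (space_of Y). \<forall>j\<le>N. x j / x i \<in> stalk Y p})"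

definition closed_immersion_into_projective_space ::
    "('k \<Rightarrow> 'a::field) \<Rightarrow> ('p, 'a) ringed_space \<Rightarrow> nat \<Rightarrow> (nat \<Rightarrow> 'a) \<Rightarrow> bool" where
  "closed_immersion_into_projective_space \<iota> Y N x \<longleftrightarrow>
     (\<Union>i\<le>N. chart Y N x i) = topspace (space_of Y) \<and>
     (\<forall>i\<le>N. x i \<noteq> 0 \<longrightarrow> affine_open Y (chart Y N x i) \<and>
        regular Y (chart Y N x i) = k_subalgebra \<iota> hull ((\<lambda>j. x j / x i) ` {..N}))"

definition projective :: "('k \<Rightarrow> 'a::field) \<Rightarrow> ('p, 'a) ringed_space \<Rightarrow> bool" where
  "projective \<iota> Y \<longleftrightarrow> (\<exists>N x. closed_immersion_into_projective_space \<iota> Y N x)"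

definition integrally_closed :: "'a::field set \<Rightarrow> bool" where
  "integrally_closed A \<longleftrightarrow>
     (\<forall>z P. Polynomial.lead_coeff P = 1 \<and> (\<forall>i. Polynomial.coeff P i \<in> A) \<and>
        Polynomial.poly P z = 0 \<longrightarrow> z \<in> A)"

definition normal_scheme :: "('p, 'a::field) ringed_space \<Rightarrow> bool" where
  "normal_scheme Y \<longleftrightarrow> (\<forall>p\<in>topspace (space_of Y). integrally_closed (stalk Y p))"

definition normal_projective_model ::
    "('k \<Rightarrow> 'a::field) \<Rightarrow> ('p, 'a) ringed_space \<Rightarrow> bool" where
  "normal_projective_model \<iota> Y \<longleftrightarrow> algebraic_variety \<iota> Y \<and> projective \<iota> Y \<and> normal_scheme Y"

definition is_center :: "('p, 'a::field) ringed_space \<Rightarrow> ('a \<Rightarrow> real) \<Rightarrow> 'p \<Rightarrow> bool" where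
  "is_center Y v c \<longleftrightarrow> c \<in> topspace (space_of Y) \<and>
     (\<forall>f\<in>stalk Y c - {0}. v f \<ge> 0) \<and> (\<forall>f\<in>non_units (stalk Y c) - {0}. v f > 0)"

definition center :: "('p, 'a::field) ringed_space \<Rightarrow> ('a \<Rightarrow> real) \<Rightarrow> 'p" where
  "center Y v = (THE c. is_center Y v c)"


section \<open>Line bundles\<close>

text \<open>
  A line bundle is given by an open cover on whose members it is trivialized, and by the transition
  functions of these trivializations. A section is given by its components \<open>s i\<close> in the
  trivializations; they are related by \<open>s i = transition L i j * s j\<close>.
\<close>

record ('i, 'p, 'a) line_bundle =
  idx :: "'i set"
  patch :: "'i \<Rightarrow> 'p set"
  transition :: "'i \<Rightarrow> 'i \<Rightarrow> 'a"

definition is_line_bundle ::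
    "('p, 'a::field) ringed_space \<Rightarrow> ('i, 'p, 'a) line_bundle \<Rightarrow> bool" where
  "is_line_bundle Y L \<longleftrightarrow>
     (\<forall>i\<in>idx L. nonempty_open Y (patch L i)) \<and>
     (\<Union>i\<in>idx L. patch L i) = topspace (space_of Y) \<and>
     (\<forall>i\<in>idx L. \<forall>j\<in>idx L. transition L i j \<noteq> 0 \<and>
        transition L i j \<in> regular Y (patch L i \<inter> patch L j) \<and>
        inverse (transition L i j) \<in> regular Y (patch L i \<inter> patch L j)) \<and>
     (\<forall>i\<in>idx L. \<forall>j\<in>idx L. \<forall>l\<in>idx L. transition L i j * transition L j l = transition L i l)"

definition tensor_power ::
    "nat \<Rightarrow> ('i, 'p, 'a::field) line_bundle \<Rightarrow> ('i, 'p, 'a) line_bundle" where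
  "tensor_power m L = L \<lparr> transition := (\<lambda>i j. transition L i j ^ m) \<rparr>"

text \<open>Components at indices outside \<open>idx L\<close> are set to \<open>0\<close>.\<close>

definition global_sections ::
    "('p, 'a::field) ringed_space \<Rightarrow> ('i, 'p, 'a) line_bundle \<Rightarrow> ('i \<Rightarrow> 'a) set" where
  "global_sections Y L =
     {s. (\<forall>i\<in>idx L. s i \<in> regular Y (patch L i)) \<and>
         (\<forall>i\<in>idx L. \<forall>j\<in>idx L. s i = transition L i j * s j) \<and>
         (\<forall>i. i \<notin> idx L \<longrightarrow> s i = 0)}"

definition h0 ::
    "('k::field \<Rightarrow> 'a::field) \<Rightarrow> ('p, 'a) ringed_space \<Rightarrow> ('i, 'p, 'a) line_bundle \<Rightarrow> nat" where
  "h0 \<iota> Y L =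
     vector_space.dim (\<lambda>(c::'k) (s::'i \<Rightarrow> 'a). (\<lambda>i. \<iota> c * s i)) (global_sections Y L)"

text \<open>For a variety \<open>Y\<close> the dimension is finite, so that \<open>the_enat\<close> is meaningful. The term of
  index \<open>0\<close> in the upper limit is irrelevant.\<close>

definition volume ::
    "('k::field \<Rightarrow> 'a::field) \<Rightarrow> ('p, 'a) ringed_space \<Rightarrow> ('i, 'p, 'a) line_bundle \<Rightarrow> ereal" where
  "volume \<iota> Y L = (let n = the_enat (function_field_dim \<iota>) in
     limsup (\<lambda>m. ereal (fact n * real (h0 \<iota> Y (tensor_power m L)) / real m ^ n)))"

definition big ::
    "('k::field \<Rightarrow> 'a::field) \<Rightarrow> ('p, 'a) ringed_space \<Rightarrow> ('i, 'p, 'a) line_bundle \<Rightarrow> bool" where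
  "big \<iota> Y L \<longleftrightarrow> volume \<iota> Y L > 0"

text \<open>
  The value of a section does not depend on the chosen trivialization around the center, since
  transition functions are units there.
\<close>

definition section_value ::
    "('p, 'a::field) ringed_space \<Rightarrow> ('i, 'p, 'a) line_bundle \<Rightarrow> ('a \<Rightarrow> real) \<Rightarrow> ('i \<Rightarrow> 'a) \<Rightarrow> real"
  where
  "section_value Y L v s = v (s (SOME i. i \<in> idx L \<and> center Y v \<in> patch L i))"

text \<open>If \<open>L\<close> has no nonzero section, \<open>a_max Y L v\<close> is \<open>- \<infinity>\<close>.\<close>

definition a_max ::
    "('p, 'a::field) ringed_space \<Rightarrow> ('i, 'p, 'a) line_bundle \<Rightarrow> ('a \<Rightarrow> real) \<Rightarrow> ereal" where
  "a_max Y L v = (SUP s\<in>global_sections Y L - {0}. ereal (section_value Y L v s))"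

definition a_max_asymptotic ::
    "('p, 'a::field) ringed_space \<Rightarrow> ('i, 'p, 'a) line_bundle \<Rightarrow> ('a \<Rightarrow> real) \<Rightarrow> ereal" where
  "a_max_asymptotic Y L v = lim (\<lambda>m. a_max Y (tensor_power m L) v / ereal (real m))"

end

theory Submission
  imports Defs
begin

text \<open>
  Everything is dimension counting. If \<open>S\<close> is finite, the products of \<open>M\<close> elements of \<open>S\<close> span a space
  of dimension \<open>O(M\<^sup>n)\<close>, where \<open>n\<close> is the transcendence degree of \<open>K\<close>. To bound \<open>H\<^sup>0(Y, \<O>(d))\<close> by
  \<open>O(d\<^sup>n)\<close>, take a valuation ring of \<open>K\<close> with residue field \<open>k\<close> in which the monomials in a
  transcendence basis have distinct values. The dimension of a space of sections is the number of its
  values; the powers of a single section \<open>a\<close> times monomials already have too many values unless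
  some bounded power of \<open>a\<close> has the value of a Laurent monomial with exponents \<open>O(d)\<close>.

  For an Abhyankar valuation \<open>v\<close>, elements \<open>F\<close> with rationally independent values and elements \<open>G\<close>
  with algebraically independent residues form a transcendence basis \<open>F \<union> G\<close>, and the value of a
  nonzero polynomial of degree \<open>D\<close> in them is \<open>O(D)\<close>. A section \<open>s\<close> of \<open>m L\<close> satisfies, for dimension
  reasons, a relation \<open>\<Sum>\<^sub>i p\<^sub>i s\<^sup>i = 0\<close> with \<open>p\<^sub>i\<close> polynomials of degree \<open>O(m)\<close> in \<open>F \<union> G\<close>, whence
  \<open>v(s) = O(m)\<close>.

  That the limit exists is superadditivity, once \<open>m L\<close> has sections for all large \<open>m\<close>. If \<open>m L\<close> has
  many sections, each affine coordinate \<open>y\<close> satisfies \<open>\<Sum>\<^sub>i p\<^sub>i y\<^sup>i = 0\<close> with \<open>p\<^sub>i \<in> H\<^sup>0(m L)\<close>; the leading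
  coefficient times \<open>y\<close> is integral over the local rings, hence a section since \<open>Y\<close> is normal. So some
  multiple of \<open>L\<close> contains the hyperplane class.
\<close>

section \<open>Linear algebra over the ground field\<close>

text \<open>The difficulty is uniformity. Elements of \<open>saturated d\<close>, that is, sections
  of O(d), need not be forms of degree d in the coordinates; they become forms only after
  multiplication by forms of a degree that depends on the section. For a fixed z in
  \<open>saturated d\<close>, however, all powers satisfy
  \<open>z ^ i \<in> homog S (b + i * d)\<close> with a single b. High powers make b negligible, so
  the bounds that they give have constants independent of z. These bounds constrain the value of z
  in an auxiliary valuation ring V, and the number of possible values bounds the dimension. V is
  unrelated to v: it is a device for computing dimensions, and it needs residue field k so that
  elements of equal value can be eliminated against each other. Linear relations forced by having
  more elements than the dimension also give the finiteness of the transcendence degree, the bound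
  on v and Kodaira's lemma.\<close>

locale ground_field =
  fixes \<iota> :: "'k::alg_closed_field \<Rightarrow> 'a::field"
  assumes extension: "field_extension \<iota>"
begin

lemma \<iota>_add: "\<iota> (x + y) = \<iota> x + \<iota> y"
  and \<iota>_mult: "\<iota> (x * y) = \<iota> x * \<iota> y"
  and \<iota>_1 [simp]: "\<iota> 1 = 1"
  using extension by (auto simp: field_extension_def ring_hom_def ring_of_type_algebra_def)

lemma \<iota>_0 [simp]: "\<iota> 0 = 0"
  by (metis \<iota>_add add.right_neutral add_left_cancel)

lemma \<iota>_eq_0_iff [simp]: "\<iota> c = 0 \<longleftrightarrow> c = 0"
proof
  assume "\<iota> c = 0"
  then show "c = 0"
    using \<iota>_mult[of c "inverse c"] by (cases "c = 0") auto
qed simp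

lemma \<iota>_uminus: "\<iota> (- x) = - \<iota> x"
  using \<iota>_add[of x "- x"] by (simp add: eq_neg_iff_add_eq_0 add.commute)

lemma \<iota>_diff: "\<iota> (x - y) = \<iota> x - \<iota> y"
  using \<iota>_add[of x "- y"] by (simp add: \<iota>_uminus)

lemma \<iota>_inverse: "\<iota> (inverse x) = inverse (\<iota> x)"
proof (cases "x = 0")
  case False
  then show ?thesis using \<iota>_mult[of x "inverse x"] by (simp add: inverse_unique)
qed simp

sublocale lin: vector_space "\<lambda>c x. \<iota> c * x"
  by unfold_locales (auto simp: \<iota>_add \<iota>_mult algebra_simps)

text \<open>Stated through finite independent subsets rather than \<open>lin.dim\<close>, which is 0
  for spaces of infinite dimension and so cannot express an upper bound. V may be any set, which
  makes passing to subsets immediate.\<close>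

definition dim_at_most :: "'a set \<Rightarrow> nat \<Rightarrow> bool" where
  "dim_at_most V N \<longleftrightarrow> (\<forall>I. I \<subseteq> V \<and> finite I \<and> \<not> lin.dependent I \<longrightarrow> card I \<le> N)"

lemma dim_at_most_mono: "dim_at_most V N \<Longrightarrow> W \<subseteq> V \<Longrightarrow> N \<le> M \<Longrightarrow> dim_at_most W M"
  unfolding dim_at_most_def by (meson le_trans subset_trans)

lemma dim_at_most_span: "finite T \<Longrightarrow> V \<subseteq> lin.span T \<Longrightarrow> card T \<le> N \<Longrightarrow> dim_at_most V N"
  unfolding dim_at_most_def by (metis lin.independent_span_bound le_trans subset_trans)

text \<open>The family is indexed because products such as \<open>z ^ i * mon T \<gamma>\<close> may
  coincide for different indices. A coincidence is itself a relation, with coefficients 1 and -1, so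
  only indices have to be counted.\<close>

lemma dim_at_most_relation:
  fixes f :: "'b \<Rightarrow> 'a"
  assumes V: "dim_at_most V N" and I: "finite I" "f ` I \<subseteq> V" "N < card I"
  shows "\<exists>c. (\<exists>i\<in>I. c i \<noteq> 0) \<and> (\<Sum>i\<in>I. \<iota> (c i) * f i) = 0"
proof (cases "inj_on f I")
  case True
  then have "card (f ` I) = card I" by (rule card_image)
  then have "lin.dependent (f ` I)"
    using V I unfolding dim_at_most_def by (metis finite_imageI not_less)
  then obtain u where u: "\<exists>v\<in>f ` I. u v \<noteq> 0" "(\<Sum>v\<in>f ` I. \<iota> (u v) * v) = 0"
    using lin.dependent_finite[OF finite_imageI[OF I(1)], of f] by blast
  then show ?thesis
    using True by (intro exI[of _ "\<lambda>i. u (f i)"]) (auto simp: sum.reindex)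
next
  case False
  then obtain a b where ab: "a \<in> I" "b \<in> I" "a \<noteq> b" "f a = f b" by (auto simp: inj_on_def)
  define c where "c i = (if i = a then 1 else if i = b then - 1 else 0 :: 'k)" for i
  have "(\<Sum>i\<in>I. \<iota> (c i) * f i) = (\<Sum>i\<in>{a, b}. \<iota> (c i) * f i)"
    using ab I(1) by (intro sum.mono_neutral_right) (auto simp: c_def)
  also have "\<dots> = 0" using ab by (simp add: c_def \<iota>_uminus)
  finally show ?thesis using ab by (intro exI[of _ c]) (auto simp: c_def intro!: bexI[of _ a])
qed

text \<open>Serves for families with denominators: q clears all of them at once and is cancelled
  from the resulting relation.\<close>

lemma dim_at_most_relation_scaled:
  fixes f :: "'b \<Rightarrow> 'a"
  assumes V: "dim_at_most V N" and I: "finite I" "\<And>i. i \<in> I \<Longrightarrow> q * f i \<in> V" "N < card I" and "q \<noteq> 0"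
  shows "\<exists>c. (\<exists>i\<in>I. c i \<noteq> 0) \<and> (\<Sum>i\<in>I. \<iota> (c i) * f i) = 0"
proof -
  obtain c where c: "\<exists>i\<in>I. c i \<noteq> 0" "(\<Sum>i\<in>I. \<iota> (c i) * (q * f i)) = 0"
    using dim_at_most_relation[OF V I(1) _ I(3), of "\<lambda>i. q * f i"] I(2) by (auto simp: image_subset_iff)
  have "q * (\<Sum>i\<in>I. \<iota> (c i) * f i) = 0"
    using c(2) by (simp add: sum_distrib_left mult_ac)
  then show ?thesis using c(1) \<open>q \<noteq> 0\<close> by auto
qed

lemma span_mult:
  assumes "x \<in> lin.span A" "y \<in> lin.span B" "\<And>a b. a \<in> A \<Longrightarrow> b \<in> B \<Longrightarrow> a * b \<in> lin.span C"
  shows "x * y \<in> lin.span C"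
proof -
  have 1: "a * y \<in> lin.span C" if "a \<in> A" for a
    using assms(2)
  proof (induction rule: lin.span_induct_alt)
    case (step c b y)
    then show ?case
      using lin.span_add[OF lin.span_scale[OF assms(3)[OF that step(1)], of c] step(2)]
      by (simp add: algebra_simps)
  qed (simp add: lin.span_zero)
  show ?thesis
    using assms(1)
  proof (induction rule: lin.span_induct_alt)
    case (step c b x)
    then show ?case
      using lin.span_add[OF lin.span_scale[OF 1[OF step(1)], of c] step(2)]
      by (simp add: algebra_simps)
  qed (simp add: lin.span_zero)
qed


section \<open>Monomials and growth\<close>

definition mon :: "'a set \<Rightarrow> ('a \<Rightarrow> nat) \<Rightarrow> 'a" where
  "mon S \<alpha> = (\<Prod>s\<in>S. s ^ \<alpha> s)"

lemma mon_0 [simp]: "mon S (\<lambda>_. 0) = 1"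
  by (simp add: mon_def)

lemma mon_add: "mon S \<alpha> * mon S \<beta> = mon S (\<lambda>s. \<alpha> s + \<beta> s)"
  by (simp add: mon_def power_add prod.distrib)

lemma mon_single: "finite S \<Longrightarrow> s \<in> S \<Longrightarrow> mon S (\<lambda>x. if x = s then i else 0) = s ^ i"
  unfolding mon_def by (subst prod.remove[of S s]) (auto intro!: prod.neutral)

lemma mon_cong: "(\<And>s. s \<in> S \<Longrightarrow> \<alpha> s = \<beta> s) \<Longrightarrow> mon S \<alpha> = mon S \<beta>"
  by (simp add: mon_def)

lemma mon_upd:
  assumes "finite S" "s \<in> S"
  shows "mon S (\<alpha>(s := \<alpha> s + i)) = s ^ i * mon S \<alpha>"
proof -
  have "s ^ i * mon S \<alpha> = mon S (\<lambda>x. (if x = s then i else 0) + \<alpha> x)"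
    by (simp add: mon_single[OF assms, symmetric] mon_add)
  also have "\<dots> = mon S (\<alpha>(s := \<alpha> s + i))"
    by (rule mon_cong) auto
  finally show ?thesis ..
qed

text \<open>The image in K of the forms of degree M in the elements of S. Inside K there is no
  grading: once S contains 1, these are the polynomials of degree at most M, and the spaces grow
  with M.\<close>

definition homog :: "'a set \<Rightarrow> nat \<Rightarrow> 'a set" where
  "homog S M = lin.span {mon S \<alpha> |\<alpha>. sum \<alpha> S = M}"

lemma homog_mult: "x \<in> homog S M \<Longrightarrow> y \<in> homog S M' \<Longrightarrow> x * y \<in> homog S (M + M')"
  unfolding homog_def
proof (rule span_mult, assumption, assumption)
  fix a b assume "a \<in> {mon S \<alpha> |\<alpha>. sum \<alpha> S = M}" "b \<in> {mon S \<alpha> |\<alpha>. sum \<alpha> S = M'}"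
  then obtain \<alpha> \<beta> where "a = mon S \<alpha>" "b = mon S \<beta>" "sum \<alpha> S = M" "sum \<beta> S = M'" by auto
  then have "a * b = mon S (\<lambda>s. \<alpha> s + \<beta> s)" "sum (\<lambda>s. \<alpha> s + \<beta> s) S = M + M'"
    by (simp_all add: mon_add sum.distrib)
  then show "a * b \<in> lin.span {mon S \<alpha> |\<alpha>. sum \<alpha> S = M + M'}"
    by (intro lin.span_base CollectI exI conjI)
qed

lemma homog_power: "x \<in> homog S M \<Longrightarrow> x ^ i \<in> homog S (i * M)"
proof (induction i)
  case 0
  have "1 = mon S (\<lambda>_. 0)" "sum (\<lambda>_. 0) S = (0 :: nat)" by simp_all
  then show ?case unfolding homog_def power_0 mult_0 by (intro lin.span_base CollectI exI conjI)
qed (auto intro: homog_mult)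

lemma homog_prod:
  "finite A \<Longrightarrow> (\<And>i. i \<in> A \<Longrightarrow> f i \<in> homog S (d i)) \<Longrightarrow> prod f A \<in> homog S (sum d A)"
proof (induction A rule: finite_induct)
  case empty
  \<comment> \<open>\<open>0 ^ 0 = 1\<close>, so the power lemma with exponent 0 gives 1 in degree
    0.\<close>
  show ?case using homog_power[of 0 S 0 0] by (simp add: homog_def lin.span_zero)
qed (auto intro: homog_mult)

lemma homog_subspace: "lin.subspace (homog S M)"
  by (simp add: homog_def)

lemma homog_generator: "finite S \<Longrightarrow> s \<in> S \<Longrightarrow> s \<in> homog S 1"
  unfolding homog_def
  by (rule lin.span_base, rule CollectI, rule exI[of _ "\<lambda>x. if x = s then 1 else 0"])
     (simp add: mon_single)

lemma homog_1: "finite S \<Longrightarrow> 1 \<in> S \<Longrightarrow> 1 \<in> homog S M"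
  using homog_power[of 1 S 1 M] homog_generator by simp

lemma homog_mono:
  assumes "finite S" "1 \<in> S" "M \<le> M'" "x \<in> homog S M"
  shows "x \<in> homog S M'"
  using homog_mult[OF assms(4) homog_1[OF assms(1,2), of "M' - M"]] assms(3) by simp

text \<open>Each exponent is bounded separately, so that there are exactly
  \<open>(D + 1) ^ card T\<close> of them. The value 0 outside T makes an element determined by its
  restriction to T.\<close>

definition exps :: "'a set \<Rightarrow> nat \<Rightarrow> ('a \<Rightarrow> nat) set" where
  "exps T D = {\<gamma>. (\<forall>x\<in>T. \<gamma> x \<le> D) \<and> (\<forall>x. x \<notin> T \<longrightarrow> \<gamma> x = 0)}"

lemma bij_exps:
  "bij_betw (\<lambda>\<gamma> x. if x \<in> T then \<gamma> x else 0) (T \<rightarrow>\<^sub>E {..D}) (exps T D)"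
  by (rule bij_betw_byWitness[where f' = "\<lambda>\<gamma>. restrict \<gamma> T"])
     (auto simp: exps_def fun_eq_iff PiE_def extensional_def restrict_def Pi_def)

lemma finite_exps [simp]: "finite T \<Longrightarrow> finite (exps T D)"
  using bij_betw_finite[OF bij_exps[of T D]] by (simp add: finite_PiE)

lemma card_exps: "finite T \<Longrightarrow> card (exps T D) = (D + 1) ^ card T"
  using bij_betw_same_card[OF bij_exps[of T D]] by (simp add: card_PiE)

lemma exps_mono: "D \<le> D' \<Longrightarrow> exps T D \<subseteq> exps T D'"
  by (auto simp: exps_def)

text \<open>Works with coefficient functions on boxes of exponents instead of polynomial mappings;
  \<open>algebraically_independent_iff\<close> gives the equivalence with
  \<open>algebraically_independent\<close>.\<close>

definition alg_indep :: "'a set \<Rightarrow> bool" where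
  "alg_indep T \<longleftrightarrow> (\<forall>D c. (\<Sum>\<gamma>\<in>exps T D. \<iota> (c \<gamma>) * mon T \<gamma>) = 0 \<longrightarrow> (\<forall>\<gamma>\<in>exps T D. c \<gamma> = 0))"

definition box :: "'a set \<Rightarrow> nat \<Rightarrow> 'a set" where
  "box T D = lin.span (mon T ` exps T D)"

lemma box_mult: "x \<in> box T D \<Longrightarrow> y \<in> box T D' \<Longrightarrow> x * y \<in> box T (D + D')"
  unfolding box_def
proof (rule span_mult, assumption, assumption)
  fix a b assume "a \<in> mon T ` exps T D" "b \<in> mon T ` exps T D'"
  then obtain \<alpha> \<beta> where "a = mon T \<alpha>" "b = mon T \<beta>" "\<alpha> \<in> exps T D" "\<beta> \<in> exps T D'" by auto
  then show "a * b \<in> lin.span (mon T ` exps T (D + D'))"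
    by (intro lin.span_base) (auto simp: mon_add exps_def intro!: imageI add_mono)
qed

lemma box_mono: "D \<le> D' \<Longrightarrow> box T D \<subseteq> box T D'"
  unfolding box_def by (intro lin.span_mono image_mono exps_mono)

lemma box_1: "1 \<in> box T D"
  unfolding box_def by (rule lin.span_base) (auto simp: exps_def intro!: image_eqI[of _ _ "\<lambda>_. 0"])

lemma box_prod:
  "finite A \<Longrightarrow> (\<And>i. i \<in> A \<Longrightarrow> f i \<in> box T D) \<Longrightarrow> prod f A \<in> box T (card A * D)"
proof (induction A rule: finite_induct)
  case empty
  show ?case using box_1 by simp
qed (auto intro: box_mult)

lemma box_sumI: "finite T \<Longrightarrow> (\<Sum>\<gamma>\<in>exps T D. \<iota> (c \<gamma>) * mon T \<gamma>) \<in> box T D"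
  unfolding box_def by (intro lin.span_sum lin.span_scale lin.span_base) auto


lemma dim_at_most_scale:
  assumes "dim_at_most W N" "q \<noteq> 0" "\<And>x. x \<in> V \<Longrightarrow> q * x \<in> W"
  shows "dim_at_most V N"
  unfolding dim_at_most_def
proof (intro allI impI)
  fix I assume I: "I \<subseteq> V \<and> finite I \<and> \<not> lin.dependent I"
  show "card I \<le> N"
  proof (rule ccontr)
    assume "\<not> card I \<le> N"
    then obtain c where "\<exists>i\<in>I. c i \<noteq> 0" "(\<Sum>i\<in>I. \<iota> (c i) * i) = 0"
      using dim_at_most_relation_scaled[OF assms(1), of I q "\<lambda>x. x"] I assms(2,3)
      by (auto simp: subset_iff)
    then show False using I lin.dependent_finite[of I] by blast
  qed
qed

text \<open>Isolates the top term, in preparation for multiplication by its coefficient. The top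
  index is positive, since a relation of degree 0 would say that its only coefficient
  vanishes.\<close>

lemma leading_coefficient:
  fixes p :: "nat \<Rightarrow> 'a"
  assumes "(\<Sum>i\<le>e. p i * y ^ i) = 0" "i \<le> e" "p i \<noteq> 0"
  obtains e' where "0 < e'" "e' \<le> e" "p e' \<noteq> 0" "p e' * y ^ e' = (\<Sum>i<e'. - p i * y ^ i)"
proof -
  define e' where "e' = (GREATEST i. i \<le> e \<and> p i \<noteq> 0)"
  have e': "e' \<le> e \<and> p e' \<noteq> 0"
    unfolding e'_def using GreatestI_nat[of "\<lambda>i. i \<le> e \<and> p i \<noteq> 0" i e] assms by blast
  have max: "p j = 0" if "e' < j" "j \<le> e" for j
    using Greatest_le_nat[of "\<lambda>i. i \<le> e \<and> p i \<noteq> 0" j e] that unfolding e'_def by fastforce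
  have "(\<Sum>i\<le>e. p i * y ^ i) = (\<Sum>i\<le>e'. p i * y ^ i)"
    using e' max by (intro sum.mono_neutral_right) (auto simp: not_le)
  also have "\<dots> = (\<Sum>i<e'. p i * y ^ i) + p e' * y ^ e'"
    by (simp add: lessThan_Suc_atMost[symmetric])
  finally have eq: "p e' * y ^ e' = (\<Sum>i<e'. - p i * y ^ i)"
    using assms(1) by (simp add: sum_negf eq_neg_iff_add_eq_0 add.commute)
  have "0 < e'"
  proof (rule ccontr)
    assume "\<not> 0 < e'"
    then show False using eq e' by simp
  qed
  then show thesis using that e' eq by blast
qed

lemma box_eq:
  assumes T: "finite T" and p: "p \<in> box T D"
  shows "\<exists>c. p = (\<Sum>\<gamma>\<in>exps T D. \<iota> (c \<gamma>) * mon T \<gamma>)"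
  using p unfolding box_def
proof (induction rule: lin.span_induct_alt)
  case base
  show ?case by (rule exI[of _ "\<lambda>_. 0"]) simp
next
  case (step a m p)
  then obtain c \<gamma> where c: "p = (\<Sum>\<gamma>\<in>exps T D. \<iota> (c \<gamma>) * mon T \<gamma>)"
    and \<gamma>: "\<gamma> \<in> exps T D" "m = mon T \<gamma>" by auto
  have "(\<Sum>\<delta>\<in>exps T D. \<iota> ((c(\<gamma> := a + c \<gamma>)) \<delta>) * mon T \<delta>) =
    (\<Sum>\<delta>\<in>exps T D. \<iota> (c \<delta>) * mon T \<delta> + (if \<delta> = \<gamma> then \<iota> a * m else 0))"
    by (rule sum.cong) (auto simp: \<gamma> \<iota>_add algebra_simps)
  also have "\<dots> = \<iota> a * m + p"
    using \<gamma> T by (simp add: sum.distrib c add.commute)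
  finally have "(\<Sum>\<delta>\<in>exps T D. \<iota> ((c(\<gamma> := a + c \<gamma>)) \<delta>) * mon T \<delta>) = \<iota> a * m + p" .
  then show ?case by metis
qed

lemma bij_exps_insert:
  assumes "s \<notin> T"
  shows "bij_betw (\<lambda>(i, \<gamma>). \<gamma>(s := i)) ({..D} \<times> exps T D) (exps (insert s T) D)"
  using assms
  by (intro bij_betw_byWitness[where f' = "\<lambda>\<gamma>. (\<gamma> s, \<gamma>(s := 0))"])
     (auto simp: exps_def fun_eq_iff)

lemma sum_exps_insert:
  fixes f :: "('a \<Rightarrow> nat) \<Rightarrow> 'a"
  assumes "s \<notin> T"
  shows "(\<Sum>\<gamma>\<in>exps (insert s T) D. f \<gamma>) = (\<Sum>i\<le>D. \<Sum>\<gamma>\<in>exps T D. f (\<gamma>(s := i)))"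
  by (subst sum.reindex_bij_betw[OF bij_exps_insert[OF assms], symmetric])
     (simp add: sum.cartesian_product case_prod_unfold)

lemma mon_insert:
  "finite T \<Longrightarrow> s \<notin> T \<Longrightarrow> mon (insert s T) (\<gamma>(s := i)) = mon T \<gamma> * s ^ i"
  by (simp add: mon_def mult.commute) (intro disjI2 prod.cong, auto)

lemma alg_indep_empty: "alg_indep {}"
proof -
  have "exps {} D = {\<lambda>_. 0}" for D by (auto simp: exps_def)
  then show ?thesis by (simp add: alg_indep_def)
qed

text \<open>Sorted by powers of s, a dependence relation has polynomials in T as coefficients.
  Independence of T makes one of them nonzero, so the relation has a genuine leading coefficient,
  which becomes q.\<close>

lemma algebraic_relation:
  assumes T: "finite T" "alg_indep T" and s: "s \<notin> T" "\<not> alg_indep (insert s T)"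
  shows "\<exists>e D q p. 0 < e \<and> q \<noteq> 0 \<and> q \<in> box T D \<and> (\<forall>i<e. p i \<in> box T D) \<and>
    q * s ^ e = (\<Sum>i<e. p i * s ^ i)"
proof -
  obtain D c \<gamma>\<^sub>0 where c: "(\<Sum>\<gamma>\<in>exps (insert s T) D. \<iota> (c \<gamma>) * mon (insert s T) \<gamma>) = 0"
    and \<gamma>\<^sub>0: "\<gamma>\<^sub>0 \<in> exps (insert s T) D" "c \<gamma>\<^sub>0 \<noteq> 0"
    using s(2) unfolding alg_indep_def by blast
  define p where "p i = (\<Sum>\<gamma>\<in>exps T D. \<iota> (c (\<gamma>(s := i))) * mon T \<gamma>)" for i
  have 0: "(\<Sum>i\<le>D. p i * s ^ i) = 0"
    using c by (simp add: sum_exps_insert[OF s(1)] mon_insert[OF T(1) s(1)] p_def sum_distrib_left mult_ac)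
  have "\<gamma>\<^sub>0(s := 0) \<in> exps T D" "c ((\<gamma>\<^sub>0(s := 0))(s := \<gamma>\<^sub>0 s)) \<noteq> 0" "\<gamma>\<^sub>0 s \<le> D"
    using \<gamma>\<^sub>0 by (auto simp: exps_def)
  then have "p (\<gamma>\<^sub>0 s) \<noteq> 0" "\<gamma>\<^sub>0 s \<le> D"
    using T(2)[unfolded alg_indep_def, rule_format, where c = "\<lambda>\<gamma>. c (\<gamma>(s := \<gamma>\<^sub>0 s))" and D = D]
    unfolding p_def by blast+
  then obtain e where "0 < e" "e \<le> D" "p e \<noteq> 0" "p e * s ^ e = (\<Sum>i<e. - p i * s ^ i)"
    using leading_coefficient[OF 0] by blast
  moreover have "p i \<in> box T D" for i
    unfolding p_def by (rule box_sumI[OF T(1)])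
  moreover have "- x \<in> box T D" if "x \<in> box T D" for x
    using that unfolding box_def by (rule lin.span_neg)
  ultimately show ?thesis
    by (intro exI[of _ e] exI[of _ D] exI[of _ "p e"] exI[of _ "\<lambda>i. - p i"]) auto
qed

section \<open>Growth of the spaces spanned by monomials of degree M\<close>

lemma maximal_alg_indep:
  assumes "finite S"
  obtains T where "T \<subseteq> S" "alg_indep T" "\<And>s. s \<in> S - T \<Longrightarrow> \<not> alg_indep (insert s T)"
proof -
  have "finite {T. T \<subseteq> S \<and> alg_indep T}" using assms by simp
  moreover have "{T. T \<subseteq> S \<and> alg_indep T} \<noteq> {}" using alg_indep_empty by blast
  ultimately obtain T where T: "T \<in> {T. T \<subseteq> S \<and> alg_indep T}"
    "\<And>T'. T' \<in> {T. T \<subseteq> S \<and> alg_indep T} \<Longrightarrow> T \<subseteq> T' \<Longrightarrow> T = T'"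
    using finite_has_maximal[of "{T. T \<subseteq> S \<and> alg_indep T}"] by metis
  then show thesis by (intro that[of T]) blast+
qed

text \<open>Take T maximal independent in S. Each s satisfies an equation of degree
  \<open>e s\<close> over the polynomials in T, so at the cost of a factor \<open>q s\<close>
  exponents of s can be kept below \<open>e s\<close>, while the degree in T grows by a bounded
  amount per step. After M steps the products lie in a space of dimension at most
  \<open>(D\<^sub>1 * M + 1) ^ card T * card R\<close>.\<close>

lemma growth:
  assumes S: "finite S"
  shows "\<exists>T C. T \<subseteq> S \<and> alg_indep T \<and> (\<forall>M\<ge>1. dim_at_most (homog S M) (C * M ^ card T))"
proof -
  obtain T where T: "T \<subseteq> S" "alg_indep T" "\<And>s. s \<in> S - T \<Longrightarrow> \<not> alg_indep (insert s T)"
    using maximal_alg_indep[OF S] by blast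
  have fT: "finite T" using S T(1) finite_subset by blast
  have "\<forall>s\<in>S. \<exists>e D q p. 0 < e \<and> q \<noteq> 0 \<and> q \<in> box T D \<and> (\<forall>i<e. p i \<in> box T D) \<and>
    q * s ^ e = (\<Sum>i<e. p i * s ^ i)"
  proof
    fix s assume that: "s \<in> S"
    show "\<exists>e D q p. 0 < e \<and> q \<noteq> 0 \<and> q \<in> box T D \<and> (\<forall>i<e. p i \<in> box T D) \<and>
      q * s ^ e = (\<Sum>i<e. p i * s ^ i)"
    proof (cases "s \<in> T")
      case True
      \<comment> \<open>Elements of T satisfy the trivial equation \<open>1 * s ^ 1 = s\<close>, so
        that all of S can be treated alike.\<close>
      have "s \<in> box T 1"
        using True fT unfolding box_def
        by (intro lin.span_base image_eqI[of _ _ "\<lambda>x. if x = s then 1 else 0"])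
           (auto simp: mon_single exps_def)
      then show ?thesis
        by (intro exI[of _ 1] exI[of _ "1::'a"] exI[of _ "\<lambda>_. s"]) (use box_1 in auto)
    next
      case False
      then have "\<not> alg_indep (insert s T)" using T(3) that by blast
      then show ?thesis by (rule algebraic_relation[OF fT T(2) False])
    qed
  qed
  then obtain e D q p where rel0: "\<forall>s\<in>S. 0 < e s \<and> q s \<noteq> 0 \<and> q s \<in> box T (D s) \<and>
    (\<forall>i<e s. p s i \<in> box T (D s)) \<and> q s * s ^ e s = (\<Sum>i<e s. p s i * s ^ i)"
    unfolding bchoice_iff by blast
  then have rel: "s \<in> S \<Longrightarrow> 0 < e s \<and> q s \<noteq> 0 \<and> q s \<in> box T (D s) \<and>
    (\<forall>i<e s. p s i \<in> box T (D s)) \<and> q s * s ^ e s = (\<Sum>i<e s. p s i * s ^ i)" for s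
    by blast
  define D\<^sub>0 where "D\<^sub>0 = sum D S"
  have D\<^sub>0: "box T (D s) \<subseteq> box T D\<^sub>0" if "s \<in> S" for s
    unfolding D\<^sub>0_def using S that by (intro box_mono member_le_sum) auto
  define R where "R = {\<beta>. (\<forall>s\<in>S. \<beta> s < e s) \<and> (\<forall>s. s \<notin> S \<longrightarrow> \<beta> s = 0)}"
  have "R \<subseteq> exps S (sum e S)"
  proof
    fix \<beta> assume \<beta>: "\<beta> \<in> R"
    have "\<beta> s \<le> sum e S" if "s \<in> S" for s
      using \<beta> that member_le_sum[of s S e] S unfolding R_def by fastforce
    then show "\<beta> \<in> exps S (sum e S)" using \<beta> by (simp add: R_def exps_def)
  qed
  then have fR: "finite R" using S by (rule finite_subset[OF _ finite_exps])
  define E where "E d = lin.span ((\<lambda>(\<gamma>, \<beta>). mon T \<gamma> * mon S \<beta>) ` (exps T d \<times> R))" for d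
  have E_base: "mon T \<gamma> * mon S \<beta> \<in> E d" if "\<gamma> \<in> exps T d" "\<beta> \<in> R" for \<gamma> \<beta> d
    using that unfolding E_def by (intro lin.span_base) auto
  have E_box: "x * z \<in> E (a + d)" if "x \<in> box T a" "z \<in> E d" for x z a d
    unfolding E_def
  proof (rule span_mult[OF that[unfolded box_def E_def]])
    fix x z assume "x \<in> mon T ` exps T a" "z \<in> (\<lambda>(\<gamma>, \<beta>). mon T \<gamma> * mon S \<beta>) ` (exps T d \<times> R)"
    then obtain \<alpha> \<gamma> \<beta> where "x = mon T \<alpha>" "z = mon T \<gamma> * mon S \<beta>" "\<alpha> \<in> exps T a" "\<gamma> \<in> exps T d" "\<beta> \<in> R"
      by auto
    moreover from this have "(\<lambda>s. \<alpha> s + \<gamma> s) \<in> exps T (a + d)" by (auto simp: exps_def add_mono)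
    ultimately show "x * z \<in> lin.span ((\<lambda>(\<gamma>, \<beta>). mon T \<gamma> * mon S \<beta>) ` (exps T (a + d) \<times> R))"
      using E_base[unfolded E_def] by (simp add: mult.assoc[symmetric] mon_add)
  qed
  have E_gen: "q s * s * z \<in> E (D\<^sub>0 + d)" if s: "s \<in> S" and z: "z \<in> E d" for s z d
    unfolding E_def
  proof (rule span_mult[OF lin.span_base[of "q s * s" "{q s * s}"] z[unfolded E_def]])
    fix x z assume "x \<in> {q s * s}" "z \<in> (\<lambda>(\<gamma>, \<beta>). mon T \<gamma> * mon S \<beta>) ` (exps T d \<times> R)"
    then obtain \<gamma> \<beta> where x: "x = q s * s" and z: "z = mon T \<gamma> * mon S \<beta>" and \<gamma>: "\<gamma> \<in> exps T d" and \<beta>: "\<beta> \<in> R"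
      by auto
    have R_upd: "\<beta>(s := i) \<in> R" if "i < e s" for i
      using \<beta> s that by (auto simp: R_def)
    show "x * z \<in> lin.span ((\<lambda>(\<gamma>, \<beta>). mon T \<gamma> * mon S \<beta>) ` (exps T (D\<^sub>0 + d) \<times> R))"
      unfolding E_def[symmetric]
    proof (cases "\<beta> s + 1 < e s")
      case True
      have "x * z = q s * (mon T \<gamma> * mon S (\<beta>(s := \<beta> s + 1)))"
        by (simp only: x z mon_upd[OF S s] power_one_right mult_ac)
      also have "\<dots> \<in> E (D\<^sub>0 + d)"
        using rel[OF s] D\<^sub>0[OF s] by (intro E_box E_base \<gamma> R_upd True) blast
      finally show "x * z \<in> E (D\<^sub>0 + d)" .
    next
      \<comment> \<open>The exponent of s is already maximal, so multiplication by s produces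
        \<open>s ^ e s\<close>, which the equation of s replaces by lower powers.\<close>
      case False
      define \<beta>' where "\<beta>' = \<beta>(s := 0)"
      have e: "e s = Suc (\<beta> s)" using False \<beta> s by (force simp: R_def)
      have upd: "mon S (\<beta>(s := i)) = s ^ i * mon S \<beta>'" for i
        using mon_upd[OF S s, of \<beta>' i] by (simp add: \<beta>'_def)
      have "x * z = (q s * s ^ e s) * (mon T \<gamma> * mon S \<beta>')"
        using upd[of "\<beta> s"] by (simp add: x z e mult_ac)
      also have "\<dots> = (\<Sum>i<e s. p s i * (mon T \<gamma> * mon S (\<beta>(s := i))))"
        using rel[OF s] by (simp add: sum_distrib_right sum_distrib_left upd mult_ac)
      also have "\<dots> \<in> E (D\<^sub>0 + d)"
        using rel[OF s] D\<^sub>0[OF s]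
        by (subst E_def, intro lin.span_sum, fold E_def, intro E_box E_base \<gamma> R_upd) auto
      finally show "x * z \<in> E (D\<^sub>0 + d)" .
    qed
  qed simp
  define q\<^sub>0 where "q\<^sub>0 = prod q S"
  have "q\<^sub>0 \<noteq> 0" unfolding q\<^sub>0_def using S rel by auto
  \<comment> \<open>Multiplication by \<open>q\<^sub>0 * s\<close> spends the factor
    \<open>q s\<close> on the reduction, at the cost of \<open>D\<^sub>0\<close>; the other
    denominators cost at most \<open>card S * D\<^sub>0\<close>.\<close>
  define D\<^sub>1 where "D\<^sub>1 = card S * D\<^sub>0 + D\<^sub>0"
  have E_mono: "E d \<subseteq> E d'" if "d \<le> d'" for d d'
    using E_box[OF box_1, of _ d "d' - d"] that by auto
  have E_step: "q\<^sub>0 * s * z \<in> E (D\<^sub>1 + d)" if s: "s \<in> S" and z: "z \<in> E d" for s z d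
  proof -
    have "prod q (S - {s}) \<in> box T (card (S - {s}) * D\<^sub>0)"
      using S rel D\<^sub>0 by (intro box_prod) blast+
    then have "prod q (S - {s}) * (q s * s * z) \<in> E (card (S - {s}) * D\<^sub>0 + (D\<^sub>0 + d))"
      by (rule E_box[OF _ E_gen[OF s z]])
    moreover have "card (S - {s}) * D\<^sub>0 + (D\<^sub>0 + d) \<le> D\<^sub>1 + d"
      using S by (auto simp: D\<^sub>1_def intro!: mult_le_mono1 card_mono)
    moreover have "q\<^sub>0 * s * z = prod q (S - {s}) * (q s * s * z)"
      unfolding q\<^sub>0_def by (subst prod.remove[OF S s]) (simp add: mult_ac)
    ultimately show ?thesis using E_mono by (metis subsetD)
  qed
  have mon_E: "q\<^sub>0 ^ M * mon S \<alpha> \<in> E (D\<^sub>1 * M)" if "sum \<alpha> S = M" for M \<alpha>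
    using that
  proof (induction M arbitrary: \<alpha>)
    case 0
    then have "mon S \<alpha> = 1" using S by (auto simp: mon_def)
    moreover have "mon T (\<lambda>_. 0) * mon S (\<lambda>_. 0) \<in> E 0"
      using rel by (intro E_base) (auto simp: exps_def R_def)
    ultimately show ?case by simp
  next
    case (Suc M)
    then obtain s where s: "s \<in> S" "\<alpha> s > 0" by (metis not_gr_zero sum.neutral nat.simps(3))
    define \<alpha>' where "\<alpha>' = \<alpha>(s := \<alpha> s - 1)"
    have "sum \<alpha>' (S - {s}) = sum \<alpha> (S - {s})" unfolding \<alpha>'_def by (rule sum.cong) auto
    then have "sum \<alpha>' S = M"
      using Suc.prems s sum.remove[OF S s(1), of \<alpha>] sum.remove[OF S s(1), of \<alpha>'] by (simp add: \<alpha>'_def)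
    moreover have "mon S \<alpha> = s * mon S \<alpha>'"
      using mon_upd[OF S s(1), of \<alpha>' 1] s(2) by (simp add: \<alpha>'_def)
    ultimately show ?case
      using E_step[OF s(1) Suc.IH[of \<alpha>']] by (simp add: mult_ac)
  qed
  have homog_E: "q\<^sub>0 ^ M * x \<in> E (D\<^sub>1 * M)" if "x \<in> homog S M" for x M
    unfolding E_def
    by (rule span_mult[OF lin.span_base[OF singletonI] that[unfolded homog_def]])
       (use mon_E[unfolded E_def] in auto)
  define C where "C = (D\<^sub>1 + 1) ^ card T * card R"
  have "dim_at_most (homog S M) (C * M ^ card T)" if "M \<ge> 1" for M
  proof (rule dim_at_most_scale[of "E (D\<^sub>1 * M)" _ "q\<^sub>0 ^ M"])
    have "card ((\<lambda>(\<gamma>, \<beta>). mon T \<gamma> * mon S \<beta>) ` (exps T (D\<^sub>1 * M) \<times> R)) \<le> (D\<^sub>1 * M + 1) ^ card T * card R"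
      using fT fR card_image_le[of "exps T (D\<^sub>1 * M) \<times> R"] by (simp add: card_cartesian_product card_exps)
    also have "\<dots> \<le> ((D\<^sub>1 + 1) * M) ^ card T * card R"
      using that by (intro mult_le_mono1 power_mono) auto
    finally have "card ((\<lambda>(\<gamma>, \<beta>). mon T \<gamma> * mon S \<beta>) ` (exps T (D\<^sub>1 * M) \<times> R)) \<le> C * M ^ card T"
      by (simp only: C_def power_mult_distrib mult_ac)
    then show "dim_at_most (E (D\<^sub>1 * M)) (C * M ^ card T)"
      using fT fR by (intro dim_at_most_span[OF _ _ ]) (auto simp: E_def)
  qed (use \<open>q\<^sub>0 \<noteq> 0\<close> homog_E in auto)
  then show ?thesis using T by blast
qed

end

section \<open>Valuation rings\<close>

text \<open>The pairs, a subring of K with a proper ideal of it, that Zorn's lemma maximizes in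
  Chevalley's extension theorem.\<close>

definition sub_ideal :: "'a::field set \<Rightarrow> 'a set \<Rightarrow> bool" where
  "sub_ideal R J \<longleftrightarrow> 1 \<in> R \<and> (\<forall>x\<in>R. \<forall>y\<in>R. x + y \<in> R \<and> x * y \<in> R \<and> - x \<in> R) \<and>
     J \<subseteq> R \<and> 0 \<in> J \<and> (\<forall>x\<in>J. \<forall>y\<in>J. x + y \<in> J) \<and> (\<forall>x\<in>R. \<forall>y\<in>J. x * y \<in> J) \<and> 1 \<notin> J"

lemma sub_idealD:
  assumes "sub_ideal R J"
  shows "1 \<in> R" "x \<in> R \<Longrightarrow> y \<in> R \<Longrightarrow> x + y \<in> R" "x \<in> R \<Longrightarrow> y \<in> R \<Longrightarrow> x * y \<in> R" "x \<in> R \<Longrightarrow> - x \<in> R"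
    "x \<in> J \<Longrightarrow> x \<in> R" "0 \<in> J" "x \<in> J \<Longrightarrow> y \<in> J \<Longrightarrow> x + y \<in> J" "x \<in> R \<Longrightarrow> y \<in> J \<Longrightarrow> x * y \<in> J" "1 \<notin> J"
  using assms unfolding sub_ideal_def by blast+

lemma sub_ideal_sum:
  assumes "sub_ideal R J"
  shows "(\<And>i. i \<in> A \<Longrightarrow> f i \<in> J) \<Longrightarrow> sum f A \<in> J"
    and "(\<And>i. i \<in> A \<Longrightarrow> f i \<in> R) \<Longrightarrow> sum f A \<in> R"
  by (induction A rule: infinite_finite_induct) (auto intro: sub_idealD[OF assms])

text \<open>The pair is \<open>R[x]\<close> with the extended ideal \<open>J R[x]\<close>. Every
  requirement passes to polynomials coefficientwise except properness, which is the hypothesis on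
  x.\<close>

lemma sub_ideal_adjoin:
  assumes RJ: "sub_ideal R J" and x: "\<And>p. (\<And>i. Polynomial.coeff p i \<in> J) \<Longrightarrow> Polynomial.poly p x \<noteq> 1"
  shows "sub_ideal {Polynomial.poly p x |p. \<forall>i. Polynomial.coeff p i \<in> R} {Polynomial.poly p x |p. \<forall>i. Polynomial.coeff p i \<in> J}"
proof -
  note RJ' = sub_idealD[OF RJ]
  have 0: "0 \<in> R" using RJ' by blast
  have 1: "\<exists>r. 1 = Polynomial.poly r x \<and> (\<forall>i. Polynomial.coeff r i \<in> R)"
    using RJ'(1) 0 by (intro exI[of _ 1]) simp
  have 2: "\<exists>r. Polynomial.poly p x + Polynomial.poly q x = Polynomial.poly r x \<and> (\<forall>i. Polynomial.coeff r i \<in> R)"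
    "\<exists>r. Polynomial.poly p x * Polynomial.poly q x = Polynomial.poly r x \<and> (\<forall>i. Polynomial.coeff r i \<in> R)"
    "\<exists>r. - Polynomial.poly p x = Polynomial.poly r x \<and> (\<forall>i. Polynomial.coeff r i \<in> R)"
    if "\<forall>i. Polynomial.coeff p i \<in> R" "\<forall>i. Polynomial.coeff q i \<in> R" for p q
    using that RJ'
    by (intro exI[of _ "p + q"] exI[of _ "p * q"] exI[of _ "- p"],
        auto simp: coeff_mult intro!: sub_ideal_sum(2)[OF RJ])+
  have 3: "\<exists>r. Polynomial.poly p x + Polynomial.poly q x = Polynomial.poly r x \<and> (\<forall>i. Polynomial.coeff r i \<in> J)"
    if "\<forall>i. Polynomial.coeff p i \<in> J" "\<forall>i. Polynomial.coeff q i \<in> J" for p q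
    using that RJ' by (intro exI[of _ "p + q"]) auto
  have 4: "\<exists>r. Polynomial.poly p x * Polynomial.poly q x = Polynomial.poly r x \<and> (\<forall>i. Polynomial.coeff r i \<in> J)"
    if "\<forall>i. Polynomial.coeff p i \<in> R" "\<forall>i. Polynomial.coeff q i \<in> J" for p q
    using that RJ' by (intro exI[of _ "p * q"]) (auto simp: coeff_mult intro!: sub_ideal_sum(1)[OF RJ])
  have 5: "\<exists>r. 0 = Polynomial.poly r x \<and> (\<forall>i. Polynomial.coeff r i \<in> J)"
    using RJ' by (intro exI[of _ 0]) simp
  show ?thesis
    unfolding sub_ideal_def
  proof (intro conjI ballI)
    show "1 \<in> {Polynomial.poly p x |p. \<forall>i. Polynomial.coeff p i \<in> R}" using 1 by blast
    show "0 \<in> {Polynomial.poly p x |p. \<forall>i. Polynomial.coeff p i \<in> J}" using 5 by blast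
    show "{Polynomial.poly p x |p. \<forall>i. Polynomial.coeff p i \<in> J} \<subseteq>
      {Polynomial.poly p x |p. \<forall>i. Polynomial.coeff p i \<in> R}" using RJ'(5) by blast
    show "1 \<notin> {Polynomial.poly p x |p. \<forall>i. Polynomial.coeff p i \<in> J}" using x by force
  qed (use 2 3 4 in auto)
qed

lemma sub_ideal_Union_chain:
  fixes C :: "('a::field set \<times> 'a set) set"
  assumes C: "C \<noteq> {}" "\<And>Z. Z \<in> C \<Longrightarrow> sub_ideal (fst Z) (snd Z)"
    and chain: "\<And>Z W. Z \<in> C \<Longrightarrow> W \<in> C \<Longrightarrow> fst Z \<subseteq> fst W \<and> snd Z \<subseteq> snd W \<or> fst W \<subseteq> fst Z \<and> snd W \<subseteq> snd Z"
  shows "sub_ideal (\<Union>(fst ` C)) (\<Union>(snd ` C))"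
proof -
  \<comment> \<open>One statement for all combinations of components: the Boolean a selects the
    component that contains x, and b the one that contains y.\<close>
  have up: "\<exists>W\<in>C. x \<in> (if a then fst W else snd W) \<and> y \<in> (if b then fst W else snd W)"
    if Z: "Z \<in> C" "Z' \<in> C" and x: "x \<in> (if a then fst Z else snd Z)" "y \<in> (if b then fst Z' else snd Z')"
    for Z Z' x y and a b :: bool
  proof -
    obtain W where "W \<in> C" "fst Z \<subseteq> fst W" "snd Z \<subseteq> snd W" "fst Z' \<subseteq> fst W" "snd Z' \<subseteq> snd W"
      using chain[OF Z] Z by blast
    then show ?thesis using x by (intro bexI[of _ W]) (auto split: if_splits)
  qed
  have up1: "\<exists>W\<in>C. x \<in> fst W \<and> y \<in> fst W" if "x \<in> \<Union>(fst ` C)" "y \<in> \<Union>(fst ` C)" for x y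
    using that up[where a = True and b = True] unfolding if_True if_False by blast
  have up2: "\<exists>W\<in>C. x \<in> fst W \<and> y \<in> snd W" if "x \<in> \<Union>(fst ` C)" "y \<in> \<Union>(snd ` C)" for x y
    using that up[where a = True and b = False] unfolding if_True if_False by blast
  have up3: "\<exists>W\<in>C. x \<in> snd W \<and> y \<in> snd W" if "x \<in> \<Union>(snd ` C)" "y \<in> \<Union>(snd ` C)" for x y
    using that up[where a = False and b = False] unfolding if_True if_False by blast
  note D = sub_idealD[OF C(2)]
  show ?thesis
    unfolding sub_ideal_def
  proof (intro conjI ballI)
    obtain Z where Z: "Z \<in> C" using C(1) by blast
    show "1 \<in> \<Union>(fst ` C)" "0 \<in> \<Union>(snd ` C)" using D(1)[OF Z] D(6)[OF Z] Z by blast+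
    show "1 \<notin> \<Union>(snd ` C)" "\<Union>(snd ` C) \<subseteq> \<Union>(fst ` C)" using D(9) D(5) by blast+
    fix x assume x: "x \<in> \<Union>(fst ` C)"
    then show "- x \<in> \<Union>(fst ` C)" using D(4) by blast
    fix y
    { assume "y \<in> \<Union>(fst ` C)"
      with x obtain W where "W \<in> C" "x \<in> fst W" "y \<in> fst W"
        using up1 by blast
      then show "x + y \<in> \<Union>(fst ` C)" "x * y \<in> \<Union>(fst ` C)" using D(2)[of W x y] D(3)[of W x y] by blast+ }
    { assume "y \<in> \<Union>(snd ` C)"
      with x obtain W where "W \<in> C" "x \<in> fst W" "y \<in> snd W"
        using up2 by blast
      then show "x * y \<in> \<Union>(snd ` C)" using D(8)[of W x y] by blast }
  next
    fix x y assume "x \<in> \<Union>(snd ` C)" "y \<in> \<Union>(snd ` C)"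
    then obtain W where "W \<in> C" "x \<in> snd W" "y \<in> snd W"
      using up3 by blast
    then show "x + y \<in> \<Union>(snd ` C)" using D(7)[of W x y] by blast
  qed
qed

lemma maximal_sub_ideal:
  fixes A I :: "'a::field set"
  assumes "sub_ideal A I"
  obtains R J where "sub_ideal R J" "A \<subseteq> R" "I \<subseteq> J"
    "\<And>R' J'. sub_ideal R' J' \<Longrightarrow> R \<subseteq> R' \<Longrightarrow> J \<subseteq> J' \<Longrightarrow> R' = R \<and> J' = J"
proof -
  \<comment> \<open>Tagging the components with Booleans turns a pair into a single set, so that
    inclusion of codes is componentwise inclusion of pairs and Zorn's lemma for inclusion
    applies.\<close>
  define code where "code Z = fst Z \<times> {True} \<union> snd Z \<times> {False}" for Z :: "'a set \<times> 'a set"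
  have code_iff: "code Z \<subseteq> code W \<longleftrightarrow> fst Z \<subseteq> fst W \<and> snd Z \<subseteq> snd W" for Z W
    unfolding code_def by auto
  define \<A> where "\<A> = {Z. sub_ideal (fst Z) (snd Z) \<and> A \<subseteq> fst Z \<and> I \<subseteq> snd Z}"
  have "\<exists>M\<in>code ` \<A>. \<forall>Z\<in>code ` \<A>. M \<subseteq> Z \<longrightarrow> Z = M"
  proof (rule subset_Zorn_nonempty)
    show "code ` \<A> \<noteq> {}" using assms unfolding \<A>_def by auto
    fix \<C> assume \<C>: "\<C> \<noteq> {}" "subset.chain (code ` \<A>) \<C>"
    define C where "C = {Z \<in> \<A>. code Z \<in> \<C>}"
    have \<C>_eq: "\<C> = code ` C"
      using \<C>(2) unfolding C_def subset.chain_def by auto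
    have CA: "C \<subseteq> \<A>" unfolding C_def by auto
    have ne: "C \<noteq> {}" using \<C>(1) \<C>_eq by auto
    have "sub_ideal (\<Union>(fst ` C)) (\<Union>(snd ` C))"
    proof (rule sub_ideal_Union_chain[OF ne])
      show "sub_ideal (fst Z) (snd Z)" if "Z \<in> C" for Z
        using that CA unfolding \<A>_def by auto
      show "fst Z \<subseteq> fst W \<and> snd Z \<subseteq> snd W \<or> fst W \<subseteq> fst Z \<and> snd W \<subseteq> snd Z"
        if "Z \<in> C" "W \<in> C" for Z W
      proof -
        have "code Z \<in> \<C>" "code W \<in> \<C>" using that unfolding \<C>_eq by auto
        then have "code Z \<subseteq> code W \<or> code W \<subseteq> code Z"
          using \<C>(2) by (auto simp: subset_chain_def)
        then show ?thesis unfolding code_iff .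
      qed
    qed
    then have "(\<Union>(fst ` C), \<Union>(snd ` C)) \<in> \<A>"
      using CA ne unfolding \<A>_def by auto
    moreover have "\<Union>\<C> = code (\<Union>(fst ` C), \<Union>(snd ` C))"
      unfolding \<C>_eq code_def by auto
    ultimately show "\<Union>\<C> \<in> code ` \<A>" by blast
  qed
  then obtain Z where Z: "Z \<in> \<A>" "\<And>W. W \<in> \<A> \<Longrightarrow> code Z \<subseteq> code W \<Longrightarrow> code W = code Z" by auto
  show thesis
  proof (rule that[of "fst Z" "snd Z"])
    show "sub_ideal (fst Z) (snd Z)" "A \<subseteq> fst Z" "I \<subseteq> snd Z" using Z(1) unfolding \<A>_def by auto
    fix R' J' assume *: "sub_ideal R' J'" "fst Z \<subseteq> R'" "snd Z \<subseteq> J'"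
    then have "(R', J') \<in> \<A>" using Z(1) unfolding \<A>_def by auto
    moreover have "code Z \<subseteq> code (R', J')" using * by (simp add: code_iff)
    ultimately have "code (R', J') \<subseteq> code Z" using Z(2) by blast
    then show "R' = fst Z \<and> J' = snd Z" using * unfolding code_iff by auto
  qed
qed

text \<open>Since \<open>1 - coeff q 0\<close> is invertible in R, the relation for
  \<open>inverse x\<close>, multiplied by \<open>x ^ N\<close>, expresses \<open>x ^ N\<close>
  through lower powers of x with coefficients in J. Substituting this into the leading term of p
  lowers its degree.\<close>

lemma reduce_degree:
  fixes x :: "'a::field"
  assumes RJ: "sub_ideal R J" and loc: "\<And>a. a \<in> J \<Longrightarrow> inverse (1 - a) \<in> R" and "x \<noteq> 0"
    and p: "\<And>i. Polynomial.coeff p i \<in> J" "Polynomial.poly p x = 1" and q: "\<And>i. Polynomial.coeff q i \<in> J" "Polynomial.poly q (inverse x) = 1"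
    and deg: "Polynomial.degree q \<le> Polynomial.degree p"
  shows "\<exists>p'. (\<forall>i. Polynomial.coeff p' i \<in> J) \<and> Polynomial.poly p' x = 1 \<and> Polynomial.degree p' < Polynomial.degree p"
proof -
  note D = sub_idealD[OF RJ]
  define N n where "N = Polynomial.degree p" and "n = Polynomial.degree q"
  have "n \<noteq> 0"
  proof
    assume "n = 0"
    then obtain c where "q = [:c:]" unfolding n_def by (rule degree_eq_zeroE)
    then have "Polynomial.coeff q 0 = 1" using q(2) by simp
    then show False using q(1)[of 0] D(9) by simp
  qed
  have b0: "1 - Polynomial.coeff q 0 \<noteq> 0" using q(1)[of 0] D(9) by force
  define u where "u = inverse (1 - Polynomial.coeff q 0)"
  have u: "u \<in> R" "u * (1 - Polynomial.coeff q 0) = 1" using b0 loc[OF q(1)] by (auto simp: u_def)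
  define r where "r = (\<Sum>i=1..n. Polynomial.monom (u * Polynomial.coeff q i) (N - i))"
  have nN: "n \<le> N" using deg by (simp add: n_def N_def)
  have "1 = (\<Sum>i\<le>n. Polynomial.coeff q i * inverse x ^ i)"
    using q(2) by (simp add: poly_altdef n_def)
  also have "\<dots> = Polynomial.coeff q 0 + (\<Sum>i=1..n. Polynomial.coeff q i * inverse x ^ i)"
    by (simp add: atMost_atLeast0 sum.atLeast_Suc_atMost)
  finally have "1 - Polynomial.coeff q 0 = (\<Sum>i=1..n. Polynomial.coeff q i * inverse x ^ i)" by (simp add: algebra_simps)
  then have "1 = u * (\<Sum>i=1..n. Polynomial.coeff q i * inverse x ^ i)" using u(2) by simp
  then have "x ^ N = x ^ N * (u * (\<Sum>i=1..n. Polynomial.coeff q i * inverse x ^ i))" by simp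
  also have "\<dots> = (\<Sum>i=1..n. u * Polynomial.coeff q i * x ^ (N - i))"
    unfolding sum_distrib_left
  proof (rule sum.cong[OF refl])
    fix i assume "i \<in> {1..n}"
    then have "x ^ (N - i) = x ^ N * inverse x ^ i"
      using nN \<open>x \<noteq> 0\<close> by (intro power_diff_conv_inverse) auto
    then show "x ^ N * (u * (Polynomial.coeff q i * inverse x ^ i)) = u * Polynomial.coeff q i * x ^ (N - i)"
      by (simp only: mult_ac)
  qed
  also have "\<dots> = Polynomial.poly r x"
    by (simp add: r_def poly_sum poly_monom)
  finally have r: "x ^ N = Polynomial.poly r x" .
  have rJ: "Polynomial.coeff r i \<in> J" for i
    unfolding r_def coeff_sum using D u q by (intro sub_ideal_sum(1)[OF RJ]) auto
  have rdeg: "Polynomial.degree r < N"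
  proof -
    have "Polynomial.degree r \<le> N - 1"
      unfolding r_def using nN \<open>n \<noteq> 0\<close>
      by (intro degree_sum_le) (auto intro: order.trans[OF degree_monom_le])
    then show ?thesis using nN \<open>n \<noteq> 0\<close> by simp
  qed
  define p' where "p' = (p - Polynomial.monom (Polynomial.lead_coeff p) N) + Polynomial.smult (Polynomial.lead_coeff p) r"
  have "Polynomial.poly p' x = 1"
    using p(2) r by (simp add: p'_def poly_monom)
  moreover have "Polynomial.coeff p' i \<in> J" for i
  proof -
    have "Polynomial.coeff (p - Polynomial.monom (Polynomial.lead_coeff p) N) i \<in> J"
      using p(1)[of i] D(6) by (auto simp: N_def)
    then show ?thesis
      unfolding p'_def Polynomial.coeff_add Polynomial.coeff_smult by (intro D(7) D(8) D(5) rJ p(1))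
  qed
  moreover have "Polynomial.degree p' < N"
  proof -
    have "Polynomial.coeff p' i = 0" if "i \<ge> N" for i
      using that rdeg coeff_eq_0[of r i] coeff_eq_0[of p i] unfolding p'_def N_def
      by (cases "i = Polynomial.degree p") auto
    then have "Polynomial.degree p' \<le> N - 1" using rdeg by (intro degree_le) auto
    then show ?thesis using rdeg by simp
  qed
  ultimately show ?thesis unfolding N_def by blast
qed

text \<open>Chevalley's extension theorem. In a maximal pair, x is missing from R only if 1 is a
  polynomial in x with coefficients in J, by \<open>sub_ideal_adjoin\<close>. If x and its inverse
  were both missing, the longer of the two shortest such relations could be shortened by
  \<open>reduce_degree\<close>.\<close>

lemma chevalley:
  fixes A I :: "'a::field set"
  assumes "sub_ideal A I"
  obtains R where "A \<subseteq> R" "1 \<in> R" "\<And>x y. x \<in> R \<Longrightarrow> y \<in> R \<Longrightarrow> x + y \<in> R"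
    "\<And>x y. x \<in> R \<Longrightarrow> y \<in> R \<Longrightarrow> x * y \<in> R" "\<And>x. x \<in> R \<Longrightarrow> - x \<in> R"
    "\<And>x. x \<in> R \<or> inverse x \<in> R" "\<And>x. x \<in> I \<Longrightarrow> x \<noteq> 0 \<Longrightarrow> inverse x \<notin> R"
proof -
  obtain R J where RJ: "sub_ideal R J" "A \<subseteq> R" "I \<subseteq> J"
    and max: "\<And>R' J'. sub_ideal R' J' \<Longrightarrow> R \<subseteq> R' \<Longrightarrow> J \<subseteq> J' \<Longrightarrow> R' = R \<and> J' = J"
    using maximal_sub_ideal[OF assms] by blast
  note D = sub_idealD[OF RJ(1)]
  have 0: "0 \<in> R" using D by blast
  have adjoin: "x \<in> R" if "\<And>p. (\<And>i. Polynomial.coeff p i \<in> J) \<Longrightarrow> Polynomial.poly p x \<noteq> 1" for x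
  proof -
    let ?R = "{Polynomial.poly p x |p. \<forall>i. Polynomial.coeff p i \<in> R}" and ?J = "{Polynomial.poly p x |p. \<forall>i. Polynomial.coeff p i \<in> J}"
    have const: "\<forall>i. Polynomial.coeff [:c:] i \<in> S" if "c \<in> S" "0 \<in> S" for c and S :: "'a set"
      using that by (auto simp: coeff_pCons split: nat.splits)
    have "c = Polynomial.poly [:c:] x" for c by simp
    then have "R \<subseteq> ?R" "J \<subseteq> ?J"
      using const[OF _ 0] const[OF _ D(6)] by blast+
    then have "?R = R" using max[OF sub_ideal_adjoin[OF RJ(1) that]] by blast
    moreover have "\<forall>i. Polynomial.coeff [:0, 1:] i \<in> R" using 0 D(1) by (auto simp: coeff_pCons split: nat.splits)
    moreover have "x = Polynomial.poly [:0, 1:] x" by simp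
    ultimately show ?thesis by blast
  qed
  \<comment> \<open>J lies in the Jacobson radical of R: otherwise a relation for the inverse of
    \<open>1 - a\<close> would, after clearing denominators, put a power of \<open>1 - a\<close>
    into J, although such a power is 1 modulo J.\<close>
  have loc: "inverse (1 - a) \<in> R" if a: "a \<in> J" for a
  proof (rule adjoin, rule notI)
    fix p assume p: "\<And>i. Polynomial.coeff p i \<in> J" "Polynomial.poly p (inverse (1 - a)) = 1"
    let ?n = "Polynomial.degree p"
    have "1 - a \<noteq> 0" using a D(9) by force
    have aR: "1 - a \<in> R" using D(2)[OF D(1) D(4)[OF D(5)[OF a]]] by simp
    then have pow: "(1 - a) ^ i \<in> R" for i by (induction i) (auto intro: D)
    have "(1 - a) ^ ?n = (1 - a) ^ ?n * Polynomial.poly p (inverse (1 - a))" using p(2) by simp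
    also have "\<dots> = (\<Sum>i\<le>?n. (1 - a) ^ (?n - i) * Polynomial.coeff p i)"
      unfolding poly_altdef sum_distrib_left
    proof (rule sum.cong[OF refl])
      fix i assume "i \<in> {..?n}"
      then have "(1 - a) ^ (?n - i) = (1 - a) ^ ?n * inverse (1 - a) ^ i"
        using \<open>1 - a \<noteq> 0\<close> by (intro power_diff_conv_inverse) auto
      then show "(1 - a) ^ ?n * (Polynomial.coeff p i * inverse (1 - a) ^ i) = (1 - a) ^ (?n - i) * Polynomial.coeff p i"
        by (simp only: mult_ac)
    qed
    also have "\<dots> \<in> J"
      by (intro sub_ideal_sum(1)[OF RJ(1)] D(8) pow p(1))
    finally have *: "(1 - a) ^ ?n \<in> J" .
    have "(1 - a) ^ i - 1 \<in> J" for i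
    proof (induction i)
      case (Suc i)
      have *: "- 1 * a \<in> J" by (intro D(8) D(4) D(1) a)
      then have "(1 - a) * ((1 - a) ^ i - 1) + - 1 * a \<in> J" by (intro D(7)[OF _ *] D(8) aR Suc)
      then show ?case by (simp add: algebra_simps)
    qed (use D in simp)
    then have "- 1 * ((1 - a) ^ ?n - 1) \<in> J" by (intro D(8) D(4) D(1))
    from D(7)[OF * this] show False using D(9) by simp
  qed
  have dichotomy: "x \<in> R \<or> inverse x \<in> R" for x
  proof (rule ccontr)
    assume "\<not> (x \<in> R \<or> inverse x \<in> R)"
    then have x: "x \<notin> R" "inverse x \<notin> R" "x \<noteq> 0" using 0 by auto
    define P where "P y d \<longleftrightarrow> (\<exists>p. (\<forall>i. Polynomial.coeff p i \<in> J) \<and> Polynomial.poly p y = 1 \<and> Polynomial.degree p = d)" for y d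
    have "\<exists>d. P x d" "\<exists>d. P (inverse x) d"
      unfolding P_def using adjoin x(1,2) by blast+
    define d e where "d = (LEAST d. P x d)" and "e = (LEAST d. P (inverse x) d)"
    have "P x d" "P (inverse x) e"
      unfolding d_def e_def using LeastI_ex[of "P x"] LeastI_ex[of "P (inverse x)"]
        \<open>\<exists>d. P x d\<close> \<open>\<exists>d. P (inverse x) d\<close> by blast+
    then obtain p q where p: "\<And>i. Polynomial.coeff p i \<in> J" "Polynomial.poly p x = 1" "Polynomial.degree p = d"
      and q: "\<And>i. Polynomial.coeff q i \<in> J" "Polynomial.poly q (inverse x) = 1" "Polynomial.degree q = e"
      unfolding P_def by blast
    have "\<not> P x d'" if "d' < d" for d' using that not_less_Least unfolding d_def by blast
    moreover have "\<not> P (inverse x) d'" if "d' < e" for d' using that not_less_Least unfolding e_def by blast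
    moreover have "e \<le> d \<Longrightarrow> \<exists>d'<d. P x d'"
      using reduce_degree[OF RJ(1) loc x(3) p(1,2) q(1,2)] unfolding p(3) q(3) P_def by blast
    moreover have "d \<le> e \<Longrightarrow> \<exists>d'<e. P (inverse x) d'"
    proof -
      assume "d \<le> e"
      then have "\<exists>q'. (\<forall>i. Polynomial.coeff q' i \<in> J) \<and> Polynomial.poly q' (inverse x) = 1 \<and>
          Polynomial.degree q' < Polynomial.degree q"
        using p q x(3) by (intro reduce_degree[OF RJ(1) loc, where q = p]) auto
      then show ?thesis unfolding P_def q(3) by blast
    qed
    ultimately show False by (meson nle_le)
  qed
  have "inverse x \<notin> R" if "x \<in> I" "x \<noteq> 0" for x
    using D(8)[of "inverse x" x] D(9) that RJ(3) by auto
  then show thesis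
    using RJ(2) D dichotomy by (intro that[of R]) auto
qed

section \<open>Transcendence bases\<close>

lemma ring_of_type_algebra_simps [simp]:
  "carrier ring_of_type_algebra = UNIV" "\<one>\<^bsub>ring_of_type_algebra\<^esub> = 1" "\<zero>\<^bsub>ring_of_type_algebra\<^esub> = 0"
  "x \<otimes>\<^bsub>ring_of_type_algebra\<^esub> y = x * y" "x \<oplus>\<^bsub>ring_of_type_algebra\<^esub> y = x + y"
  by (simp_all add: ring_of_type_algebra_def)

lemma finsum_ring_of_type_algebra:
  fixes f :: "'b \<Rightarrow> 'a::comm_ring_1"
  shows "finite A \<Longrightarrow> finsum ring_of_type_algebra f A = sum f A"
proof (induction A rule: finite_induct)
  case (insert x A)
  interpret R: cring "ring_of_type_algebra :: 'a ring" by (rule cring_from_type_algebra)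
  show ?case using insert by (simp add: R.finsum_insert)
qed (use abelian_monoid.finsum_empty[OF ring.is_abelian_group[OF ring_from_type_algebra, THEN abelian_group.axioms(1)]] in simp)

lemma finprod_ring_of_type_algebra:
  fixes f :: "'b \<Rightarrow> 'a::comm_ring_1"
  shows "finite A \<Longrightarrow> finprod ring_of_type_algebra f A = prod f A"
proof (induction A rule: finite_induct)
  case empty
  interpret R: cring "ring_of_type_algebra :: 'a ring" by (rule cring_from_type_algebra)
  show ?case by simp
next
  case (insert x A)
  interpret R: cring "ring_of_type_algebra :: 'a ring" by (rule cring_from_type_algebra)
  show ?case using insert by (simp add: R.finprod_insert)
qed

lemma nat_pow_ring_of_type_algebra:
  fixes x :: "'a::comm_ring_1"
  shows "x [^]\<^bsub>ring_of_type_algebra\<^esub> (n::nat) = x ^ n"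
proof -
  interpret R: cring "ring_of_type_algebra :: 'a ring" by (rule cring_from_type_algebra)
  show ?thesis by (induction n) (simp_all add: mult.commute)
qed

lemma poly_value_ring_of_type_algebra:
  "poly_value ring_of_type_algebra \<phi> P = (\<Sum>\<alpha>\<in>Poly_Mapping.keys P.
     \<phi> (Poly_Mapping.lookup P \<alpha>) * (\<Prod>t\<in>Poly_Mapping.keys \<alpha>. t ^ Poly_Mapping.lookup \<alpha> t))"
  for \<phi> :: "'k::zero \<Rightarrow> 'a::comm_ring_1"
  unfolding poly_value_def
  by (simp add: finsum_ring_of_type_algebra finprod_ring_of_type_algebra nat_pow_ring_of_type_algebra)

section \<open>Comparison of the two notions of algebraic independence\<close>

context ground_field
begin

lemma bij_lookup_exps:
  assumes "finite T"
  shows "bij_betw Poly_Mapping.lookup {\<alpha>. Poly_Mapping.lookup \<alpha> \<in> exps T D} (exps T D)"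
proof (rule bij_betw_imageI)
  show "inj_on Poly_Mapping.lookup {\<alpha>. Poly_Mapping.lookup \<alpha> \<in> exps T D}"
    by (auto simp: inj_on_def)
  show "Poly_Mapping.lookup ` {\<alpha>. Poly_Mapping.lookup \<alpha> \<in> exps T D} = exps T D"
  proof (intro equalityI subsetI)
    fix \<gamma> assume \<gamma>: "\<gamma> \<in> exps T D"
    have "finite {x. \<gamma> x \<noteq> 0}"
      by (rule finite_subset[OF _ assms]) (use \<gamma> in \<open>auto simp: exps_def\<close>)
    then have "Poly_Mapping.lookup (Abs_poly_mapping \<gamma>) = \<gamma>" by (rule lookup_Abs_poly_mapping)
    then show "\<gamma> \<in> Poly_Mapping.lookup ` {\<alpha>. Poly_Mapping.lookup \<alpha> \<in> exps T D}"
      using \<gamma> by (intro image_eqI[of _ _ "Abs_poly_mapping \<gamma>"]) auto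
  qed auto
qed

lemma poly_value_exps:
  assumes T: "finite T" and P: "\<And>\<alpha>. \<alpha> \<in> Poly_Mapping.keys P \<Longrightarrow> Poly_Mapping.lookup \<alpha> \<in> exps T D"
  shows "poly_value ring_of_type_algebra \<iota> P =
    (\<Sum>\<alpha>\<in>{\<alpha>. Poly_Mapping.lookup \<alpha> \<in> exps T D}. \<iota> (Poly_Mapping.lookup P \<alpha>) * mon T (Poly_Mapping.lookup \<alpha>))"
  unfolding poly_value_ring_of_type_algebra
proof (rule sum.mono_neutral_cong_left)
  show "finite {\<alpha>. Poly_Mapping.lookup \<alpha> \<in> exps T D}"
    using bij_betw_finite[OF bij_lookup_exps[OF T]] T by simp
  show "Poly_Mapping.keys P \<subseteq> {\<alpha>. Poly_Mapping.lookup \<alpha> \<in> exps T D}" using P by auto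
  fix \<alpha> assume "\<alpha> \<in> Poly_Mapping.keys P"
  then have "Poly_Mapping.keys \<alpha> \<subseteq> T"
    using P[of \<alpha>] by (force simp: exps_def in_keys_iff)
  then have "(\<Prod>t\<in>Poly_Mapping.keys \<alpha>. t ^ Poly_Mapping.lookup \<alpha> t) = mon T (Poly_Mapping.lookup \<alpha>)"
    unfolding mon_def using T by (intro prod.mono_neutral_left) (auto simp: in_keys_iff)
  then show "\<iota> (Poly_Mapping.lookup P \<alpha>) * (\<Prod>t\<in>Poly_Mapping.keys \<alpha>. t ^ Poly_Mapping.lookup \<alpha> t) =
    \<iota> (Poly_Mapping.lookup P \<alpha>) * mon T (Poly_Mapping.lookup \<alpha>)" by simp
qed (auto simp: in_keys_iff)

lemma algebraically_independent_iff:
  assumes T: "finite T"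
  shows "algebraically_independent ring_of_type_algebra \<iota> T \<longleftrightarrow> alg_indep T"
proof
  assume ai: "algebraically_independent ring_of_type_algebra \<iota> T"
  show "alg_indep T"
    unfolding alg_indep_def
  proof (intro allI impI ballI)
    fix D c \<gamma> assume 0: "(\<Sum>\<gamma>\<in>exps T D. \<iota> (c \<gamma>) * mon T \<gamma>) = 0" and \<gamma>: "\<gamma> \<in> exps T D"
    let ?A = "{\<alpha>. Poly_Mapping.lookup \<alpha> \<in> exps T D}"
    have fin: "finite ?A" using bij_betw_finite[OF bij_lookup_exps[OF T]] T by simp
    define f where "f \<alpha> = (if \<alpha> \<in> ?A then c (Poly_Mapping.lookup \<alpha>) else 0)" for \<alpha>
    define P where "P = Abs_poly_mapping f"
    have "finite {x. f x \<noteq> 0}" by (rule finite_subset[OF _ fin]) (auto simp: f_def)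
    then have P: "Poly_Mapping.lookup P = f" unfolding P_def by (rule lookup_Abs_poly_mapping)
    have keys: "\<alpha> \<in> ?A" if "\<alpha> \<in> Poly_Mapping.keys P" for \<alpha>
      using that by (auto simp: in_keys_iff P f_def split: if_splits)
    have "poly_value ring_of_type_algebra \<iota> P = (\<Sum>\<alpha>\<in>?A. \<iota> (c (Poly_Mapping.lookup \<alpha>)) * mon T (Poly_Mapping.lookup \<alpha>))"
      by (subst poly_value_exps[OF T, of P D]) (use keys in \<open>auto simp: P f_def\<close>)
    also have "\<dots> = 0"
      using 0 by (subst (asm) sum.reindex_bij_betw[OF bij_lookup_exps[OF T], symmetric])
    finally have "poly_value ring_of_type_algebra \<iota> P = \<zero>\<^bsub>ring_of_type_algebra\<^esub>" by simp
    moreover have "\<forall>\<alpha>\<in>Poly_Mapping.keys P. Poly_Mapping.keys \<alpha> \<subseteq> T"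
      using keys by (force simp: exps_def in_keys_iff)
    ultimately have "P = 0"
      using ai unfolding algebraically_independent_def by blast
    moreover have "\<gamma> \<in> Poly_Mapping.lookup ` ?A"
      using \<gamma> by (simp only: bij_betw_imp_surj_on[OF bij_lookup_exps[OF T]])
    then obtain \<alpha> where "\<alpha> \<in> ?A" "Poly_Mapping.lookup \<alpha> = \<gamma>" by blast
    moreover have "f \<alpha> = 0" using P \<open>P = 0\<close> by (metis lookup_zero)
    ultimately show "c \<gamma> = 0" by (simp add: f_def)
  qed
next
  assume ai: "alg_indep T"
  show "algebraically_independent ring_of_type_algebra \<iota> T"
    unfolding algebraically_independent_def
  proof (intro conjI allI impI, simp, elim conjE, rule notI)
    fix P assume P: "P \<noteq> 0" "\<forall>\<alpha>\<in>Poly_Mapping.keys P. Poly_Mapping.keys \<alpha> \<subseteq> T"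
      and 0: "poly_value ring_of_type_algebra \<iota> P = \<zero>\<^bsub>ring_of_type_algebra\<^esub>"
    \<comment> \<open>The sum of all exponents that occur is a crude bound for each of them.\<close>
    define D where "D = (\<Sum>\<alpha>\<in>Poly_Mapping.keys P. sum (Poly_Mapping.lookup \<alpha>) T)"
    let ?A = "{\<alpha>. Poly_Mapping.lookup \<alpha> \<in> exps T D}"
    have keys: "Poly_Mapping.lookup \<alpha> \<in> exps T D" if \<alpha>: "\<alpha> \<in> Poly_Mapping.keys P" for \<alpha>
    proof -
      have "Poly_Mapping.lookup \<alpha> t \<le> D" if "t \<in> T" for t
      proof -
        have "Poly_Mapping.lookup \<alpha> t \<le> sum (Poly_Mapping.lookup \<alpha>) T" using that T by (intro member_le_sum) auto
        also have "\<dots> \<le> D" unfolding D_def using \<alpha> by (intro member_le_sum) auto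
        finally show ?thesis .
      qed
      moreover have "Poly_Mapping.lookup \<alpha> x = 0" if "x \<notin> T" for x
      proof -
        have "x \<notin> Poly_Mapping.keys \<alpha>" using P(2) \<alpha> that by auto
        then show ?thesis by (simp add: in_keys_iff)
      qed
      ultimately show ?thesis by (simp add: exps_def)
    qed
    define c where "c \<gamma> = Poly_Mapping.lookup P (inv_into ?A Poly_Mapping.lookup \<gamma>)" for \<gamma>
    have c: "c (Poly_Mapping.lookup \<alpha>) = Poly_Mapping.lookup P \<alpha>" if "\<alpha> \<in> ?A" for \<alpha>
      unfolding c_def using bij_betw_imp_inj_on[OF bij_lookup_exps[OF T]] that by (simp add: inv_into_f_f)
    have "(\<Sum>\<gamma>\<in>exps T D. \<iota> (c \<gamma>) * mon T \<gamma>) = (\<Sum>\<alpha>\<in>?A. \<iota> (Poly_Mapping.lookup P \<alpha>) * mon T (Poly_Mapping.lookup \<alpha>))"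
      by (subst sum.reindex_bij_betw[OF bij_lookup_exps[OF T], symmetric], rule sum.cong) (use c in auto)
    also have "\<dots> = 0" using 0 poly_value_exps[OF T keys] by simp
    finally have *: "c \<gamma> = 0" if "\<gamma> \<in> exps T D" for \<gamma> using ai that unfolding alg_indep_def by blast
    have "Poly_Mapping.lookup P \<alpha> = 0" for \<alpha>
      using *[of "Poly_Mapping.lookup \<alpha>"] c[of \<alpha>] keys[of \<alpha>] by (cases "\<alpha> \<in> Poly_Mapping.keys P") (auto simp: in_keys_iff)
    then show False using P(1) by (metis poly_mapping_eqI lookup_zero)
  qed
qed

lemma alg_indep_card_le:
  "finite T \<Longrightarrow> alg_indep T \<Longrightarrow> enat (card T) \<le> function_field_dim \<iota>"
  unfolding function_field_dim_def transcendence_degree_def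
  by (rule SUP_upper) (simp add: algebraically_independent_iff)

end

text \<open>If all values were below n, they would be bounded by \<open>n - 1\<close>. Nonemptiness
  matters for n = 0, which is also the supremum of the empty family.\<close>

lemma enat_SUP_attained:
  fixes f :: "'b \<Rightarrow> nat"
  assumes "(SUP S\<in>A. enat (f S)) = enat n" "A \<noteq> {}"
  shows "\<exists>S\<in>A. f S = n"
proof (rule ccontr)
  assume none: "\<not> ?thesis"
  have le: "f S \<le> n" if "S \<in> A" for S
    using SUP_upper[OF that, of "\<lambda>S. enat (f S)"] assms(1) by simp
  with none have lt: "f S < n" if "S \<in> A" for S using that by (metis le_neq_implies_less)
  have "f S \<le> n - 1" if "S \<in> A" for S using lt[OF that] by simp
  then have "(SUP S\<in>A. enat (f S)) \<le> enat (n - 1)"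
    by (intro SUP_least) simp
  moreover have "n > 0" using lt assms(2) by auto
  ultimately show False using assms(1) by simp
qed

context ground_field
begin

lemma transcendence_basis:
  assumes "function_field_dim \<iota> = enat n"
  obtains T where "finite T" "alg_indep T" "card T = n"
proof -
  have "\<exists>T\<in>{S. finite S \<and> algebraically_independent ring_of_type_algebra \<iota> S}. card T = n"
    using assms unfolding function_field_dim_def transcendence_degree_def
  proof (rule enat_SUP_attained)
    show "{S. finite S \<and> algebraically_independent (ring_of_type_algebra :: 'a ring) \<iota> S} \<noteq> {}"
      using alg_indep_empty algebraically_independent_iff[of "{}"] by auto
  qed
  then show thesis using that algebraically_independent_iff by auto
qed

end


section \<open>Valuation rings with residue field \<open>k\<close>\<close>

locale valuation_subring =
  fixes V :: "'a::field set"
  assumes V_1 [simp]: "1 \<in> V" and V_add: "x \<in> V \<Longrightarrow> y \<in> V \<Longrightarrow> x + y \<in> V"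
    and V_mult: "x \<in> V \<Longrightarrow> y \<in> V \<Longrightarrow> x * y \<in> V" and V_uminus: "x \<in> V \<Longrightarrow> - x \<in> V"
    and V_total: "x \<in> V \<or> inverse x \<in> V"
begin

definition M :: "'a set" where
  "M = {x \<in> V. x = 0 \<or> inverse x \<notin> V}"

text \<open>Equality of values, expressed without constructing the value group. Division by 0 gives
  0, so 0 is related to everything; hence conditions such as \<open>y \<noteq> 0\<close> in
  transitivity.\<close>

definition equiv_val :: "'a \<Rightarrow> 'a \<Rightarrow> bool" (infix \<open>\<sim>\<^sub>V\<close> 50) where
  "x \<sim>\<^sub>V y \<longleftrightarrow> x / y \<in> V \<and> y / x \<in> V"

lemma V_0 [simp]: "0 \<in> V"
  using V_total[of 0] by simp

lemma V_power: "x \<in> V \<Longrightarrow> x ^ i \<in> V"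
  by (induction i) (auto intro: V_mult)

lemma M_subset: "x \<in> M \<Longrightarrow> x \<in> V" and M_0 [simp]: "0 \<in> M" and M_1: "1 \<notin> M"
  by (auto simp: M_def)

lemma unit: "x \<in> V \<Longrightarrow> x \<notin> M \<Longrightarrow> x \<noteq> 0 \<and> inverse x \<in> V"
  by (auto simp: M_def)

lemma M_mult: "x \<in> V \<Longrightarrow> m \<in> M \<Longrightarrow> x * m \<in> M"
proof -
  assume x: "x \<in> V" and m: "m \<in> M"
  have "inverse (x * m) \<notin> V" if "x * m \<noteq> 0"
  proof
    assume "inverse (x * m) \<in> V"
    moreover have "x * inverse (x * m) = inverse m" using that by (simp add: field_simps)
    ultimately have "inverse m \<in> V" using V_mult[OF x] by metis
    then show False using m that by (auto simp: M_def)
  qed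
  then show ?thesis using x m by (auto simp: M_def intro: V_mult)
qed

lemma M_add: "x \<in> M \<Longrightarrow> y \<in> M \<Longrightarrow> x + y \<in> M"
proof -
  assume x: "x \<in> M" and y: "y \<in> M"
  consider "x = 0" | "y = 0" | "x \<noteq> 0" "y \<noteq> 0" by blast
  then show ?thesis
  proof cases
    case 3
    have "x / y \<in> V \<or> y / x \<in> V" using V_total[of "x / y"] by simp
    then show ?thesis
    proof
      assume "x / y \<in> V"
      then have "(x / y + 1) * y \<in> M" by (intro M_mult V_add V_1 y)
      then show ?thesis using 3 by (simp add: algebra_simps)
    next
      assume "y / x \<in> V"
      then have "(y / x + 1) * x \<in> M" by (intro M_mult V_add V_1 x)
      then show ?thesis using 3 by (simp add: algebra_simps)
    qed
  qed (use x y in auto)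
qed

lemma M_sum: "(\<And>i. i \<in> A \<Longrightarrow> f i \<in> M) \<Longrightarrow> sum f A \<in> M"
  by (induction A rule: infinite_finite_induct) (auto intro: M_add)

lemma M_uminus: "x \<in> M \<Longrightarrow> - x \<in> M"
  using M_mult[of "- 1" x] V_uminus[OF V_1] by simp

lemma nonmember_M_mult: "x \<in> V \<Longrightarrow> x \<notin> M \<Longrightarrow> y \<in> V \<Longrightarrow> y \<notin> M \<Longrightarrow> x * y \<notin> M"
  using unit[of x] M_mult[of "inverse x" "x * y"] by (auto simp: mult.assoc[symmetric])

lemma equiv_val_refl: "x \<noteq> 0 \<Longrightarrow> x \<sim>\<^sub>V x"
  by (simp add: equiv_val_def)

lemma equiv_val_sym: "x \<sim>\<^sub>V y \<Longrightarrow> y \<sim>\<^sub>V x"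
  by (simp add: equiv_val_def)

lemma equiv_val_trans: "x \<sim>\<^sub>V y \<Longrightarrow> y \<sim>\<^sub>V z \<Longrightarrow> y \<noteq> 0 \<Longrightarrow> x \<sim>\<^sub>V z"
  using V_mult[of "x / y" "y / z"] V_mult[of "z / y" "y / x"] by (simp add: equiv_val_def)

lemma equiv_val_mult: "x \<sim>\<^sub>V y \<Longrightarrow> x' \<sim>\<^sub>V y' \<Longrightarrow> x * x' \<sim>\<^sub>V y * y'"
  using V_mult[of "x / y" "x' / y'"] V_mult[of "y / x" "y' / x'"] by (simp add: equiv_val_def)

lemma equiv_val_power: "x \<sim>\<^sub>V y \<Longrightarrow> x ^ c \<sim>\<^sub>V y ^ c"
  using V_power[of "x / y" c] V_power[of "y / x" c] by (simp add: equiv_val_def power_divide)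

lemma equiv_val_cancel: "z \<noteq> 0 \<Longrightarrow> x * z \<sim>\<^sub>V y * z \<longleftrightarrow> x \<sim>\<^sub>V y"
  by (simp add: equiv_val_def)

text \<open>The value group is totally ordered, hence torsion free. Concretely, one of the two
  quotients lies in V, and its inverse is a power of it times the inverse of its c-th power.\<close>

lemma equiv_val_root:
  assumes "x ^ c \<sim>\<^sub>V y ^ c" "0 < c" "x \<noteq> 0" "y \<noteq> 0"
  shows "x \<sim>\<^sub>V y"
proof -
  have *: "inverse z \<in> V" if "z \<in> V" "z \<noteq> 0" "inverse (z ^ c) \<in> V" for z
  proof -
    have "z ^ (c - 1) * inverse (z ^ c) \<in> V" using that by (intro V_mult V_power)
    moreover have "z ^ c = z ^ (c - 1) * z" using assms(2) by (simp add: power_eq_if)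
    then have "z ^ (c - 1) * inverse (z ^ c) = inverse z"
      using that(2) by (simp only: inverse_mult_distrib) (simp add: field_simps)
    ultimately show ?thesis by simp
  qed
  have "x / y \<in> V \<or> y / x \<in> V" using V_total[of "x / y"] by simp
  then show ?thesis
    using *[of "x / y"] *[of "y / x"] assms by (auto simp: equiv_val_def power_divide)
qed

lemma least_value:
  assumes "finite A" "A \<noteq> {}" "0 \<notin> A"
  shows "\<exists>a\<in>A. \<forall>x\<in>A. x / a \<in> V"
  using assms
proof (induction A rule: finite_ne_induct)
  case (insert b A)
  then obtain a where a: "a \<in> A" "\<forall>x\<in>A. x / a \<in> V" by auto
  have ne: "a \<noteq> 0" "b \<noteq> 0" using insert.prems a(1) by auto
  have "b / a \<in> V \<or> a / b \<in> V" using V_total[of "b / a"] by simp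
  then show ?case
  proof
    assume ab: "a / b \<in> V"
    have "x / b \<in> V" if "x \<in> A" for x
      using V_mult[OF a(2)[rule_format, OF that] ab] ne by simp
    then show ?thesis using ne by (intro bexI[of _ b]) auto
  qed (use a ne in auto)
qed simp

end

locale residue_valuation = ground_field \<iota> + valuation_subring V
  for \<iota> :: "'k::alg_closed_field \<Rightarrow> 'a::field" and V :: "'a set" +
  assumes V_const: "\<iota> c \<in> V"
    and residue: "x \<in> V \<Longrightarrow> x \<notin> M \<Longrightarrow> \<exists>c. x - \<iota> c \<in> M"
begin

lemma const_nonmember_M: "c \<noteq> 0 \<Longrightarrow> \<iota> c \<notin> M"
  using V_const[of "inverse c"] by (simp add: M_def \<iota>_inverse)

text \<open>In a relation, keep the terms with nonzero coefficient and divide by an element of least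
  value. All other terms fall into M, so the coefficient at that element, a nonzero constant, would
  lie in M too.\<close>

lemma inequivalent_independent:
  assumes A: "finite A" "0 \<notin> A" "\<And>x y. x \<in> A \<Longrightarrow> y \<in> A \<Longrightarrow> x \<noteq> y \<Longrightarrow> \<not> x \<sim>\<^sub>V y"
  shows "\<not> lin.dependent A"
proof
  assume "lin.dependent A"
  then obtain u where u: "\<exists>v\<in>A. u v \<noteq> 0" "(\<Sum>v\<in>A. \<iota> (u v) * v) = 0"
    using lin.dependent_finite[OF A(1)] by blast
  define A' where "A' = {v \<in> A. u v \<noteq> 0}"
  have A': "finite A'" "A' \<noteq> {}" "0 \<notin> A'" using A u(1) by (auto simp: A'_def)
  obtain a where a: "a \<in> A'" "\<forall>x\<in>A'. x / a \<in> V" using least_value[OF A'] by blast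
  have "a \<noteq> 0" using a A' by auto
  have M: "v / a \<in> M" if "v \<in> A' - {a}" for v
  proof -
    have "\<not> v \<sim>\<^sub>V a" using that a(1) A(3) by (auto simp: A'_def)
    then show ?thesis using a(2) that by (auto simp: M_def equiv_val_def)
  qed
  have "0 = (\<Sum>v\<in>A. \<iota> (u v) * v) / a" using u(2) by simp
  also have "\<dots> = (\<Sum>v\<in>A'. \<iota> (u v) * v) / a"
    unfolding A'_def using A(1) by (intro arg_cong2[of _ _ _ _ "(/)"] sum.mono_neutral_right) auto
  also have "\<dots> = (\<Sum>v\<in>A'. \<iota> (u v) * (v / a))" by (simp add: sum_divide_distrib)
  also have "\<dots> = \<iota> (u a) + (\<Sum>v\<in>A' - {a}. \<iota> (u v) * (v / a))"
    using A'(1) a(1) \<open>a \<noteq> 0\<close> by (simp add: sum.remove)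
  finally have "\<iota> (u a) = - (\<Sum>v\<in>A' - {a}. \<iota> (u v) * (v / a))"
    by (simp add: eq_neg_iff_add_eq_0)
  also have "\<dots> \<in> M" by (intro M_uminus M_sum M_mult V_const M)
  finally show False using const_nonmember_M[of "u a"] a(1) by (simp add: A'_def)
qed

text \<open>If f has the value of some a, subtracting the multiple of a with the same residue raises
  the value; here the residue field has to be k. The induction counts the elements of A whose value
  is at most that of f. With every further coincidence the count grows strictly, and it is bounded
  by \<open>card A\<close>.\<close>

lemma reduce_to_inequivalent:
  assumes A: "finite A" "0 \<notin> A" and f: "f \<notin> lin.span A"
  shows "\<exists>g\<in>lin.span (insert f A). g \<notin> lin.span A \<and> (\<forall>a\<in>A. \<not> g \<sim>\<^sub>V a)"
  using f
proof (induction "card A - card {a \<in> A. f / a \<in> V}" arbitrary: f rule: less_induct)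
  case less
  show ?case
  proof (cases "\<forall>a\<in>A. \<not> f \<sim>\<^sub>V a")
    case True
    then show ?thesis using less.prems lin.span_base[of f "insert f A"] by blast
  next
    case False
    then obtain a where a: "a \<in> A" "f / a \<in> V" "a / f \<in> V" by (auto simp: equiv_val_def)
    have "f \<noteq> 0" using less.prems lin.span_zero by auto
    moreover have "a \<noteq> 0" using a A by auto
    ultimately have "f / a \<notin> M" using a by (simp add: M_def)
    then obtain c where c: "f / a - \<iota> c \<in> M" using residue[OF a(2)] by blast
    define g where "g = f - \<iota> c * a"
    have ca: "\<iota> c * a \<in> lin.span B" if "A \<subseteq> B" for B
      using that a(1) by (intro lin.span_scale lin.span_base) auto
    have gA: "g \<notin> lin.span A"
      using lin.span_add[OF _ ca[OF order_refl], of g] less.prems unfolding g_def by auto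
    have gf: "g \<in> lin.span (insert f A)"
      unfolding g_def by (intro lin.span_diff ca lin.span_base) auto
    have "g \<noteq> 0" using gA lin.span_zero by auto
    have ga: "g / a \<in> M" using c \<open>a \<noteq> 0\<close> by (simp add: g_def diff_divide_distrib)
    have below: "a / b \<in> V" if "f / b \<in> V" for b
      using V_mult[OF a(3) that] \<open>f \<noteq> 0\<close> by simp
    have sub: "{b \<in> A. f / b \<in> V} \<subseteq> {b \<in> A. g / b \<in> V}"
      using V_mult[OF M_subset[OF ga] below] \<open>a \<noteq> 0\<close> by auto
    show ?thesis
    proof (cases "\<forall>b\<in>A. \<not> g \<sim>\<^sub>V b")
      case True
      then show ?thesis using gA gf by blast
    next
      case False
      then obtain b where b: "b \<in> A" "g / b \<in> V" "b / g \<in> V" by (auto simp: equiv_val_def)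
      have "b \<noteq> 0" using b A by auto
      \<comment> \<open>b has the value of g, which is larger than the common value of a and f; so b
        is new in the count.\<close>
      have "f / b \<notin> V"
      proof
        assume "f / b \<in> V"
        from V_mult[OF below[OF this] b(3)] have "a / g \<in> V" using \<open>b \<noteq> 0\<close> by simp
        then show False using ga \<open>g \<noteq> 0\<close> \<open>a \<noteq> 0\<close> by (simp add: M_def)
      qed
      then have "card {b \<in> A. f / b \<in> V} < card {b \<in> A. g / b \<in> V}"
        using sub b A(1) by (intro psubset_card_mono) auto
      moreover have "card {b \<in> A. g / b \<in> V} \<le> card A"
        using A(1) by (intro card_mono) auto
      ultimately have "card A - card {b \<in> A. g / b \<in> V} < card A - card {b \<in> A. f / b \<in> V}" by linarith
      from less.hyps[OF this gA] obtain h where h: "h \<in> lin.span (insert g A)" "h \<notin> lin.span A" "\<forall>a\<in>A. \<not> h \<sim>\<^sub>V a"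
        by blast
      have "insert g A \<subseteq> lin.span (insert f A)" using gf lin.span_superset[of "insert f A"] by auto
      then have "h \<in> lin.span (insert f A)" using h(1) lin.span_minimal[OF _ lin.subspace_span] by blast
      then show ?thesis using h by blast
    qed
  qed
qed

text \<open>Gaussian elimination by values. Together with \<open>inequivalent_independent\<close> it
  says that the dimension of a space is the number of values of its nonzero elements.\<close>

lemma inequivalent_basis:
  assumes "finite I" "\<not> lin.dependent I"
  shows "\<exists>A. A \<subseteq> lin.span I \<and> finite A \<and> card A = card I \<and> 0 \<notin> A \<and> (\<forall>x\<in>A. \<forall>y\<in>A. x \<noteq> y \<longrightarrow> \<not> x \<sim>\<^sub>V y)"
  using assms
proof (induction I rule: finite_induct)
  case empty
  then show ?case by (intro exI[of _ "{}"]) auto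
next
  case (insert x I)
  have "\<not> lin.dependent I" using insert.prems lin.dependent_mono[of I "insert x I"] by blast
  then obtain A where A: "A \<subseteq> lin.span I" "finite A" "card A = card I" "0 \<notin> A"
    "\<forall>x\<in>A. \<forall>y\<in>A. x \<noteq> y \<longrightarrow> \<not> x \<sim>\<^sub>V y" using insert.IH by blast
  have sA: "lin.span A \<subseteq> lin.span I" using A(1) lin.span_minimal[OF _ lin.subspace_span] by blast
  have "x \<notin> lin.span I" using insert.prems insert.hyps(2) lin.independent_insert[of x I] by simp
  then have "x \<notin> lin.span A" using sA by blast
  from reduce_to_inequivalent[OF A(2,4) this] obtain g where
    g: "g \<in> lin.span (insert x A)" "g \<notin> lin.span A" "\<forall>a\<in>A. \<not> g \<sim>\<^sub>V a" by blast
  have "insert x A \<subseteq> lin.span (insert x I)"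
    using A(1) lin.span_mono[of I "insert x I"] lin.span_base[of x "insert x I"] by blast
  then have "g \<in> lin.span (insert x I)" using g(1) lin.span_minimal[OF _ lin.subspace_span] by blast
  moreover have "A \<subseteq> lin.span (insert x I)" using A(1) lin.span_mono[of I "insert x I"] by blast
  moreover have "g \<notin> A" "g \<noteq> 0" using g(2) lin.span_base lin.span_zero by blast+
  ultimately show ?case
    using A insert.hyps g(3) by (intro exI[of _ "insert g A"]) (auto dest: equiv_val_sym)
qed

end

section \<open>A valuation ring with residue field k that separates monomials\<close>

context ground_field
begin

definition expo :: "'a set \<Rightarrow> ('a \<Rightarrow> nat) set" where
  "expo T = {\<gamma>. \<forall>x. x \<notin> T \<longrightarrow> \<gamma> x = 0}"

lemma exps_subset_expo: "exps T D \<subseteq> expo T"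
  by (auto simp: exps_def expo_def)

lemma expo_add: "\<gamma> \<in> expo T \<Longrightarrow> \<delta> \<in> expo T \<Longrightarrow> (\<lambda>x. \<gamma> x + \<delta> x) \<in> expo T"
  by (auto simp: expo_def)

lemma expo_0: "(\<lambda>_. 0) \<in> expo T"
  by (auto simp: expo_def)

lemma expo_bounded:
  assumes "finite T" "finite F" "F \<subseteq> expo T"
  obtains D where "F \<subseteq> exps T D"
proof (rule that)
  show "F \<subseteq> exps T (\<Sum>\<gamma>\<in>F. sum \<gamma> T)"
  proof
    fix \<gamma> assume \<gamma>: "\<gamma> \<in> F"
    have "\<gamma> t \<le> (\<Sum>\<gamma>\<in>F. sum \<gamma> T)" if "t \<in> T" for t
      using member_le_sum[of t T \<gamma>] member_le_sum[of \<gamma> F "\<lambda>\<gamma>. sum \<gamma> T"] assms \<gamma> that by auto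
    then show "\<gamma> \<in> exps T (\<Sum>\<gamma>\<in>F. sum \<gamma> T)" using \<gamma> assms(3) by (auto simp: exps_def expo_def)
  qed
qed

lemma alg_indep_monomials:
  assumes T: "finite T" "alg_indep T"
  shows "inj_on (mon T) (expo T)" "\<not> lin.dependent (mon T ` expo T)"
proof -
  have *: "c \<gamma> = 0"
    if F: "finite F" "F \<subseteq> expo T" and 0: "(\<Sum>\<gamma>\<in>F. \<iota> (c \<gamma>) * mon T \<gamma>) = 0" and \<gamma>: "\<gamma> \<in> F" for F c \<gamma>
  proof -
    obtain D where D: "F \<subseteq> exps T D" using expo_bounded[OF T(1) F] .
    have "(\<Sum>\<gamma>\<in>exps T D. \<iota> (if \<gamma> \<in> F then c \<gamma> else 0) * mon T \<gamma>) = (\<Sum>\<gamma>\<in>F. \<iota> (c \<gamma>) * mon T \<gamma>)"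
      using D T(1) by (intro sum.mono_neutral_cong_right) auto
    then have "\<forall>\<gamma>\<in>exps T D. (if \<gamma> \<in> F then c \<gamma> else 0) = 0"
      using T(2)[unfolded alg_indep_def, rule_format, where c = "\<lambda>\<gamma>. if \<gamma> \<in> F then c \<gamma> else 0" and D = D] 0
      by auto
    moreover have "\<gamma> \<in> exps T D" using \<gamma> D by blast
    ultimately have "(if \<gamma> \<in> F then c \<gamma> else 0) = 0" by (rule bspec)
    then show ?thesis using \<gamma> by simp
  qed
  show inj: "inj_on (mon T) (expo T)"
  proof (rule inj_onI, rule ccontr)
    fix \<gamma> \<delta> assume "\<gamma> \<in> expo T" "\<delta> \<in> expo T" "mon T \<gamma> = mon T \<delta>" "\<gamma> \<noteq> \<delta>"
    then show False
      using *[of "{\<gamma>, \<delta>}" "\<lambda>x. if x = \<gamma> then 1 else - 1" \<gamma>] by (simp add: \<iota>_uminus)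
  qed
  show "\<not> lin.dependent (mon T ` expo T)"
    unfolding lin.independent_explicit_finite_subsets
  proof (intro allI impI ballI)
    fix A u v assume A: "A \<subseteq> mon T ` expo T" "finite A" and 0: "(\<Sum>v\<in>A. \<iota> (u v) * v) = 0" and v: "v \<in> A"
    obtain F where F: "F \<subseteq> expo T" "finite F" "A = mon T ` F" using finite_subset_image[OF A(2,1)] by blast
    have "inj_on (mon T) F" using inj F(1) by (rule inj_on_subset)
    then have "(\<Sum>\<gamma>\<in>F. \<iota> (u (mon T \<gamma>)) * mon T \<gamma>) = 0"
      using 0 by (simp add: F(3) sum.reindex)
    then show "u v = 0" using *[OF F(2,1), of "\<lambda>\<gamma>. u (mon T \<gamma>)"] v F(3) by auto
  qed
qed

lemma mon_nonzero: "finite T \<Longrightarrow> alg_indep T \<Longrightarrow> \<gamma> \<in> expo T \<Longrightarrow> mon T \<gamma> \<noteq> 0"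
  using alg_indep_monomials(2) lin.dependent_zero by (metis imageI)

text \<open>Used with the monomials of larger weight as G, where it keeps 1 out of the ideal in
  \<open>exists_residue_valuation\<close>.\<close>

lemma mon_notin_span:
  assumes "finite T" "alg_indep T" "\<gamma> \<in> expo T" "G \<subseteq> expo T" "\<gamma> \<notin> G"
  shows "mon T \<gamma> \<notin> lin.span (mon T ` G)"
proof
  assume *: "mon T \<gamma> \<in> lin.span (mon T ` G)"
  have "mon T \<gamma> \<notin> mon T ` G"
    using inj_on_image_mem_iff[OF alg_indep_monomials(1)[OF assms(1,2)] assms(3,4)] assms(5) by simp
  then have "mon T ` G \<subseteq> mon T ` expo T - {mon T \<gamma>}"
    using image_mono[OF assms(4), of "mon T"] by (simp add: subset_Diff_insert)
  then have "mon T \<gamma> \<in> lin.span (mon T ` expo T - {mon T \<gamma>})" using * lin.span_mono by blast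
  then show False
    using alg_indep_monomials(2)[OF assms(1,2)] assms(3) unfolding lin.dependent_def by blast
qed

end

text \<open>The order on monomials: injective since prime factorizations are unique, and compatible with
  products.\<close>

lemma exists_multiplicative_weight:
  assumes "finite T"
  obtains w :: "('a \<Rightarrow> nat) \<Rightarrow> nat" where
    "\<And>\<gamma> \<delta>. w (\<lambda>x. \<gamma> x + \<delta> x) = w \<gamma> * w \<delta>" "w (\<lambda>_. 0) = 1" "\<And>\<gamma>. w \<gamma> > 0"
    "\<And>t. t \<in> T \<Longrightarrow> w (\<lambda>x. if x = t then 1 else 0) > 1"
    "\<And>\<gamma> \<delta>. w \<gamma> = w \<delta> \<Longrightarrow> \<forall>x. x \<notin> T \<longrightarrow> \<gamma> x = \<delta> x \<Longrightarrow> \<gamma> = \<delta>"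
proof -
  obtain P :: "nat set" where P: "finite P" "card P = card T" "P \<subseteq> {p. Factorial_Ring.prime p}"
    using infinite_arbitrarily_large[OF primes_infinite] by blast
  obtain \<pi> where \<pi>: "bij_betw \<pi> T P" using finite_same_card_bij[OF assms P(1)] P(2) by auto
  have prime: "Factorial_Ring.prime (\<pi> t)" if "t \<in> T" for t using that P(3) bij_betwE[OF \<pi>] by auto
  define w where "w \<gamma> = (\<Prod>t\<in>T. \<pi> t ^ \<gamma> t)" for \<gamma> :: "'a \<Rightarrow> nat"
  have mult: "multiplicity (\<pi> t) (w \<gamma>) = \<gamma> t" if t: "t \<in> T" for \<gamma> t
  proof -
    have "w \<gamma> = (\<Prod>p\<in>P. p ^ \<gamma> (inv_into T \<pi> p))"
      unfolding w_def using \<pi> by (subst prod.reindex_bij_betw[OF \<pi>, symmetric])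
        (simp add: bij_betw_def inv_into_f_f cong: prod.cong)
    then have "multiplicity (\<pi> t) (w \<gamma>) = \<gamma> (inv_into T \<pi> (\<pi> t))"
      using P prime[OF t] bij_betwE[OF \<pi>] t by (simp add: multiplicity_prod_prime_powers subset_iff)
    then show ?thesis using \<pi> t by (simp add: bij_betw_def inv_into_f_f)
  qed
  show thesis
  proof (rule that[of w])
    show "w (\<lambda>x. if x = t then 1 else 0) > 1" if "t \<in> T" for t
    proof -
      have "w (\<lambda>x. if x = t then 1 else 0) = \<pi> t"
        unfolding w_def using assms that by (subst prod.remove[of T t]) (auto intro!: prod.neutral)
      then show ?thesis using prime[OF that] prime_gt_1_nat by simp
    qed
    show "w \<gamma> > 0" for \<gamma>
      unfolding w_def using prime by (auto intro!: prod_pos simp: prime_gt_0_nat)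
    show "\<gamma> = \<delta>" if "w \<gamma> = w \<delta>" "\<forall>x. x \<notin> T \<longrightarrow> \<gamma> x = \<delta> x" for \<gamma> \<delta>
    proof
      fix x show "\<gamma> x = \<delta> x" using mult[of x \<gamma>] mult[of x \<delta>] that by (cases "x \<in> T") auto
    qed
  qed (simp_all add: w_def power_add prod.distrib)
qed

context ground_field
begin

text \<open>Over the algebraically closed k, f splits into linear factors, and each
  \<open>u - \<iota> a\<close> is a unit of V by hypothesis. So an element of V whose residue is not
  in k has a residue transcendental over k.\<close>

lemma root_avoiding:
  fixes u :: 'a and f :: "'k poly"
  assumes V: "valuation_subring V" and const: "\<And>c. \<iota> c \<in> V" and u: "u \<in> V"
    and avoid: "\<And>a. u - \<iota> a \<notin> valuation_subring.M V"
  shows "f \<noteq> 0 \<Longrightarrow> Polynomial.poly (map_poly \<iota> f) u \<notin> valuation_subring.M V \<and> Polynomial.poly (map_poly \<iota> f) u \<in> V"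
proof (induction "Polynomial.degree f" arbitrary: f rule: less_induct)
  interpret valuation_subring V by (rule V)
  case less
  show ?case
  proof (cases "Polynomial.degree f = 0")
    case True
    then obtain c where c: "f = [:c:]" by (rule degree_eq_zeroE)
    then have "c \<noteq> 0" using less.prems by auto
    then have "\<iota> c \<notin> M" using const[of "inverse c"] by (simp add: M_def \<iota>_inverse)
    then show ?thesis using const by (simp add: c map_poly_pCons)
  next
    case False
    then obtain a where "Polynomial.poly f a = 0" using alg_closed_imp_poly_has_root[of f] by auto
    then obtain g where g: "f = [:- a, 1:] * g" by (auto simp: poly_eq_0_iff_dvd)
    have "g \<noteq> 0" using less.prems g by auto
    have "Polynomial.degree g < Polynomial.degree f"
      unfolding g using \<open>g \<noteq> 0\<close> by (subst degree_mult_eq) auto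
    note IH = less.hyps[OF this \<open>g \<noteq> 0\<close>]
    have mp: "map_poly \<iota> f = [:- \<iota> a, 1:] * map_poly \<iota> g"
      by (rule poly_eqI)
         (simp add: g coeff_map_poly coeff_pCons \<iota>_add \<iota>_mult \<iota>_uminus \<iota>_diff split: nat.splits)
    have eq: "Polynomial.poly (map_poly \<iota> f) u = (u - \<iota> a) * Polynomial.poly (map_poly \<iota> g) u"
      unfolding mp poly_mult by simp
    have "u - \<iota> a \<in> V" using V_add[OF u V_uminus[OF const[of a]]] by simp
    then show ?thesis unfolding eq using IH avoid[of a] by (simp add: nonmember_M_mult V_mult)
  qed
qed

text \<open>Order the monomials in T by the weight w. A consists of the x that some monomial
  multiplies into polynomials of weight at least its own, I of those for which the weight becomes
  larger. Chevalley's theorem extends this pair to V, where larger weight means larger value.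
  Suppose a unit u has no residue in k. Maximality of T gives an equation for u over T; sorted by
  monomials in T, its nonzero coefficients are polynomials in u over k, hence units by
  \<open>root_avoiding\<close>, and the monomial of least weight dominates, which is absurd.\<close>

lemma exists_residue_valuation:
  assumes T: "finite T" "alg_indep T" and max: "\<And>u. u \<notin> T \<Longrightarrow> \<not> alg_indep (insert u T)"
  obtains V where "residue_valuation \<iota> V"
    "\<And>\<gamma> \<delta>. \<gamma> \<in> expo T \<Longrightarrow> \<delta> \<in> expo T \<Longrightarrow> valuation_subring.equiv_val V (mon T \<gamma>) (mon T \<delta>) \<Longrightarrow> \<gamma> = \<delta>"
proof -
  obtain w :: "('a \<Rightarrow> nat) \<Rightarrow> nat" where w_add: "\<And>\<gamma> \<delta>. w (\<lambda>x. \<gamma> x + \<delta> x) = w \<gamma> * w \<delta>"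
    and w_0: "w (\<lambda>_. 0) = 1" and w_pos: "\<And>\<gamma>. w \<gamma> > 0"
    and w_gen: "\<And>t. t \<in> T \<Longrightarrow> w (\<lambda>x. if x = t then 1 else 0) > 1"
    and w_inj: "\<And>\<gamma> \<delta>. w \<gamma> = w \<delta> \<Longrightarrow> \<forall>x. x \<notin> T \<longrightarrow> \<gamma> x = \<delta> x \<Longrightarrow> \<gamma> = \<delta>"
    using exists_multiplicative_weight[OF T(1)] by blast
  define F where "F r = lin.span (mon T ` {\<gamma> \<in> expo T. w \<gamma> \<ge> r})" for r
  have F_mult: "x * y \<in> F (r * r')" if "x \<in> F r" "y \<in> F r'" for x y r r'
    unfolding F_def
  proof (rule span_mult[OF that[unfolded F_def]])
    fix a b assume "a \<in> mon T ` {\<gamma> \<in> expo T. r \<le> w \<gamma>}" "b \<in> mon T ` {\<gamma> \<in> expo T. r' \<le> w \<gamma>}"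
    then obtain \<gamma> \<delta> where "a = mon T \<gamma>" "b = mon T \<delta>" "\<gamma> \<in> expo T" "\<delta> \<in> expo T" "r \<le> w \<gamma>" "r' \<le> w \<delta>" by auto
    then show "a * b \<in> lin.span (mon T ` {\<gamma> \<in> expo T. r * r' \<le> w \<gamma>})"
      by (intro lin.span_base image_eqI[of _ _ "\<lambda>x. \<gamma> x + \<delta> x"])
         (auto simp: mon_add w_add expo_add intro: mult_le_mono)
  qed
  have F_anti: "F r' \<subseteq> F r" if "r \<le> r'" for r r'
    unfolding F_def using that by (intro lin.span_mono image_mono) auto
  have F_mon: "mon T \<gamma> \<in> F r" if "\<gamma> \<in> expo T" "r \<le> w \<gamma>" for \<gamma> r
    unfolding F_def using that by (intro lin.span_base) auto
  have F_add: "x + y \<in> F r" if "x \<in> F r" "y \<in> F r" for x y r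
    using that unfolding F_def by (rule lin.span_add)
  define A where "A = {x. \<exists>\<mu>\<in>expo T. x * mon T \<mu> \<in> F (w \<mu>)}"
  define I where "I = {x. \<exists>\<mu>\<in>expo T. x * mon T \<mu> \<in> F (w \<mu> + 1)}"
  have prod: "x * mon T \<mu> * (y * mon T \<nu>) = x * y * mon T (\<lambda>s. \<mu> s + \<nu> s)" for x y \<mu> \<nu>
    by (simp add: mon_add[symmetric] mult_ac)
  have "sub_ideal A I"
    unfolding sub_ideal_def
  proof (intro conjI ballI)
    show "1 \<in> A" unfolding A_def using expo_0[of T] F_mon[OF expo_0] w_0 by (auto intro!: bexI[of _ "\<lambda>_. 0"])
    show "I \<subseteq> A"
    proof
      fix x assume "x \<in> I"
      then obtain \<mu> where "\<mu> \<in> expo T" "x * mon T \<mu> \<in> F (w \<mu> + 1)" unfolding I_def by blast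
      then show "x \<in> A" using F_anti[of "w \<mu>" "w \<mu> + 1"] unfolding A_def by auto
    qed
    show "0 \<in> I" unfolding I_def using expo_0[of T] by (auto simp: F_def lin.span_zero)
    show "1 \<notin> I"
    proof
      assume "1 \<in> I"
      then obtain \<mu> where "\<mu> \<in> expo T" "mon T \<mu> \<in> F (w \<mu> + 1)" unfolding I_def by auto
      then show False
        using mon_notin_span[OF T, of \<mu> "{\<gamma> \<in> expo T. w \<mu> + 1 \<le> w \<gamma>}"] unfolding F_def by auto
    qed
  next
    fix x y assume "x \<in> A" "y \<in> A"
    then obtain \<mu> \<nu> where *: "\<mu> \<in> expo T" "\<nu> \<in> expo T" "x * mon T \<mu> \<in> F (w \<mu>)" "y * mon T \<nu> \<in> F (w \<nu>)"
      unfolding A_def by auto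
    note e = expo_add[OF *(1,2)]
    have "x * mon T \<mu> * (1 * mon T \<nu>) \<in> F (w \<mu> * w \<nu>)" "(1 * mon T \<mu>) * (y * mon T \<nu>) \<in> F (w \<mu> * w \<nu>)"
      using * by (auto intro!: F_mult F_mon)
    then have "(x + y) * mon T (\<lambda>s. \<mu> s + \<nu> s) \<in> F (w (\<lambda>s. \<mu> s + \<nu> s))"
      unfolding prod w_add by (simp add: algebra_simps F_add)
    then show "x + y \<in> A" unfolding A_def using e by blast
    have "x * mon T \<mu> * (y * mon T \<nu>) \<in> F (w \<mu> * w \<nu>)" using * by (intro F_mult)
    then show "x * y \<in> A" unfolding A_def prod w_add[symmetric] using e by blast
    show "- x \<in> A" unfolding A_def using *(1,3) by (auto intro!: bexI[of _ \<mu>] simp: F_def lin.span_neg)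
  next
    fix x y assume "x \<in> I" "y \<in> I"
    then obtain \<mu> \<nu> where *: "\<mu> \<in> expo T" "\<nu> \<in> expo T" "x * mon T \<mu> \<in> F (w \<mu> + 1)" "y * mon T \<nu> \<in> F (w \<nu> + 1)"
      unfolding I_def by auto
    note e = expo_add[OF *(1,2)]
    have "x * mon T \<mu> * (1 * mon T \<nu>) \<in> F ((w \<mu> + 1) * w \<nu>)" "(1 * mon T \<mu>) * (y * mon T \<nu>) \<in> F (w \<mu> * (w \<nu> + 1))"
      using * by (auto intro!: F_mult F_mon simp del: mult_Suc mult_Suc_right add_mult_distrib add_mult_distrib2)
    moreover have "F ((w \<mu> + 1) * w \<nu>) \<subseteq> F (w \<mu> * w \<nu> + 1)" "F (w \<mu> * (w \<nu> + 1)) \<subseteq> F (w \<mu> * w \<nu> + 1)"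
      using w_pos[of \<mu>] w_pos[of \<nu>] by (intro F_anti; simp)+
    ultimately have "x * mon T \<mu> * (1 * mon T \<nu>) \<in> F (w \<mu> * w \<nu> + 1)" "(1 * mon T \<mu>) * (y * mon T \<nu>) \<in> F (w \<mu> * w \<nu> + 1)"
      by blast+
    then have "(x + y) * mon T (\<lambda>s. \<mu> s + \<nu> s) \<in> F (w (\<lambda>s. \<mu> s + \<nu> s) + 1)"
      unfolding prod w_add by (simp add: algebra_simps F_add)
    then show "x + y \<in> I" unfolding I_def using e by blast
  next
    fix x y assume "x \<in> A" "y \<in> I"
    then obtain \<mu> \<nu> where *: "\<mu> \<in> expo T" "\<nu> \<in> expo T" "x * mon T \<mu> \<in> F (w \<mu>)" "y * mon T \<nu> \<in> F (w \<nu> + 1)"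
      unfolding A_def I_def by auto
    have "x * mon T \<mu> * (y * mon T \<nu>) \<in> F (w \<mu> * (w \<nu> + 1))" using * by (intro F_mult)
    moreover have "w \<mu> * w \<nu> + 1 \<le> w \<mu> * (w \<nu> + 1)" using w_pos[of \<mu>] by simp
    ultimately have "x * mon T \<mu> * (y * mon T \<nu>) \<in> F (w \<mu> * w \<nu> + 1)" using F_anti by blast
    then show "x * y \<in> I" unfolding I_def prod w_add[symmetric] using expo_add[OF *(1,2)] by blast
  qed
  then obtain V where V: "A \<subseteq> V" "1 \<in> V" "\<And>x y. x \<in> V \<Longrightarrow> y \<in> V \<Longrightarrow> x + y \<in> V"
    "\<And>x y. x \<in> V \<Longrightarrow> y \<in> V \<Longrightarrow> x * y \<in> V" "\<And>x. x \<in> V \<Longrightarrow> - x \<in> V"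
    "\<And>x. x \<in> V \<or> inverse x \<in> V" and IV: "\<And>x. x \<in> I \<Longrightarrow> x \<noteq> 0 \<Longrightarrow> inverse x \<notin> V"
    by (rule chevalley) blast
  interpret valuation_subring V by (rule valuation_subring.intro) (use V in blast)+
  have "I \<subseteq> A" using sub_idealD(5)[OF \<open>sub_ideal A I\<close>] by blast
  then have IM: "x \<in> M" if "x \<in> I" for x using IV[OF that] V(1) that by (auto simp: M_def)
  have const: "\<iota> c \<in> V" for c
  proof -
    have "\<iota> c * mon T (\<lambda>_. 0) \<in> F (w (\<lambda>_. 0))"
      using F_mon[OF expo_0, of "w (\<lambda>_. 0)"] unfolding F_def by (intro lin.span_scale) simp
    then have "\<iota> c \<in> A" unfolding A_def using expo_0 by blast
    then show ?thesis using V(1) by blast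
  qed
  have mon_M: "mon T \<gamma> / mon T \<delta> \<in> M" if "\<gamma> \<in> expo T" "\<delta> \<in> expo T" "w \<delta> < w \<gamma>" for \<gamma> \<delta>
  proof (rule IM)
    have "mon T \<gamma> / mon T \<delta> * mon T \<delta> \<in> F (w \<delta> + 1)" using mon_nonzero[OF T that(2)] that by (auto intro: F_mon)
    then show "mon T \<gamma> / mon T \<delta> \<in> I" unfolding I_def using that by blast
  qed
  have ineq: "\<gamma> = \<delta>" if "\<gamma> \<in> expo T" "\<delta> \<in> expo T" "equiv_val (mon T \<gamma>) (mon T \<delta>)" for \<gamma> \<delta>
  proof (rule ccontr)
    assume "\<gamma> \<noteq> \<delta>"
    then have "w \<gamma> < w \<delta> \<or> w \<delta> < w \<gamma>"
      using w_inj[of \<gamma> \<delta>] that unfolding expo_def by (metis (mono_tags, lifting) linorder_neqE_nat mem_Collect_eq)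
    then show False
      using mon_M[of \<gamma> \<delta>] mon_M[of \<delta> \<gamma>] that mon_nonzero[OF T that(1)] mon_nonzero[OF T that(2)]
      by (auto simp: M_def equiv_val_def)
  qed
  have residue: "\<exists>c. u - \<iota> c \<in> M" if u: "u \<in> V" "u \<notin> M" for u
  proof (rule ccontr)
    assume none: "\<nexists>c. u - \<iota> c \<in> M"
    \<comment> \<open>Elements of T have weight above 1, the weight of the empty monomial, so they
      lie in M.\<close>
    have "u \<notin> T"
    proof
      assume uT: "u \<in> T"
      have e: "(\<lambda>x. if x = u then 1 else 0) \<in> expo T" using uT by (auto simp: expo_def)
      have "mon T (\<lambda>x. if x = u then 1 else 0) / mon T (\<lambda>_. 0) \<in> M"
        using w_gen[OF uT] w_0 by (intro mon_M e expo_0) simp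
      then show False using u(2) by (simp add: mon_single[OF T(1) uT])
    qed
    then have "\<not> alg_indep (insert u T)" by (rule max)
    then obtain D c \<gamma>\<^sub>0 where c: "(\<Sum>\<gamma>\<in>exps (insert u T) D. \<iota> (c \<gamma>) * mon (insert u T) \<gamma>) = 0"
      and \<gamma>\<^sub>0: "\<gamma>\<^sub>0 \<in> exps (insert u T) D" "c \<gamma>\<^sub>0 \<noteq> 0" unfolding alg_indep_def by blast
    \<comment> \<open>The relation is regrouped by the exponent \<gamma> of T;
      \<open>f \<gamma>\<close> is the resulting coefficient, a polynomial over k to be evaluated at
      u.\<close>
    define f where "f \<gamma> = (\<Sum>i\<le>D. Polynomial.monom (c (\<gamma>(u := i))) i)" for \<gamma>
    have coeff_f: "Polynomial.coeff (f \<gamma>) i = (if i \<le> D then c (\<gamma>(u := i)) else 0)" for \<gamma> i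
      unfolding f_def by (simp add: coeff_sum)
    define e where "e \<gamma> = Polynomial.poly (map_poly \<iota> (f \<gamma>)) u" for \<gamma>
    have e: "e \<gamma> = (\<Sum>i\<le>D. \<iota> (c (\<gamma>(u := i))) * u ^ i)" for \<gamma>
    proof -
      have "map_poly \<iota> (f \<gamma>) = (\<Sum>i\<le>D. Polynomial.monom (\<iota> (c (\<gamma>(u := i)))) i)"
        by (rule poly_eqI) (simp add: coeff_map_poly coeff_f coeff_sum)
      then show ?thesis unfolding e_def by (simp add: poly_sum poly_monom)
    qed
    have sum0: "(\<Sum>\<gamma>\<in>exps T D. e \<gamma> * mon T \<gamma>) = 0"
    proof -
      have "(\<Sum>\<gamma>\<in>exps T D. e \<gamma> * mon T \<gamma>) = (\<Sum>\<gamma>\<in>exps T D. \<Sum>i\<le>D. \<iota> (c (\<gamma>(u := i))) * (mon T \<gamma> * u ^ i))"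
        by (simp add: e sum_distrib_left sum_distrib_right mult_ac)
      also have "\<dots> = (\<Sum>i\<le>D. \<Sum>\<gamma>\<in>exps T D. \<iota> (c (\<gamma>(u := i))) * (mon T \<gamma> * u ^ i))"
        by (rule sum.swap)
      also have "\<dots> = 0"
        using c by (simp only: sum_exps_insert[OF \<open>u \<notin> T\<close>] mon_insert[OF T(1) \<open>u \<notin> T\<close>])
      finally show ?thesis .
    qed
    define G where "G = {\<gamma> \<in> exps T D. f \<gamma> \<noteq> 0}"
    have e_unit: "e \<gamma> \<notin> M" "e \<gamma> \<in> V" if "\<gamma> \<in> G" for \<gamma>
      using root_avoiding[OF valuation_subring_axioms const u(1), of "f \<gamma>"] none that
      unfolding G_def e_def by blast+
    have "\<gamma>\<^sub>0(u := 0) \<in> exps T D" "Polynomial.coeff (f (\<gamma>\<^sub>0(u := 0))) (\<gamma>\<^sub>0 u) \<noteq> 0"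
      using \<gamma>\<^sub>0 \<open>u \<notin> T\<close> by (auto simp: exps_def coeff_f)
    then have "\<gamma>\<^sub>0(u := 0) \<in> G" unfolding G_def by auto
    moreover have "finite G" unfolding G_def using T(1) by simp
    ultimately obtain \<gamma> where \<gamma>: "\<gamma> \<in> G" "\<And>\<delta>. \<delta> \<in> G \<Longrightarrow> w \<gamma> \<le> w \<delta>"
      using ex_min_if_finite[of "w ` G"] by (metis (no_types, lifting) arg_min_if_finite(1) arg_min_least empty_iff)
    have GE: "G \<subseteq> expo T" unfolding G_def using exps_subset_expo by auto
    have "mon T \<gamma> \<noteq> 0" using mon_nonzero[OF T] \<gamma>(1) GE by auto
    have "0 = (\<Sum>\<delta>\<in>exps T D. e \<delta> * mon T \<delta>) / mon T \<gamma>" by (simp add: sum0)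
    also have "\<dots> = (\<Sum>\<delta>\<in>G. e \<delta> * mon T \<delta>) / mon T \<gamma>"
      unfolding G_def using T(1) by (intro arg_cong2[of _ _ _ _ "(/)"] sum.mono_neutral_right) (auto simp: e_def)
    also have "\<dots> = (\<Sum>\<delta>\<in>G. e \<delta> * (mon T \<delta> / mon T \<gamma>))" by (simp add: sum_divide_distrib)
    also have "\<dots> = e \<gamma> + (\<Sum>\<delta>\<in>G - {\<gamma>}. e \<delta> * (mon T \<delta> / mon T \<gamma>))"
      using \<open>finite G\<close> \<gamma>(1) \<open>mon T \<gamma> \<noteq> 0\<close> by (simp add: sum.remove)
    finally have "e \<gamma> = - (\<Sum>\<delta>\<in>G - {\<gamma>}. e \<delta> * (mon T \<delta> / mon T \<gamma>))"
      by (simp add: eq_neg_iff_add_eq_0)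
    also have "\<dots> \<in> M"
    proof (intro M_uminus M_sum M_mult mon_M)
      fix \<delta> assume \<delta>: "\<delta> \<in> G - {\<gamma>}"
      then show "e \<delta> \<in> V" using e_unit by blast
      show "\<delta> \<in> expo T" "\<gamma> \<in> expo T" using \<delta> \<gamma> GE by auto
      then have "w \<gamma> \<noteq> w \<delta>" using w_inj[of \<gamma> \<delta>] \<delta> unfolding expo_def by auto
      then show "w \<gamma> < w \<delta>" using \<gamma>(2)[of \<delta>] \<delta> by auto
    qed
    finally show False using e_unit \<gamma>(1) by blast
  qed
  have "residue_valuation \<iota> V"
    by unfold_locales (use const residue in blast)+
  then show thesis using ineq by (rule that)
qed

lemma residue_valuation_of_basis:
  assumes "function_field_dim \<iota> = enat n"
  obtains T V where "finite T" "alg_indep T" "card T = n" "residue_valuation \<iota> V"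
    "\<And>\<gamma> \<delta>. \<gamma> \<in> expo T \<Longrightarrow> \<delta> \<in> expo T \<Longrightarrow> valuation_subring.equiv_val V (mon T \<gamma>) (mon T \<delta>) \<Longrightarrow> \<gamma> = \<delta>"
proof -
  obtain T where T: "finite T" "alg_indep T" "card T = n" using transcendence_basis[OF assms] .
  have max: "\<not> alg_indep (insert u T)" if "u \<notin> T" for u
    using alg_indep_card_le[of "insert u T"] T that assms by auto
  show thesis
  proof (rule exists_residue_valuation[OF T(1,2) max])
    fix V assume "residue_valuation \<iota> V" "\<And>\<gamma> \<delta>. \<gamma> \<in> expo T \<Longrightarrow> \<delta> \<in> expo T \<Longrightarrow>
      valuation_subring.equiv_val V (mon T \<gamma>) (mon T \<delta>) \<Longrightarrow> \<gamma> = \<delta>"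
    then show thesis by (intro that[OF T])
  qed
qed

end

section \<open>Saturated elements\<close>

text \<open>S stands for the affine coordinates of a projective model together with 1; the last
  assumption says that K is the field of fractions of the algebra that they generate.\<close>

locale coordinates = ground_field \<iota> for \<iota> :: "'k::alg_closed_field \<Rightarrow> 'a::field" +
  fixes S :: "'a set"
  assumes finite_S: "finite S" and one_S: "1 \<in> S"
    and fractions: "\<exists>h c. h \<noteq> 0 \<and> h \<in> homog S c \<and> h * f \<in> homog S c"
begin

lemma homog_monoD: "x \<in> homog S M \<Longrightarrow> M \<le> M' \<Longrightarrow> x \<in> homog S M'"
  using homog_mono[OF finite_S one_S] .

lemma common_denominator:
  assumes "finite T"
  obtains h c where "h \<noteq> 0" "1 \<le> c" "h \<in> homog S c" "\<And>t. t \<in> T \<Longrightarrow> h * t \<in> homog S c"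
proof -
  have "\<exists>h c. h \<noteq> 0 \<and> 1 \<le> c \<and> h \<in> homog S c \<and> (\<forall>t\<in>T. h * t \<in> homog S c)"
    using assms
  proof (induction T rule: finite_induct)
    case empty
    show ?case using homog_1[OF finite_S one_S, of 1] by (intro exI[of _ 1]) auto
  next
    case (insert t T)
    then obtain h c where h: "h \<noteq> 0" "1 \<le> c" "h \<in> homog S c" "\<forall>t\<in>T. h * t \<in> homog S c" by auto
    obtain g d where g: "g \<noteq> 0" "g \<in> homog S d" "g * t \<in> homog S d" using fractions[of t] by blast
    have "h * g * x \<in> homog S (c + d)" if "x \<in> insert t T" for x
    proof (cases "x = t")
      case True
      then show ?thesis using homog_mult[OF h(3) g(3)] by (simp add: mult_ac)
    next
      case False
      then show ?thesis using homog_mult[OF h(4)[rule_format, of x] g(2)] that by (simp add: mult_ac)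
    qed
    then show ?case
      using h(1,2) g(1) homog_mult[OF h(3) g(2)] by (intro exI[of _ "h * g"] exI[of _ "c + d"]) auto
  qed
  then show thesis using that by blast
qed

text \<open>Each factor is padded to contain \<open>h ^ D\<close>, so that denominator and degree
  are the same for all exponents in the box, as linear combinations require.\<close>

lemma denominator_monomial:
  assumes "finite T" "h \<in> homog S c" "\<And>t. t \<in> T \<Longrightarrow> h * t \<in> homog S c" "\<gamma> \<in> exps T D"
  shows "h ^ (card T * D) * mon T \<gamma> \<in> homog S (card T * D * c)"
proof -
  have "(\<Prod>t\<in>T. (h * t) ^ \<gamma> t * h ^ (D - \<gamma> t)) \<in> homog S (\<Sum>t\<in>T. D * c)"
  proof (rule homog_prod[OF assms(1)])
    fix t assume t: "t \<in> T"
    then have "\<gamma> t \<le> D" using assms(4) by (simp add: exps_def)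
    then have "\<gamma> t * c + (D - \<gamma> t) * c = D * c" by (simp flip: add_mult_distrib)
    then show "(h * t) ^ \<gamma> t * h ^ (D - \<gamma> t) \<in> homog S (D * c)"
      using homog_mult[OF homog_power[OF assms(3)[OF t], of "\<gamma> t"] homog_power[OF assms(2), of "D - \<gamma> t"]] by simp
  qed
  moreover have "(\<Prod>t\<in>T. (h * t) ^ \<gamma> t * h ^ (D - \<gamma> t)) = (\<Prod>t\<in>T. h ^ D * t ^ \<gamma> t)"
  proof (rule prod.cong[OF refl])
    fix t assume t: "t \<in> T"
    then have "\<gamma> t \<le> D" using assms(4) by (simp add: exps_def)
    then have "h ^ D = h ^ \<gamma> t * h ^ (D - \<gamma> t)" by (simp flip: power_add)
    then show "(h * t) ^ \<gamma> t * h ^ (D - \<gamma> t) = h ^ D * t ^ \<gamma> t" by (simp only: power_mult_distrib mult_ac)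
  qed
  moreover have "\<dots> = h ^ (card T * D) * mon T \<gamma>"
    by (simp add: prod.distrib mon_def mult.commute power_mult)
  ultimately show ?thesis by (simp add: mult.assoc)
qed

text \<open>A transcendental family of size \<open>k\<close> produces \<open>(D + 1) ^ k\<close> independent elements in degree
  \<open>O(D)\<close>, which the growth of \<open>S\<close> only allows for bounded \<open>k\<close>.\<close>

lemma function_field_dim_finite: "\<exists>n. function_field_dim \<iota> = enat n"
proof -
  obtain T C where T: "T \<subseteq> S" "\<And>M. M \<ge> 1 \<Longrightarrow> dim_at_most (homog S M) (C * M ^ card T)"
    using growth[OF finite_S] by blast
  have "card T' \<le> card T" if T': "finite T'" "alg_indep T'" for T'
  proof (rule ccontr)
    assume "\<not> card T' \<le> card T"
    then have k: "card T' \<ge> card T + 1" by simp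
    obtain h c where h: "h \<noteq> 0" "1 \<le> c" "h \<in> homog S c" "\<And>t. t \<in> T' \<Longrightarrow> h * t \<in> homog S c"
      using common_denominator[OF T'(1)] by blast
    define B where "B = C * (card T' * c) ^ card T"
    have le: "(D + 1) ^ card T' \<le> B * D ^ card T" if "D \<ge> 1" for D
    proof (rule ccontr)
      assume "\<not> (D + 1) ^ card T' \<le> B * D ^ card T"
      then have "C * (card T' * D * c) ^ card T < card (exps T' D)"
        using T'(1) by (simp add: card_exps B_def power_mult_distrib mult_ac)
      moreover have "card T' * D * c \<ge> 1" using that k h(2) by simp
      ultimately obtain u where "\<exists>\<gamma>\<in>exps T' D. u \<gamma> \<noteq> 0" "(\<Sum>\<gamma>\<in>exps T' D. \<iota> (u \<gamma>) * mon T' \<gamma>) = 0"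
        using dim_at_most_relation_scaled[OF T(2), of "card T' * D * c" "exps T' D" "h ^ (card T' * D)" "mon T'"]
          denominator_monomial[OF T'(1) h(3,4)] h(1) T'(1) by auto
      then show False using T'(2) unfolding alg_indep_def by blast
    qed
    \<comment> \<open>At this D a power of exponent at least \<open>card T + 1\<close> already
      exceeds \<open>B * D ^ card T\<close>.\<close>
    define D where "D = B + 1"
    have "D ^ card T * D = D ^ (card T + 1)" by simp
    also have "\<dots> \<le> D ^ card T'" using k by (intro power_increasing) (auto simp: D_def)
    also have "\<dots> \<le> (D + 1) ^ card T'" by (intro power_mono) auto
    also have "\<dots> \<le> B * D ^ card T" by (rule le) (simp add: D_def)
    finally have "D \<le> B" by (simp add: D_def mult.commute)
    then show False by (simp add: D_def)
  qed
  then have "function_field_dim \<iota> \<le> enat (card T)"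
    unfolding function_field_dim_def transcendence_degree_def
    by (intro SUP_least) (auto simp: algebraically_independent_iff)
  then show ?thesis by (cases "function_field_dim \<iota>") auto
qed

definition n :: nat where
  "n = the_enat (function_field_dim \<iota>)"

lemma function_field_dim_eq: "function_field_dim \<iota> = enat n"
  using function_field_dim_finite by (auto simp: n_def)

lemma growth_dim:
  obtains C where "\<And>M. M \<ge> 1 \<Longrightarrow> dim_at_most (homog S M) (C * M ^ n)"
proof -
  obtain T C where T: "T \<subseteq> S" "alg_indep T" "\<And>M. M \<ge> 1 \<Longrightarrow> dim_at_most (homog S M) (C * M ^ card T)"
    using growth[OF finite_S] by blast
  have "card T \<le> n"
    using alg_indep_card_le[of T] T finite_S finite_subset function_field_dim_eq by (metis enat_ord_simps(1))
  then show thesis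
    by (intro that[of C] dim_at_most_mono[OF T(3)]) (auto intro: power_increasing)
qed

text \<open>If \<open>S\<close> consists of the \<open>x\<^sub>j / x\<^sub>0\<close> for the homogeneous coordinates \<open>x\<^sub>j\<close> of a projective variety,
  these are the global sections of \<open>\<O>(d)\<close>.\<close>

definition saturated :: "nat \<Rightarrow> 'a set" where
  "saturated d = {z. \<forall>s\<in>S. s \<noteq> 0 \<longrightarrow> (\<exists>M. z * s ^ M \<in> homog S (d + M))}"

lemma saturated_uniform:
  assumes "z \<in> saturated d"
  shows "\<exists>M\<ge>1. \<forall>s\<in>S. s \<noteq> 0 \<longrightarrow> z * s ^ M \<in> homog S (d + M)"
proof -
  have "\<forall>s\<in>S. \<exists>M. s \<noteq> 0 \<longrightarrow> z * s ^ M \<in> homog S (d + M)"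
    using assms unfolding saturated_def by blast
  then obtain m where m: "\<forall>s\<in>S. s \<noteq> 0 \<longrightarrow> z * s ^ m s \<in> homog S (d + m s)"
    unfolding bchoice_iff by blast
  \<comment> \<open>The summand 1 makes the exponent positive, so that \<open>s ^ M\<close> vanishes
    for s = 0; \<open>saturated_mult_homog\<close> relies on it.\<close>
  show ?thesis
  proof (intro exI[of _ "sum m S + 1"] conjI ballI impI)
    fix s assume s: "s \<in> S" "s \<noteq> 0"
    define e where "e = sum m S + 1 - m s"
    have e: "m s + e = sum m S + 1" using member_le_sum[OF s(1), of m] finite_S by (simp add: e_def)
    have "z * s ^ m s * s ^ e \<in> homog S (d + m s + e * 1)"
      by (intro homog_mult m[rule_format] s homog_power homog_generator finite_S)
    moreover have "z * s ^ m s * s ^ e = z * s ^ (sum m S + 1)"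
      unfolding e[symmetric] by (simp add: power_add mult.assoc)
    moreover have "d + m s + e * 1 = d + (sum m S + 1)" unfolding e[symmetric] by simp
    ultimately show "z * s ^ (sum m S + 1) \<in> homog S (d + (sum m S + 1))" by metis
  qed simp
qed

text \<open>A monomial of degree at least \<open>card S * M\<close> contains some s to the power M,
  and z absorbs that power. So z behaves like a form of degree d in all large degrees.\<close>

lemma saturated_mult_homog:
  assumes "z \<in> saturated d"
  obtains b where "\<And>b' x. b \<le> b' \<Longrightarrow> x \<in> homog S b' \<Longrightarrow> z * x \<in> homog S (d + b')"
proof -
  obtain M where M1: "M \<ge> 1" and M2: "\<forall>s\<in>S. s \<noteq> 0 \<longrightarrow> z * s ^ M \<in> homog S (d + M)"
    using saturated_uniform[OF assms] by blast
  note M = M1 M2[rule_format]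
  show thesis
  proof (rule that[of "card S * M"])
    fix b' x assume b': "card S * M \<le> b'" and x: "x \<in> homog S b'"
    have "z * x \<in> lin.span {mon S \<alpha> |\<alpha>. sum \<alpha> S = d + b'}"
    proof (rule span_mult[OF lin.span_base[OF singletonI] x[unfolded homog_def]])
      fix y a assume "y \<in> {z}" "a \<in> {mon S \<alpha> |\<alpha>. sum \<alpha> S = b'}"
      then obtain \<alpha> where y: "y = z" and a: "a = mon S \<alpha>" and \<alpha>: "sum \<alpha> S = b'" by auto
      have "\<exists>s\<in>S. M \<le> \<alpha> s"
      proof (rule ccontr)
        assume "\<not> ?thesis"
        then have "sum \<alpha> S < (\<Sum>s\<in>S. M)" using finite_S one_S by (intro sum_strict_mono) auto
        then show False using b' \<alpha> by simp
      qed
      then obtain s where s: "s \<in> S" "M \<le> \<alpha> s" by blast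
      define \<beta> where "\<beta> = \<alpha>(s := \<alpha> s - M)"
      have \<alpha>\<beta>: "mon S \<alpha> = s ^ M * mon S \<beta>"
        using mon_upd[OF finite_S s(1), of \<beta> M] s(2) by (simp add: \<beta>_def)
      have "sum \<beta> (S - {s}) = sum \<alpha> (S - {s})" unfolding \<beta>_def by (rule sum.cong) auto
      then have \<beta>: "M + sum \<beta> S = b'"
        using \<alpha> s sum.remove[OF finite_S s(1), of \<alpha>] sum.remove[OF finite_S s(1), of \<beta>] by (simp add: \<beta>_def)
      show "y * a \<in> lin.span {mon S \<alpha> |\<alpha>. sum \<alpha> S = d + b'}"
        unfolding homog_def[symmetric]
      proof (cases "s = 0")
        case True
        then have "y * a = 0" using M(1) by (simp add: a \<alpha>\<beta>)
        then show "y * a \<in> homog S (d + b')" using lin.subspace_0[OF homog_subspace] by (simp only:)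
      next
        case False
        have "mon S \<beta> \<in> homog S (sum \<beta> S)" unfolding homog_def by (intro lin.span_base) auto
        from homog_mult[OF M(2)[OF s(1) False] this] show "y * a \<in> homog S (d + b')"
          by (simp add: y a \<alpha>\<beta> mult_ac add_ac flip: \<beta>)
      qed
    qed
    then show "z * x \<in> homog S (d + b')" by (simp add: homog_def)
  qed
qed

text \<open>The loss of b occurs once and not with every factor: from degree b on, each
  multiplication by z costs exactly d.\<close>

lemma saturated_power:
  assumes "z \<in> saturated d"
  obtains b where "\<And>i. z ^ i \<in> homog S (b + i * d)"
proof -
  obtain b where b: "\<And>b' x. b \<le> b' \<Longrightarrow> x \<in> homog S b' \<Longrightarrow> z * x \<in> homog S (d + b')"
    using saturated_mult_homog[OF assms] by blast
  have "z ^ i \<in> homog S (b + i * d)" for i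
  proof (induction i)
    case 0
    show ?case using homog_1[OF finite_S one_S] by simp
  next
    case (Suc i)
    show ?case using b[OF _ Suc] by (simp add: add_ac)
  qed
  then show thesis by (rule that)
qed

lemma saturated_subspace: "lin.subspace (saturated d)"
  unfolding lin.subspace_def
proof (intro conjI ballI allI)
  show "0 \<in> saturated d" by (auto simp: saturated_def homog_def lin.span_zero)
  fix x y c assume x: "x \<in> saturated d"
  show "\<iota> c * x \<in> saturated d"
    using x unfolding saturated_def by (auto simp: mult.assoc homog_def intro: lin.span_scale)
  assume y: "y \<in> saturated d"
  obtain M where M0: "\<forall>s\<in>S. s \<noteq> 0 \<longrightarrow> x * s ^ M \<in> homog S (d + M)"
    using saturated_uniform[OF x] by blast
  note M = M0[rule_format]
  obtain N where N0: "\<forall>s\<in>S. s \<noteq> 0 \<longrightarrow> y * s ^ N \<in> homog S (d + N)"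
    using saturated_uniform[OF y] by blast
  note N = N0[rule_format]
  have gen: "s ^ i \<in> homog S i" if "s \<in> S" for s i
    using homog_power[OF homog_generator[OF finite_S that], of i] by simp
  have "(x + y) * s ^ (M + N) \<in> homog S (d + (M + N))" if s: "s \<in> S" "s \<noteq> 0" for s
  proof -
    have "(x * s ^ M) * s ^ N \<in> homog S (d + (M + N))" "(y * s ^ N) * s ^ M \<in> homog S (d + (M + N))"
      using homog_mult[OF M[OF s] gen[OF s(1), of N]] homog_mult[OF N[OF s] gen[OF s(1), of M]]
      by (simp_all add: add_ac)
    then have "(x * s ^ M) * s ^ N + (y * s ^ N) * s ^ M \<in> homog S (d + (M + N))"
      by (rule lin.subspace_add[OF homog_subspace])
    then show ?thesis by (simp add: power_add algebra_simps)
  qed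
  then show "x + y \<in> saturated d" unfolding saturated_def by blast
qed

lemma saturated_mult: "x \<in> saturated d \<Longrightarrow> y \<in> saturated e \<Longrightarrow> x * y \<in> saturated (d + e)"
proof -
  assume x: "x \<in> saturated d" and y: "y \<in> saturated e"
  obtain M where M0: "\<forall>s\<in>S. s \<noteq> 0 \<longrightarrow> x * s ^ M \<in> homog S (d + M)"
    using saturated_uniform[OF x] by blast
  note M = M0[rule_format]
  obtain N where N0: "\<forall>s\<in>S. s \<noteq> 0 \<longrightarrow> y * s ^ N \<in> homog S (e + N)"
    using saturated_uniform[OF y] by blast
  note N = N0[rule_format]
  have "(x * y) * s ^ (M + N) \<in> homog S (d + e + (M + N))" if s: "s \<in> S" "s \<noteq> 0" for s
    using homog_mult[OF M[OF s] N[OF s]] by (simp add: power_add mult_ac add_ac)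
  then show ?thesis unfolding saturated_def by blast
qed

lemma homog_saturated: "homog S d \<subseteq> saturated d"
  unfolding saturated_def by (auto intro!: exI[of _ 0])

lemma saturated_power_mem: "x \<in> saturated d \<Longrightarrow> x ^ i \<in> saturated (i * d)"
proof (induction i)
  case 0
  show ?case using homog_saturated[of 0] homog_1[OF finite_S one_S] by auto
qed (auto intro: saturated_mult)

end

section \<open>Counting the values of sections of O(d)\<close>

locale monomial_valuation = coordinates \<iota> S + residue_valuation \<iota> V
  for \<iota> :: "'k::alg_closed_field \<Rightarrow> 'a::field" and S V :: "'a set" +
  fixes T :: "'a set" and C c :: nat and h :: 'a
  assumes finite_T: "finite T" and indep_T: "alg_indep T" and card_T: "card T = n"
    and mon_inj: "\<gamma> \<in> expo T \<Longrightarrow> \<delta> \<in> expo T \<Longrightarrow> mon T \<gamma> \<sim>\<^sub>V mon T \<delta> \<Longrightarrow> \<gamma> = \<delta>"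
    and C: "m \<ge> 1 \<Longrightarrow> dim_at_most (homog S m) (C * m ^ n)"
    and h: "h \<noteq> 0" "1 \<le> c" "h \<in> homog S c" "t \<in> T \<Longrightarrow> h * t \<in> homog S c"
begin

lemma mon_T_nonzero: "\<gamma> \<in> expo T \<Longrightarrow> mon T \<gamma> \<noteq> 0"
  using mon_nonzero[OF finite_T indep_T] .

text \<open>Products with distinct values are independent, and \<open>h ^ (n * D)\<close> moves them
  into a space of forms of known growth. The point is the order of quantifiers: b depends on z, but
  l and D may be taken large afterwards.\<close>

lemma count_values:
  assumes z: "z \<in> saturated d" "z \<noteq> 0"
  shows "\<exists>b\<ge>1. \<forall>l D P. P \<subseteq> {..l} \<times> exps T D \<and>
      (\<forall>p\<in>P. \<forall>q\<in>P. z ^ fst p * mon T (snd p) \<sim>\<^sub>V z ^ fst q * mon T (snd q) \<longrightarrow> p = q) \<longrightarrow>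
      card P \<le> C * (b + l * d + n * D * c) ^ n"
proof -
  obtain b where b: "\<And>i. z ^ i \<in> homog S (b + i * d)" using saturated_power[OF z(1)] by blast
  show ?thesis
  proof (intro exI[of _ "b + 1"] conjI allI impI, simp, elim conjE)
    fix l D and P :: "(nat \<times> ('a \<Rightarrow> nat)) set"
    assume P: "P \<subseteq> {..l} \<times> exps T D" and
      inj0: "\<forall>p\<in>P. \<forall>q\<in>P. z ^ fst p * mon T (snd p) \<sim>\<^sub>V z ^ fst q * mon T (snd q) \<longrightarrow> p = q"
    note inj = inj0[rule_format]
    define f where "f p = z ^ fst p * mon T (snd p)" for p
    define K where "K = b + 1 + l * d + n * D * c"
    have nz: "f p \<noteq> 0" if "p \<in> P" for p
    proof -
      have "snd p \<in> expo T" using that P exps_subset_expo[of T D] by force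
      then show ?thesis using z(2) by (simp add: f_def mon_T_nonzero)
    qed
    have injf: "inj_on f P"
    proof (rule inj_onI)
      fix p q assume pq: "p \<in> P" "q \<in> P" "f p = f q"
      then have "f p \<sim>\<^sub>V f q" using equiv_val_refl[OF nz[OF pq(1)]] by simp
      then show "p = q" using inj pq by (simp add: f_def)
    qed
    have finP: "finite P" by (rule finite_subset[OF P]) (use finite_T in auto)
    have "\<not> lin.dependent (f ` P)"
    proof (rule inequivalent_independent)
      show "finite (f ` P)" using finP by simp
      show "0 \<notin> f ` P" using nz by force
      fix x y assume "x \<in> f ` P" "y \<in> f ` P" "x \<noteq> y"
      then show "\<not> x \<sim>\<^sub>V y" using inj by (auto simp: f_def)
    qed
    moreover have "dim_at_most (f ` P) (C * K ^ n)"
    proof (rule dim_at_most_scale[OF C[of K]])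
      show "h ^ (n * D) \<noteq> 0" using h(1) by simp
      fix x assume "x \<in> f ` P"
      then obtain i \<gamma> where ig: "(i, \<gamma>) \<in> P" "x = z ^ i * mon T \<gamma>" by (auto simp: f_def)
      then have "\<gamma> \<in> exps T D" "i \<le> l" using P by auto
      then have "h ^ (n * D) * mon T \<gamma> \<in> homog S (n * D * c)"
        using denominator_monomial[OF finite_T h(3,4)] card_T by simp
      from homog_mult[OF b[of i] this] have "h ^ (n * D) * x \<in> homog S (b + i * d + n * D * c)"
        by (simp add: ig mult_ac)
      moreover have "i * d \<le> l * d" using \<open>i \<le> l\<close> by (rule mult_le_mono1)
      then have "b + i * d + n * D * c \<le> K" unfolding K_def by linarith
      ultimately show "h ^ (n * D) * x \<in> homog S K" by (rule homog_monoD)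
    qed (simp add: K_def)
    ultimately have "card (f ` P) \<le> C * K ^ n" using finP unfolding dim_at_most_def by blast
    then show "card P \<le> C * (b + 1 + l * d + n * D * c) ^ n"
      using card_image[OF injf] by (simp add: K_def)
  qed
qed

text \<open>Chosen to contradict the counts in \<open>torsion\<close> and
  \<open>exponent_bound\<close>. There D dominates b and the degrees of the powers of z, so all
  products have degree at most \<open>(2 + n * c) * D\<close> and
  \<open>(1 + A\<^sub>1 + n * c) * D\<close>, respectively, without b.\<close>

definition A\<^sub>1 :: nat where "A\<^sub>1 = C * (2 + n * c) ^ n + 1"
definition A\<^sub>2 :: nat where "A\<^sub>2 = C * (1 + A\<^sub>1 + n * c) ^ n"

text \<open>There are more products \<open>z ^ i * mon T \<gamma>\<close> than
  \<open>count_values\<close> allows, so two have the same value. They differ in the power of z,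
  because monomials in T have distinct values. Cancelling the smaller power shows that a bounded
  multiple of the value of z is the value of a Laurent monomial.\<close>

lemma torsion:
  assumes z: "z \<in> saturated d" "z \<noteq> 0" and d: "d \<ge> 1"
  shows "\<exists>k \<beta> \<beta>'. 1 \<le> k \<and> k \<le> A\<^sub>1 \<and> \<beta> \<in> expo T \<and> \<beta>' \<in> expo T \<and> z ^ k * mon T \<beta> \<sim>\<^sub>V mon T \<beta>'"
proof -
  obtain b where b1: "b \<ge> 1" and b2: "\<forall>l D P. P \<subseteq> {..l} \<times> exps T D \<and>
      (\<forall>p\<in>P. \<forall>q\<in>P. z ^ fst p * mon T (snd p) \<sim>\<^sub>V z ^ fst q * mon T (snd q) \<longrightarrow> p = q) \<longrightarrow>
      card P \<le> C * (b + l * d + n * D * c) ^ n"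
    using count_values[OF z] by blast
  note b = b1 b2[rule_format, OF conjI]
  \<comment> \<open>Large compared with b and with the degree \<open>A\<^sub>1 * d\<close> of the
    highest power of z.\<close>
  define D where "D = (b + A\<^sub>1) * d"
  have "b + A\<^sub>1 \<le> D" using mult_le_mono2[OF d, of "b + A\<^sub>1"] by (simp add: D_def)
  then have "b \<le> D" "A\<^sub>1 * d \<le> D" "D \<ge> 1" using b(1) by (auto simp: D_def algebra_simps)
  have "\<exists>p\<in>{..A\<^sub>1} \<times> exps T D. \<exists>q\<in>{..A\<^sub>1} \<times> exps T D.
    z ^ fst p * mon T (snd p) \<sim>\<^sub>V z ^ fst q * mon T (snd q) \<and> p \<noteq> q"
  proof (rule ccontr)
    assume "\<not> ?thesis"
    then have "card ({..A\<^sub>1} \<times> exps T D) \<le> C * (b + A\<^sub>1 * d + n * D * c) ^ n"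
      by (intro b(2)[OF order_refl] ballI impI) blast
    also have "\<dots> \<le> C * ((2 + n * c) * D) ^ n"
      using \<open>b \<le> D\<close> \<open>A\<^sub>1 * d \<le> D\<close> by (intro mult_le_mono2 power_mono) (auto simp: algebra_simps)
    also have "\<dots> \<le> A\<^sub>1 * D ^ n" by (simp only: A\<^sub>1_def power_mult_distrib) (simp add: add_mult_distrib mult.assoc)
    also have "\<dots> \<le> A\<^sub>1 * (D + 1) ^ n" by (intro mult_le_mono2 power_mono) auto
    finally have "(A\<^sub>1 + 1) * (D + 1) ^ n \<le> A\<^sub>1 * (D + 1) ^ n"
      by (simp add: card_cartesian_product card_exps[OF finite_T] card_T)
    then show False by simp
  qed
  then obtain p q where pq: "p \<in> {..A\<^sub>1} \<times> exps T D" "q \<in> {..A\<^sub>1} \<times> exps T D"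
    "z ^ fst p * mon T (snd p) \<sim>\<^sub>V z ^ fst q * mon T (snd q)" "p \<noteq> q" by blast
  obtain i \<gamma> where p: "p = (i, \<gamma>)" by (cases p)
  obtain j \<delta> where q: "q = (j, \<delta>)" by (cases q)
  have ij: "i \<le> A\<^sub>1" "j \<le> A\<^sub>1" "\<gamma> \<in> expo T" "\<delta> \<in> expo T"
    "z ^ i * mon T \<gamma> \<sim>\<^sub>V z ^ j * mon T \<delta>" "(i, \<gamma>) \<noteq> (j, \<delta>)"
    using pq exps_subset_expo[of T D] unfolding p q by auto
  have main: ?thesis if "j < i" "i \<le> A\<^sub>1" "\<gamma> \<in> expo T" "\<delta> \<in> expo T" "z ^ i * mon T \<gamma> \<sim>\<^sub>V z ^ j * mon T \<delta>" for i j \<gamma> \<delta>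
  proof -
    have "z ^ i = z ^ (i - j) * z ^ j" using that(1) by (simp flip: power_add)
    then have "(z ^ (i - j) * mon T \<gamma>) * z ^ j \<sim>\<^sub>V mon T \<delta> * z ^ j"
      using that(5) by (simp add: mult_ac)
    then have "z ^ (i - j) * mon T \<gamma> \<sim>\<^sub>V mon T \<delta>" using z(2) by (simp add: equiv_val_cancel)
    then show ?thesis using that by (intro exI[of _ "i - j"]) auto
  qed
  consider "i < j" | "j < i" | "i = j" by linarith
  then show ?thesis
  proof cases
    case 1
    then show ?thesis using main[OF _ ij(2,4,3) equiv_val_sym[OF ij(5)]] by blast
  next
    case 2
    then show ?thesis using main[OF _ ij(1,3,4,5)] by blast
  next
    case 3
    then have "mon T \<gamma> * z ^ i \<sim>\<^sub>V mon T \<delta> * z ^ i" using ij(5) by (simp add: mult.commute)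
    then have "mon T \<gamma> \<sim>\<^sub>V mon T \<delta>" using z(2) by (simp add: equiv_val_cancel)
    then show ?thesis using mon_inj[OF ij(3,4)] 3 ij(6) by simp
  qed
qed

lemma card_exps_restricted:
  assumes "t \<in> T" "\<delta> \<ge> 1" "\<delta> \<le> D + 1"
  shows "card {\<gamma> \<in> exps T D. \<gamma> t < \<delta>} = \<delta> * (D + 1) ^ (n - 1)"
proof -
  have "bij_betw (\<lambda>(i, \<gamma>). \<gamma>(t := i)) ({..<\<delta>} \<times> exps (T - {t}) D) {\<gamma> \<in> exps T D. \<gamma> t < \<delta>}"
    using assms by (intro bij_betw_byWitness[where f' = "\<lambda>\<gamma>. (\<gamma> t, \<gamma>(t := 0))"])
      (auto simp: exps_def fun_eq_iff split: if_splits)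
  from bij_betw_same_card[OF this] show ?thesis
    using assms(1) finite_T card_T by (simp add: card_cartesian_product card_exps)
qed

text \<open>Suppose that the exponent of t in the Laurent monomial has absolute value \<delta> above
  \<open>A\<^sub>2 * d\<close>. Powers \<open>z ^ (k * i)\<close> times monomials with exponent of t
  below \<delta> then have distinct values, because i can be recovered as in division with remainder
  by \<delta>. For i up to l and \<open>D = l * d\<close> there are about
  \<open>l * \<delta> * D ^ (n - 1)\<close> of them, more than the growth permits.\<close>

lemma exponent_bound:
  assumes z: "z \<in> saturated d" "z \<noteq> 0" and d: "d \<ge> 1"
    and k: "1 \<le> k" "k \<le> A\<^sub>1" "\<beta> \<in> expo T" "\<beta>' \<in> expo T" "z ^ k * mon T \<beta> \<sim>\<^sub>V mon T \<beta>'" and t: "t \<in> T"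
  shows "\<bar>int (\<beta>' t) - int (\<beta> t)\<bar> \<le> int (A\<^sub>2 * d)"
proof (rule ccontr)
  define \<delta> where "\<delta> = nat \<bar>int (\<beta>' t) - int (\<beta> t)\<bar>"
  assume "\<not> ?thesis"
  then have \<delta>: "A\<^sub>2 * d < \<delta>" unfolding \<delta>_def by linarith
  have n: "n \<ge> 1" using t finite_T card_T by (metis One_nat_def Suc_leI card_gt_0_iff empty_iff)
  obtain b where b1: "b \<ge> 1" and b2: "\<forall>l D P. P \<subseteq> {..l} \<times> exps T D \<and>
      (\<forall>p\<in>P. \<forall>q\<in>P. z ^ fst p * mon T (snd p) \<sim>\<^sub>V z ^ fst q * mon T (snd q) \<longrightarrow> p = q) \<longrightarrow>
      card P \<le> C * (b + l * d + n * D * c) ^ n"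
    using count_values[OF z] by blast
  note b = b1 b2[rule_format, OF conjI]
  \<comment> \<open>The summand b lets D absorb b, and the summand \<delta> makes the exponents
    below \<delta> fit into the box.\<close>
  define l where "l = b + \<delta>"
  define D where "D = l * d"
  have "b + \<delta> \<le> D" using mult_le_mono2[OF d, of l] by (simp add: D_def l_def)
  then have D: "b \<le> D" "\<delta> \<le> D" "D \<ge> 1" using b(1) by auto
  define P where "P = (\<lambda>(i, \<gamma>). (k * i, \<gamma>)) ` ({..l} \<times> {\<gamma> \<in> exps T D. \<gamma> t < \<delta>})"
  have scale: "(\<lambda>x. i * \<mu> x) \<in> expo T" if "\<mu> \<in> expo T" for i \<mu> using that by (auto simp: expo_def)
  have mon_scale: "mon T \<mu> ^ i = mon T (\<lambda>x. i * \<mu> x)" for \<mu> i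
    by (simp add: mon_def prod_power_distrib mult.commute flip: power_mult)
  have zi: "z ^ (k * i) * mon T (\<lambda>x. i * \<beta> x) \<sim>\<^sub>V mon T (\<lambda>x. i * \<beta>' x)" for i
    using equiv_val_power[OF k(5), of i] by (simp add: power_mult_distrib power_mult mon_scale)
  have inj: "i = i' \<and> \<gamma> = \<gamma>'"
    if \<gamma>: "\<gamma> \<in> exps T D" "\<gamma> t < \<delta>" "\<gamma>' \<in> exps T D" "\<gamma>' t < \<delta>"
      and eq: "z ^ (k * i) * mon T \<gamma> \<sim>\<^sub>V z ^ (k * i') * mon T \<gamma>'" for i i' \<gamma> \<gamma>'
  proof -
    have e: "\<gamma> \<in> expo T" "\<gamma>' \<in> expo T" using \<gamma> exps_subset_expo by auto
    \<comment> \<open>Both sides are multiplied by the same monomial to clear the denominators of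
      the two Laurent monomials.\<close>
    let ?m = "mon T (\<lambda>x. i * \<beta> x) * mon T (\<lambda>x. i' * \<beta> x)"
    let ?l = "mon T (\<lambda>x. i * \<beta>' x) * (mon T \<gamma> * mon T (\<lambda>x. i' * \<beta> x))"
    let ?r = "mon T (\<lambda>x. i' * \<beta>' x) * (mon T \<gamma>' * mon T (\<lambda>x. i * \<beta> x))"
    have refl: "mon T \<mu> * mon T \<nu> \<sim>\<^sub>V mon T \<mu> * mon T \<nu>" if "\<mu> \<in> expo T" "\<nu> \<in> expo T" for \<mu> \<nu>
      using that by (intro equiv_val_refl) (simp add: mon_T_nonzero)
    have 1: "?l \<sim>\<^sub>V z ^ (k * i) * mon T \<gamma> * ?m"
      using equiv_val_sym[OF equiv_val_mult[OF zi[of i] refl[OF e(1) scale[OF k(3), of i']]]] by (simp only: mult_ac)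
    have 2: "z ^ (k * i) * mon T \<gamma> * ?m \<sim>\<^sub>V z ^ (k * i') * mon T \<gamma>' * ?m"
      by (rule equiv_val_mult[OF eq refl[OF scale[OF k(3)] scale[OF k(3)]]])
    have 3: "z ^ (k * i') * mon T \<gamma>' * ?m \<sim>\<^sub>V ?r"
      using equiv_val_mult[OF zi[of i'] refl[OF e(2) scale[OF k(3), of i]]] by (simp only: mult_ac)
    have nz: "z ^ (k * i) * mon T \<gamma> * ?m \<noteq> 0" "z ^ (k * i') * mon T \<gamma>' * ?m \<noteq> 0"
      using z(2) e scale[OF k(3)] by (simp_all add: mon_T_nonzero)
    have "?l \<sim>\<^sub>V ?r"
      using equiv_val_trans[OF equiv_val_trans[OF 1 2 nz(1)] 3 nz(2)] .
    then have "mon T (\<lambda>x. i * \<beta>' x + (\<gamma> x + i' * \<beta> x)) \<sim>\<^sub>V mon T (\<lambda>x. i' * \<beta>' x + (\<gamma>' x + i * \<beta> x))"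
      by (simp only: mon_add)
    then have exp: "(\<lambda>x. i * \<beta>' x + (\<gamma> x + i' * \<beta> x)) = (\<lambda>x. i' * \<beta>' x + (\<gamma>' x + i * \<beta> x))"
      by (intro mon_inj expo_add scale k(3,4) e)
    have "int i * int (\<beta>' t) + (int (\<gamma> t) + int i' * int (\<beta> t)) =
      int i' * int (\<beta>' t) + (int (\<gamma>' t) + int i * int (\<beta> t))"
      using fun_cong[OF exp, of t] by (simp flip: of_nat_mult of_nat_add)
    then have "(int i - int i') * (int (\<beta>' t) - int (\<beta> t)) = int (\<gamma>' t) - int (\<gamma> t)"
      by (simp add: algebra_simps)
    then have "\<bar>int i - int i'\<bar> * int \<delta> = \<bar>int (\<gamma>' t) - int (\<gamma> t)\<bar>"
      by (simp add: \<delta>_def flip: abs_mult)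
    also have "\<dots> < int \<delta>" using \<gamma>(2,4) by linarith
    finally have "\<bar>int i - int i'\<bar> < 1"
      by (metis abs_ge_zero mult.commute mult_le_cancel_left1 not_le of_nat_0_le_iff order_less_le_trans)
    then have "i = i'" by linarith
    then show ?thesis using exp by (auto simp: fun_eq_iff)
  qed
  have "inj_on (\<lambda>(i, \<gamma>). (k * i, \<gamma>)) ({..l} \<times> {\<gamma> \<in> exps T D. \<gamma> t < \<delta>})"
    using k(1) by (auto simp: inj_on_def)
  then have "card P = (l + 1) * (\<delta> * (D + 1) ^ (n - 1))"
    unfolding P_def using \<delta> D(2) card_exps_restricted[OF t, of \<delta> D]
    by (simp add: card_image card_cartesian_product)
  moreover have "card P \<le> C * (b + A\<^sub>1 * l * d + n * D * c) ^ n"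
  proof (rule b(2))
    show "P \<subseteq> {..A\<^sub>1 * l} \<times> exps T D"
      unfolding P_def using k(2) by (auto intro: mult_le_mono)
    show "\<forall>p\<in>P. \<forall>q\<in>P. z ^ fst p * mon T (snd p) \<sim>\<^sub>V z ^ fst q * mon T (snd q) \<longrightarrow> p = q"
      unfolding P_def using inj by auto
  qed
  moreover have "\<dots> \<le> C * ((1 + A\<^sub>1 + n * c) * D) ^ n"
    using D(1) by (intro mult_le_mono2 power_mono) (auto simp: D_def algebra_simps)
  moreover have "\<dots> = A\<^sub>2 * D ^ n" by (simp only: A\<^sub>2_def power_mult_distrib mult.assoc)
  moreover have "\<dots> = A\<^sub>2 * d * l * D ^ (n - 1)"
    using n by (cases n) (simp_all add: D_def mult_ac)
  moreover have "\<dots> \<le> A\<^sub>2 * d * l * (D + 1) ^ (n - 1)"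
    by (intro mult_le_mono2 power_mono) auto
  ultimately have "(l + 1) * \<delta> * (D + 1) ^ (n - 1) \<le> A\<^sub>2 * d * l * (D + 1) ^ (n - 1)"
    by (simp only: mult.assoc)
  then have "(l + 1) * \<delta> \<le> A\<^sub>2 * d * l" by (simp only: mult_le_cancel2) simp
  also have "\<dots> \<le> \<delta> * l" using \<delta> by (intro mult_le_mono1) simp
  finally show False using \<delta> by (simp add: mult.commute)
qed

text \<open>A value that occurs in \<open>saturated d\<close> is determined by k and the vector of
  differences \<beta>' - \<beta>, because the value group has no torsion. By \<open>torsion\<close>
  and \<open>exponent_bound\<close> there are at most
  \<open>A\<^sub>1 * (2 * A\<^sub>2 * d + 1) ^ n\<close> such pairs, and
  \<open>inequivalent_basis\<close> makes this a bound for the dimension.\<close>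

lemma saturated_dim_bound:
  assumes "d \<ge> 1"
  shows "dim_at_most (saturated d) (A\<^sub>1 * (2 * A\<^sub>2 + 1) ^ n * d ^ n)"
  unfolding dim_at_most_def
proof (intro allI impI, elim conjE)
  fix I assume I: "I \<subseteq> saturated d" "finite I" "\<not> lin.dependent I"
  obtain A where A: "A \<subseteq> lin.span I" "finite A" "card A = card I" "0 \<notin> A"
    "\<forall>x\<in>A. \<forall>y\<in>A. x \<noteq> y \<longrightarrow> \<not> x \<sim>\<^sub>V y" using inequivalent_basis[OF I(2,3)] by blast
  have "lin.span I \<subseteq> saturated d" using I(1) by (rule lin.span_minimal[OF _ saturated_subspace])
  then have sat: "a \<in> saturated d" "a \<noteq> 0" if "a \<in> A" for a using that A(1,4) by auto
  have "\<forall>a\<in>A. \<exists>k \<beta> \<beta>'. 1 \<le> k \<and> k \<le> A\<^sub>1 \<and> \<beta> \<in> expo T \<and> \<beta>' \<in> expo T \<and> a ^ k * mon T \<beta> \<sim>\<^sub>V mon T \<beta>'"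
    by (intro ballI torsion[OF sat assms])
  then obtain k \<beta> \<beta>' where k: "\<forall>a\<in>A. 1 \<le> k a \<and> k a \<le> A\<^sub>1 \<and> \<beta> a \<in> expo T \<and> \<beta>' a \<in> expo T \<and>
    a ^ k a * mon T (\<beta> a) \<sim>\<^sub>V mon T (\<beta>' a)"
    unfolding bchoice_iff by blast
  define g where "g a = (k a, \<lambda>t\<in>T. int (\<beta>' a t) - int (\<beta> a t))" for a
  define R where "R = {- int (A\<^sub>2 * d)..int (A\<^sub>2 * d)}"
  have "g ` A \<subseteq> {1..A\<^sub>1} \<times> (T \<rightarrow>\<^sub>E R)"
  proof
    fix p assume "p \<in> g ` A"
    then obtain a where a: "a \<in> A" "p = g a" by auto
    note ka = k[rule_format, OF a(1)]
    have "int (\<beta>' a t) - int (\<beta> a t) \<in> R" if "t \<in> T" for t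
    proof -
      have "\<bar>int (\<beta>' a t) - int (\<beta> a t)\<bar> \<le> int (A\<^sub>2 * d)"
        by (rule exponent_bound[OF sat[OF a(1)] assms _ _ _ _ _ that, of "k a"]) (use ka in auto)
      then show ?thesis unfolding R_def atLeastAtMost_iff by linarith
    qed
    then show "p \<in> {1..A\<^sub>1} \<times> (T \<rightarrow>\<^sub>E R)" using ka by (simp add: a(2) g_def)
  qed
  moreover have "inj_on g A"
  proof (rule inj_onI)
    fix x y assume x: "x \<in> A" and y: "y \<in> A" and eq: "g x = g y"
    note kx = k[rule_format, OF x] and ky = k[rule_format, OF y]
    have diff: "int (\<beta>' x t) - int (\<beta> x t) = int (\<beta>' y t) - int (\<beta> y t)" if "t \<in> T" for t
    proof -
      have "snd (g x) t = snd (g y) t" using eq by simp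
      then show ?thesis using that by (simp add: g_def)
    qed
    have "mon T (\<lambda>t. \<beta>' x t + \<beta> y t) = mon T (\<lambda>t. \<beta>' y t + \<beta> x t)"
    proof (rule mon_cong)
      fix t assume "t \<in> T"
      from diff[OF this] show "\<beta>' x t + \<beta> y t = \<beta>' y t + \<beta> x t" by linarith
    qed
    then have eq': "mon T (\<beta>' x) * mon T (\<beta> y) = mon T (\<beta>' y) * mon T (\<beta> x)" by (simp add: mon_add)
    have nz: "mon T (\<beta> x) \<noteq> 0" "mon T (\<beta> y) \<noteq> 0" "mon T (\<beta>' x) \<noteq> 0" "mon T (\<beta>' y) \<noteq> 0"
      by (rule mon_T_nonzero, use kx ky in blast)+
    have "x ^ k x * mon T (\<beta> x) * mon T (\<beta> y) \<sim>\<^sub>V mon T (\<beta>' x) * mon T (\<beta> y)"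
      "y ^ k y * mon T (\<beta> y) * mon T (\<beta> x) \<sim>\<^sub>V mon T (\<beta>' y) * mon T (\<beta> x)"
      using kx ky nz by (simp_all add: equiv_val_cancel)
    then have "x ^ k x * mon T (\<beta> x) * mon T (\<beta> y) \<sim>\<^sub>V y ^ k y * mon T (\<beta> y) * mon T (\<beta> x)"
      unfolding eq' using nz by (meson equiv_val_sym equiv_val_trans mult_eq_0_iff)
    then have "x ^ k x * (mon T (\<beta> x) * mon T (\<beta> y)) \<sim>\<^sub>V y ^ k y * (mon T (\<beta> x) * mon T (\<beta> y))"
      by (simp only: mult_ac)
    then have "x ^ k x \<sim>\<^sub>V y ^ k y" using nz by (simp add: equiv_val_cancel)
    moreover have "k x = k y" using eq by (simp add: g_def)
    moreover have "x \<noteq> 0" "y \<noteq> 0" "0 < k x" using x y A(4) kx by auto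
    ultimately have "x \<sim>\<^sub>V y" by (auto intro: equiv_val_root[of x "k x" y])
    then show "x = y" using A(5) x y by blast
  qed
  moreover have "finite ({1..A\<^sub>1} \<times> (T \<rightarrow>\<^sub>E R))" using finite_T by (auto simp: R_def intro!: finite_PiE)
  ultimately have "card A \<le> card ({1..A\<^sub>1} \<times> (T \<rightarrow>\<^sub>E R))" using card_inj_on_le by blast
  also have "\<dots> = A\<^sub>1 * (2 * (A\<^sub>2 * d) + 1) ^ n"
    using finite_T card_T by (simp add: card_cartesian_product card_PiE R_def nat_add_distrib nat_mult_distrib mult.commute)
  also have "\<dots> \<le> A\<^sub>1 * ((2 * A\<^sub>2 + 1) * d) ^ n"
    using assms by (intro mult_le_mono2 power_mono) (auto simp: algebra_simps)
  finally show "card I \<le> A\<^sub>1 * (2 * A\<^sub>2 + 1) ^ n * d ^ n"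
    using A(3) by (simp only: power_mult_distrib mult.assoc)
qed

end

lemma (in coordinates) saturated_dim:
  obtains C where "\<And>d. d \<ge> 1 \<Longrightarrow> dim_at_most (saturated d) (C * d ^ n)"
proof -
  show thesis
  proof (rule residue_valuation_of_basis[OF function_field_dim_eq])
    fix T V assume T: "finite T" "alg_indep T" "card T = n" and V: "residue_valuation \<iota> V"
      and inj: "\<And>\<gamma> \<delta>. \<gamma> \<in> expo T \<Longrightarrow> \<delta> \<in> expo T \<Longrightarrow> valuation_subring.equiv_val V (mon T \<gamma>) (mon T \<delta>) \<Longrightarrow> \<gamma> = \<delta>"
    obtain h c where h: "h \<noteq> 0" "1 \<le> c" "h \<in> homog S c" "\<And>t. t \<in> T \<Longrightarrow> h * t \<in> homog S c"
      using common_denominator[OF T(1)] by blast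
    obtain C where C: "\<And>m. m \<ge> 1 \<Longrightarrow> dim_at_most (homog S m) (C * m ^ n)" using growth_dim by blast
    interpret V: residue_valuation \<iota> V by (rule V)
    interpret monomial_valuation \<iota> S V T C c h
      by unfold_locales (use T inj C h in auto)
    show thesis by (rule that, rule saturated_dim_bound)
  qed
qed

section \<open>Abhyankar valuations\<close>

locale real_valued = ground_field \<iota> for \<iota> :: "'k::alg_closed_field \<Rightarrow> 'a::field" +
  fixes v :: "'a \<Rightarrow> real"
  assumes real_valuation: "real_valuation \<iota> v"
begin

lemma v_mult: "x \<noteq> 0 \<Longrightarrow> y \<noteq> 0 \<Longrightarrow> v (x * y) = v x + v y"
  and v_add: "x \<noteq> 0 \<Longrightarrow> y \<noteq> 0 \<Longrightarrow> x + y \<noteq> 0 \<Longrightarrow> min (v x) (v y) \<le> v (x + y)"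
  and v_const: "c \<noteq> 0 \<Longrightarrow> v (\<iota> c) = 0"
  using real_valuation unfolding real_valuation_def by blast+

lemma v_1 [simp]: "v 1 = 0"
  using v_mult[of 1 1] by simp

lemma v_uminus: "v (- x) = v x"
proof (cases "x = 0")
  case False
  have "v (- 1) = 0" using v_mult[of "- 1" "- 1"] by simp
  then show ?thesis using v_mult[of "- 1" x] False by simp
qed simp

lemma v_power: "x \<noteq> 0 \<Longrightarrow> v (x ^ i) = real i * v x"
  by (induction i) (auto simp: v_mult algebra_simps)

lemma v_prod: "finite A \<Longrightarrow> (\<And>i. i \<in> A \<Longrightarrow> f i \<noteq> 0) \<Longrightarrow> v (prod f A) = (\<Sum>i\<in>A. v (f i))"
  by (induction A rule: finite_induct) (auto simp: v_mult)

lemma v_mon: "finite T \<Longrightarrow> 0 \<notin> T \<Longrightarrow> v (mon T \<gamma>) = (\<Sum>t\<in>T. real (\<gamma> t) * v t)"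
proof -
  assume T: "finite T" "0 \<notin> T"
  then have "v (mon T \<gamma>) = (\<Sum>t\<in>T. v (t ^ \<gamma> t))" unfolding mon_def by (intro v_prod) auto
  also have "\<dots> = (\<Sum>t\<in>T. real (\<gamma> t) * v t)" using T(2) by (intro sum.cong refl v_power) auto
  finally show ?thesis .
qed

text \<open>The value of 0 is unspecified, so a vanishing sum has to be kept as a separate
  alternative, here and in later estimates.\<close>

lemma v_sum_ge: "(\<And>i. i \<in> A \<Longrightarrow> f i = 0 \<or> r \<le> v (f i)) \<Longrightarrow> sum f A = 0 \<or> r \<le> v (sum f A)"
proof (induction A rule: infinite_finite_induct)
  case (insert i A)
  then show ?case using v_add[of "f i" "sum f A"] by fastforce
qed auto

lemma v_sum_gr: "(\<And>i. i \<in> A \<Longrightarrow> f i = 0 \<or> r < v (f i)) \<Longrightarrow> sum f A = 0 \<or> r < v (sum f A)"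
proof (induction A rule: infinite_finite_induct)
  case (insert i A)
  then show ?case using v_add[of "f i" "sum f A"] by fastforce
qed auto

lemma v_add_eq: "x \<noteq> 0 \<Longrightarrow> y = 0 \<or> v x < v y \<Longrightarrow> x + y \<noteq> 0 \<and> v (x + y) = v x"
proof -
  assume x: "x \<noteq> 0" and y: "y = 0 \<or> v x < v y"
  show ?thesis
  proof (cases "y = 0")
    case False
    then have less: "v x < v y" using y by simp
    have ne: "x + y \<noteq> 0" using less v_uminus[of y] by (auto simp: add_eq_0_iff2)
    moreover have "v x \<le> v (x + y)" using v_add[OF x False ne] less by simp
    moreover have "min (v (x + y)) (v (- y)) \<le> v x"
      using v_add[OF ne, of "- y"] False x by simp
    ultimately show ?thesis using less v_uminus[of y] by (simp add: min_def split: if_splits)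
  qed (use x in simp)
qed

section \<open>Valuation ring and residue field of \<open>v\<close>\<close>

lemma valuation_ring_closed:
  "x \<in> valuation_ring v \<Longrightarrow> y \<in> valuation_ring v \<Longrightarrow> x + y \<in> valuation_ring v"
  "x \<in> valuation_ring v \<Longrightarrow> y \<in> valuation_ring v \<Longrightarrow> x * y \<in> valuation_ring v"
  "x \<in> valuation_ring v \<Longrightarrow> - x \<in> valuation_ring v" "1 \<in> valuation_ring v" "\<iota> c \<in> valuation_ring v"
proof -
  assume x: "x \<in> valuation_ring v"
  show "- x \<in> valuation_ring v" using x by (auto simp: valuation_ring_def v_uminus)
  assume y: "y \<in> valuation_ring v"
  show "x + y \<in> valuation_ring v" "x * y \<in> valuation_ring v"
    using x y v_mult[of x y] v_add[of x y] by (force simp: valuation_ring_def)+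
next
  show "1 \<in> valuation_ring v" "\<iota> c \<in> valuation_ring v"
    using v_const[of c] by (cases "c = 0"; simp add: valuation_ring_def)+
qed

lemma valuation_ring_sum: "(\<And>i. i \<in> A \<Longrightarrow> f i \<in> valuation_ring v) \<Longrightarrow> sum f A \<in> valuation_ring v"
proof -
  have "0 \<in> valuation_ring v" by (simp add: valuation_ring_def)
  then show "(\<And>i. i \<in> A \<Longrightarrow> f i \<in> valuation_ring v) \<Longrightarrow> sum f A \<in> valuation_ring v"
    by (induction A rule: infinite_finite_induct) (auto intro: valuation_ring_closed)
qed

lemma valuation_ring_power: "x \<in> valuation_ring v \<Longrightarrow> x ^ i \<in> valuation_ring v"
  by (induction i) (auto intro: valuation_ring_closed)

lemma valuation_ring_prod: "(\<And>i. i \<in> A \<Longrightarrow> f i \<in> valuation_ring v) \<Longrightarrow> prod f A \<in> valuation_ring v"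
  by (induction A rule: infinite_finite_induct) (auto intro: valuation_ring_closed)

lemma cring_valuation_ring: "cring (ring_on (valuation_ring v))"
proof -
  interpret R: cring "ring_of_type_algebra :: 'a ring" by (rule cring_from_type_algebra)
  have inv: "\<ominus>\<^bsub>ring_of_type_algebra\<^esub> x = - x" for x :: 'a
    using R.minus_equality[of "- x" x] by simp
  have "subring (valuation_ring v) ring_of_type_algebra"
    by (rule R.subringI) (auto simp: inv intro: valuation_ring_closed)
  then show ?thesis using R.subcringI'[of "valuation_ring v"] R.subcring_iff[of "valuation_ring v"] by simp
qed

lemma ideal_valuation_ideal: "ideal (valuation_ideal v) (ring_on (valuation_ring v))"
proof -
  interpret R: cring "ring_on (valuation_ring v)" by (rule cring_valuation_ring)
  have sub: "valuation_ideal v \<subseteq> valuation_ring v" by (auto simp: valuation_ideal_def valuation_ring_def)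
  have neg: "\<ominus>\<^bsub>ring_on (valuation_ring v)\<^esub> x = - x" if "x \<in> valuation_ring v" for x
    using that valuation_ring_closed(3)[OF that] R.minus_equality[of "- x" x] by simp
  have mult: "x * a \<in> valuation_ideal v" if "a \<in> valuation_ideal v" "x \<in> valuation_ring v" for a x
    using that v_mult[of x a] by (cases "x = 0"; cases "a = 0") (auto simp: valuation_ideal_def valuation_ring_def)
  have add: "a + b \<in> valuation_ideal v" if "a \<in> valuation_ideal v" "b \<in> valuation_ideal v" for a b
    using that v_add[of a b] by (force simp: valuation_ideal_def)
  show ?thesis
  proof (rule idealI)
    show "ring (ring_on (valuation_ring v))" by (rule R.ring_axioms)
    show "subgroup (valuation_ideal v) (add_monoid (ring_on (valuation_ring v)))"
    proof (rule R.add.subgroupI)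
      show "valuation_ideal v \<noteq> {}" by (auto simp: valuation_ideal_def)
      show "\<ominus>\<^bsub>ring_on (valuation_ring v)\<^esub> a \<in> valuation_ideal v" if "a \<in> valuation_ideal v" for a
        using neg[of a] sub that by (auto simp: valuation_ideal_def v_uminus)
    qed (use sub add in auto)
  qed (use mult in \<open>auto simp: mult.commute\<close>)
qed

lemma cring_residue_field: "cring (residue_field v)"
  unfolding residue_field_def by (rule ideal.quotient_is_cring[OF ideal_valuation_ideal cring_valuation_ring])

lemma residue_class_hom:
  "x \<in> valuation_ring v \<Longrightarrow> residue_class v x \<in> carrier (residue_field v)"
  "x \<in> valuation_ring v \<Longrightarrow> y \<in> valuation_ring v \<Longrightarrow>
    residue_class v (x * y) = residue_class v x \<otimes>\<^bsub>residue_field v\<^esub> residue_class v y"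
  "x \<in> valuation_ring v \<Longrightarrow> y \<in> valuation_ring v \<Longrightarrow>
    residue_class v (x + y) = residue_class v x \<oplus>\<^bsub>residue_field v\<^esub> residue_class v y"
  "residue_class v 1 = \<one>\<^bsub>residue_field v\<^esub>"
  using ideal.rcos_ring_hom[OF ideal_valuation_ideal]
  unfolding residue_class_def residue_field_def ring_hom_def by (auto simp: Pi_iff)

lemma residue_class_eq_zero: "x \<in> valuation_ideal v \<Longrightarrow> residue_class v x = \<zero>\<^bsub>residue_field v\<^esub>"
proof -
  assume x: "x \<in> valuation_ideal v"
  interpret R: cring "ring_on (valuation_ring v)" by (rule cring_valuation_ring)
  have "abelian_subgroup (valuation_ideal v) (ring_on (valuation_ring v))"
    by (rule abelian_subgroupI3[OF ideal.axioms(1)[OF ideal_valuation_ideal] R.is_abelian_group])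
  from abelian_subgroup.a_rcos_const[OF this x] show ?thesis
    by (simp add: residue_class_def residue_field_def FactRing_def)
qed

lemma residue_class_surj: "carrier (residue_field v) \<subseteq> residue_class v ` valuation_ring v"
  unfolding residue_field_def residue_class_def FactRing_def A_RCOSETS_def' by auto

lemma residue_class_prod:
  assumes "finite A" "\<And>i. i \<in> A \<Longrightarrow> f i \<in> valuation_ring v"
  shows "finprod (residue_field v) (\<lambda>i. residue_class v (f i)) A = residue_class v (prod f A)"
proof -
  interpret Q: cring "residue_field v" by (rule cring_residue_field)
  show ?thesis
    using assms
  proof (induction A rule: finite_induct)
    case (insert i A)
    then show ?case
      by (subst Q.finprod_insert) (auto simp: residue_class_hom valuation_ring_prod)
  qed (simp add: residue_class_hom)
qed

lemma residue_class_sum: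
  assumes "finite A" "\<And>i. i \<in> A \<Longrightarrow> f i \<in> valuation_ring v"
  shows "finsum (residue_field v) (\<lambda>i. residue_class v (f i)) A = residue_class v (sum f A)"
proof -
  interpret Q: cring "residue_field v" by (rule cring_residue_field)
  show ?thesis
    using assms
  proof (induction A rule: finite_induct)
    case empty
    then show ?case using residue_class_eq_zero[of 0] by (simp add: valuation_ideal_def)
  next
    case (insert i A)
    then show ?case
      by (subst Q.finsum_insert) (auto simp: residue_class_hom valuation_ring_sum)
  qed
qed

lemma residue_class_power:
  assumes "x \<in> valuation_ring v"
  shows "residue_class v x [^]\<^bsub>residue_field v\<^esub> (i::nat) = residue_class v (x ^ i)"
proof -
  interpret Q: cring "residue_field v" by (rule cring_residue_field)
  show ?thesis
    using assms by (induction i) (simp_all add: residue_class_hom valuation_ring_power power_Suc2 del: power_Suc)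
qed

text \<open>The residue of the sum is the value of a nonzero polynomial at algebraically independent
  residues. The work lies in the indexing: the variables of that polynomial are named by residues,
  while \<open>exps G D\<close> uses elements of G. Injectivity of \<open>residue_class v\<close> on
  G lets \<tau> translate.\<close>

lemma residue_independent:
  assumes G: "finite G" "G \<subseteq> valuation_ring v" "inj_on (residue_class v) G"
    and ai: "algebraically_independent (residue_field v) (\<lambda>c. residue_class v (\<iota> c)) (residue_class v ` G)"
    and c: "\<gamma>\<^sub>0 \<in> exps G D" "c \<gamma>\<^sub>0 \<noteq> 0"
  shows "(\<Sum>\<gamma>\<in>exps G D. \<iota> (c \<gamma>) * mon G \<gamma>) \<notin> valuation_ideal v"
proof
  assume z: "(\<Sum>\<gamma>\<in>exps G D. \<iota> (c \<gamma>) * mon G \<gamma>) \<in> valuation_ideal v"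
  let ?\<phi> = "residue_class v"
  define A where "A = {\<alpha>. Poly_Mapping.keys \<alpha> \<subseteq> ?\<phi> ` G \<and> (\<forall>t\<in>?\<phi> ` G. Poly_Mapping.lookup \<alpha> t \<le> D)}"
  define \<tau> where "\<tau> \<alpha> = (\<lambda>g. if g \<in> G then Poly_Mapping.lookup \<alpha> (?\<phi> g) else 0)" for \<alpha> :: "'a set \<Rightarrow>\<^sub>0 nat"
  have bij: "bij_betw \<tau> A (exps G D)"
  proof (rule bij_betw_imageI)
    show "inj_on \<tau> A"
    proof (rule inj_onI)
      fix \<alpha> \<beta> assume ab: "\<alpha> \<in> A" "\<beta> \<in> A" "\<tau> \<alpha> = \<tau> \<beta>"
      show "\<alpha> = \<beta>"
      proof (rule poly_mapping_eqI)
        fix t show "Poly_Mapping.lookup \<alpha> t = Poly_Mapping.lookup \<beta> t"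
        proof (cases "t \<in> ?\<phi> ` G")
          case True
          then obtain g where "g \<in> G" "t = ?\<phi> g" by blast
          then show ?thesis using fun_cong[OF ab(3), of g] by (simp add: \<tau>_def)
        next
          case False
          then have "t \<notin> Poly_Mapping.keys \<alpha>" "t \<notin> Poly_Mapping.keys \<beta>" using ab by (auto simp: A_def)
          then show ?thesis by (simp add: in_keys_iff)
        qed
      qed
    qed
    show "\<tau> ` A = exps G D"
    proof (intro equalityI subsetI)
      fix \<gamma> assume "\<gamma> \<in> \<tau> ` A"
      then show "\<gamma> \<in> exps G D" by (auto simp: A_def \<tau>_def exps_def)
    next
      fix \<gamma> assume \<gamma>: "\<gamma> \<in> exps G D"
      define f where "f t = (if t \<in> ?\<phi> ` G then \<gamma> (inv_into G ?\<phi> t) else 0)" for t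
      have "finite {t. f t \<noteq> 0}"
        by (rule finite_subset[of _ "?\<phi> ` G"]) (use G(1) in \<open>auto simp: f_def\<close>)
      then have l: "Poly_Mapping.lookup (Abs_poly_mapping f) = f" by (rule lookup_Abs_poly_mapping)
      have "\<tau> (Abs_poly_mapping f) = \<gamma>"
        using \<gamma> G(3) by (auto simp: \<tau>_def l f_def fun_eq_iff exps_def inv_into_f_f)
      moreover have "Abs_poly_mapping f \<in> A"
        using \<gamma> G(3) unfolding A_def by (auto simp: in_keys_iff l f_def exps_def inv_into_f_f split: if_splits)
      ultimately show "\<gamma> \<in> \<tau> ` A" by (metis image_eqI)
    qed
  qed
  have finA: "finite A" using bij_betw_finite[OF bij] G(1) by simp
  define f where "f \<alpha> = (if \<alpha> \<in> A then c (\<tau> \<alpha>) else 0)" for \<alpha>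
  define P where "P = Abs_poly_mapping f"
  have "finite {\<alpha>. f \<alpha> \<noteq> 0}" by (rule finite_subset[OF _ finA]) (auto simp: f_def)
  then have P: "Poly_Mapping.lookup P = f" unfolding P_def by (rule lookup_Abs_poly_mapping)
  have keysP: "Poly_Mapping.keys P \<subseteq> A" by (auto simp: in_keys_iff P f_def split: if_splits)
  interpret Q: cring "residue_field v" by (rule cring_residue_field)
  have mon_val: "mon G \<gamma> \<in> valuation_ring v" for \<gamma>
    unfolding mon_def using G(2) by (intro valuation_ring_prod valuation_ring_power) auto
  have prod: "finprod (residue_field v) (\<lambda>t. t [^]\<^bsub>residue_field v\<^esub> Poly_Mapping.lookup \<alpha> t) (Poly_Mapping.keys \<alpha>)
      = ?\<phi> (mon G (\<tau> \<alpha>))" if "\<alpha> \<in> A" for \<alpha>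
  proof -
    define H where "H = {g \<in> G. ?\<phi> g \<in> Poly_Mapping.keys \<alpha>}"
    have H: "finite H" "inj_on ?\<phi> H" "H \<subseteq> G" using G by (auto simp: H_def intro: inj_on_subset)
    have keys: "Poly_Mapping.keys \<alpha> = ?\<phi> ` H" using that by (auto simp: A_def H_def)
    have HV: "g \<in> valuation_ring v" if "g \<in> H" for g using that H(3) G(2) by blast
    have "finprod (residue_field v) (\<lambda>t. t [^]\<^bsub>residue_field v\<^esub> Poly_Mapping.lookup \<alpha> t) (Poly_Mapping.keys \<alpha>)
      = finprod (residue_field v) (\<lambda>g. ?\<phi> g [^]\<^bsub>residue_field v\<^esub> Poly_Mapping.lookup \<alpha> (?\<phi> g)) H"
      unfolding keys using HV
      by (intro Q.finprod_reindex H(2)) (auto intro!: Q.nat_pow_closed residue_class_hom)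
    also have "\<dots> = finprod (residue_field v) (\<lambda>g. ?\<phi> (g ^ Poly_Mapping.lookup \<alpha> (?\<phi> g))) H"
      using HV by (intro Q.finprod_cong') (auto simp: residue_class_power intro!: residue_class_hom valuation_ring_power)
    also have "\<dots> = ?\<phi> (\<Prod>g\<in>H. g ^ Poly_Mapping.lookup \<alpha> (?\<phi> g))"
      using HV H(1) by (intro residue_class_prod) (auto intro: valuation_ring_power)
    also have "(\<Prod>g\<in>H. g ^ Poly_Mapping.lookup \<alpha> (?\<phi> g)) = mon G (\<tau> \<alpha>)"
      unfolding mon_def \<tau>_def using G(1) by (intro prod.mono_neutral_cong_left) (auto simp: H_def in_keys_iff)
    finally show ?thesis .
  qed
  have "poly_value (residue_field v) (\<lambda>c. ?\<phi> (\<iota> c)) P =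
    finsum (residue_field v) (\<lambda>\<alpha>. ?\<phi> (\<iota> (f \<alpha>) * mon G (\<tau> \<alpha>))) (Poly_Mapping.keys P)"
    unfolding poly_value_def P using keysP
    by (intro Q.finsum_cong')
       (auto simp: prod subset_iff residue_class_hom valuation_ring_closed mon_val
         intro!: residue_class_hom valuation_ring_closed mon_val)
  also have "\<dots> = ?\<phi> (\<Sum>\<alpha>\<in>Poly_Mapping.keys P. \<iota> (f \<alpha>) * mon G (\<tau> \<alpha>))"
    by (intro residue_class_sum valuation_ring_closed mon_val) auto
  also have "(\<Sum>\<alpha>\<in>Poly_Mapping.keys P. \<iota> (f \<alpha>) * mon G (\<tau> \<alpha>)) = (\<Sum>\<alpha>\<in>A. \<iota> (c (\<tau> \<alpha>)) * mon G (\<tau> \<alpha>))"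
    using keysP finA by (intro sum.mono_neutral_cong_left) (auto simp: in_keys_iff P f_def)
  also have "\<dots> = (\<Sum>\<gamma>\<in>exps G D. \<iota> (c \<gamma>) * mon G \<gamma>)"
    by (rule sum.reindex_bij_betw[OF bij])
  finally have "poly_value (residue_field v) (\<lambda>c. ?\<phi> (\<iota> c)) P = \<zero>\<^bsub>residue_field v\<^esub>"
    using residue_class_eq_zero[OF z] by simp
  moreover have "\<forall>\<alpha>\<in>Poly_Mapping.keys P. Poly_Mapping.keys \<alpha> \<subseteq> ?\<phi> ` G" using keysP by (auto simp: A_def)
  moreover have "P \<noteq> 0"
  proof
    assume "P = 0"
    then have "f \<alpha> = 0" for \<alpha> using P by (metis lookup_zero)
    moreover obtain \<alpha> where "\<alpha> \<in> A" "\<tau> \<alpha> = \<gamma>\<^sub>0"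
      using c(1) bij_betw_imp_surj_on[OF bij] by (metis imageE)
    ultimately show False using c(2) by (metis f_def)
  qed
  ultimately show False using ai unfolding algebraically_independent_def by blast
qed

end

text \<open>F supplies the rational rank and G the residual transcendence degree.
  \<open>values_F\<close> is linear independence of values over the rationals, with natural
  coefficients on both sides because it is applied to pairs of exponents. \<open>residue_G\<close>
  says that nonzero polynomials in G have nonzero residue.\<close>

locale adapted_basis = real_valued \<iota> v
  for \<iota> :: "'k::alg_closed_field \<Rightarrow> 'a::field" and v :: "'a \<Rightarrow> real" +
  fixes F G :: "'a set"
  assumes finite_F: "finite F" and zero_F: "0 \<notin> F"
    and values_F: "(\<Sum>f\<in>F. real (a f) * v f) = (\<Sum>f\<in>F. real (b f) * v f) \<Longrightarrow> f \<in> F \<Longrightarrow> a f = b f"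
    and finite_G: "finite G" and ring_G: "G \<subseteq> valuation_ring v"
    and residue_G: "\<gamma> \<in> exps G D \<Longrightarrow> c \<gamma> \<noteq> 0 \<Longrightarrow> (\<Sum>\<gamma>\<in>exps G D. \<iota> (c \<gamma>) * mon G \<gamma>) \<notin> valuation_ideal v"
begin

definition K :: real where
  "K = (\<Sum>f\<in>F. \<bar>v f\<bar>)"

text \<open>\<open>residue_G\<close> is applied to the polynomial that consists of the single
  variable g.\<close>

lemma value_G: "g \<in> G \<Longrightarrow> g \<noteq> 0 \<and> v g = 0"
proof -
  assume g: "g \<in> G"
  define e where "e = (\<lambda>x. if x = g then 1 else 0 :: nat)"
  have e: "e \<in> exps G 1" using g by (auto simp: e_def exps_def)
  have "(\<Sum>\<gamma>\<in>exps G 1. \<iota> (if \<gamma> = e then 1 else 0) * mon G \<gamma>) = (\<Sum>\<gamma>\<in>{e}. \<iota> (if \<gamma> = e then 1 else 0) * mon G \<gamma>)"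
    using e finite_G by (intro sum.mono_neutral_right) auto
  also have "\<dots> = g" using mon_single[OF finite_G g, of 1] by (simp add: e_def)
  finally have "g \<notin> valuation_ideal v"
    using residue_G[OF e, of "\<lambda>\<gamma>. if \<gamma> = e then 1 else 0"] by simp
  then show ?thesis using ring_G g by (force simp: valuation_ideal_def valuation_ring_def)
qed

lemma value_F: "f \<in> F \<Longrightarrow> v f \<noteq> 0"
proof
  assume f: "f \<in> F" and 0: "v f = 0"
  have "(\<Sum>x\<in>F. real (if x = f then 1 else 0) * v x) = (\<Sum>x\<in>F. real 0 * v x)"
    using 0 by (intro sum.cong) auto
  from values_F[OF this f] show False by simp
qed

lemma disjoint: "F \<inter> G = {}"
  using value_F value_G by blast

lemma zero_FG: "0 \<notin> F \<union> G"
  using zero_F value_G by blast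

lemma v_mon_F: "v (mon F \<alpha>) = (\<Sum>f\<in>F. real (\<alpha> f) * v f)" and mon_F_nonzero: "mon F \<alpha> \<noteq> 0"
  using v_mon[OF finite_F zero_F] zero_F finite_F by (auto simp: mon_def)

lemma values_F_bound:
  assumes "\<gamma> \<in> exps (F \<union> G) D \<or> \<gamma> \<in> exps F D"
  shows "\<bar>\<Sum>f\<in>F. real (\<gamma> f) * v f\<bar> \<le> real D * K"
proof -
  have "\<bar>\<Sum>f\<in>F. real (\<gamma> f) * v f\<bar> \<le> (\<Sum>f\<in>F. \<bar>real (\<gamma> f) * v f\<bar>)" by (rule sum_abs)
  also have "\<dots> \<le> (\<Sum>f\<in>F. real D * \<bar>v f\<bar>)"
    using assms by (intro sum_mono) (auto simp: abs_mult exps_def intro!: mult_right_mono)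
  finally show ?thesis by (simp add: K_def sum_distrib_left)
qed

lemma sum_exps_Un:
  fixes f :: "('a \<Rightarrow> nat) \<Rightarrow> 'a"
  shows "(\<Sum>\<gamma>\<in>exps (F \<union> G) D. f \<gamma>) = (\<Sum>\<alpha>\<in>exps F D. \<Sum>\<beta>\<in>exps G D. f (\<lambda>x. \<alpha> x + \<beta> x))"
proof -
  have "bij_betw (\<lambda>(\<alpha>, \<beta>). (\<lambda>x. \<alpha> x + \<beta> x :: nat)) (exps F D \<times> exps G D) (exps (F \<union> G) D)"
    using disjoint
    by (intro bij_betw_byWitness[where f' = "\<lambda>\<gamma>. (\<lambda>x. if x \<in> F then \<gamma> x else 0, \<lambda>x. if x \<in> G then \<gamma> x else 0)"])
       (auto simp: exps_def fun_eq_iff)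
  from sum.reindex_bij_betw[OF this, of f] show ?thesis
    by (simp add: sum.cartesian_product case_prod_unfold)
qed

lemma mon_Un:
  assumes "\<alpha> \<in> exps F D" "\<beta> \<in> exps G D"
  shows "mon (F \<union> G) (\<lambda>x. \<alpha> x + \<beta> x) = mon F \<alpha> * mon G \<beta>"
proof -
  have "mon (F \<union> G) (\<lambda>x. \<alpha> x + \<beta> x) = mon F (\<lambda>x. \<alpha> x + \<beta> x) * mon G (\<lambda>x. \<alpha> x + \<beta> x)"
    unfolding mon_def using finite_F finite_G disjoint by (rule prod.union_disjoint)
  also have "mon F (\<lambda>x. \<alpha> x + \<beta> x) = mon F \<alpha>" using assms disjoint by (intro mon_cong) (auto simp: exps_def)
  also have "mon G (\<lambda>x. \<alpha> x + \<beta> x) = mon G \<beta>" using assms disjoint by (intro mon_cong) (auto simp: exps_def)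
  finally show ?thesis .
qed

text \<open>Sorted by monomials in F, the coefficients are polynomials in G, of value 0 unless they
  vanish, while the monomials in F have pairwise distinct values. So nothing cancels, and the value
  of p is the least value of a monomial in F that occurs. In particular, the union of F and G is
  algebraically independent.\<close>

lemma value_polynomial:
  assumes "\<gamma>\<^sub>0 \<in> exps (F \<union> G) D" "c \<gamma>\<^sub>0 \<noteq> 0"
  defines "p \<equiv> (\<Sum>\<gamma>\<in>exps (F \<union> G) D. \<iota> (c \<gamma>) * mon (F \<union> G) \<gamma>)"
  shows "p \<noteq> 0 \<and> v p \<le> real D * K"
proof -
  define P where "P \<alpha> = (\<Sum>\<beta>\<in>exps G D. \<iota> (c (\<lambda>x. \<alpha> x + \<beta> x)) * mon G \<beta>)" for \<alpha>
  have p: "p = (\<Sum>\<alpha>\<in>exps F D. mon F \<alpha> * P \<alpha>)"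
    unfolding p_def sum_exps_Un P_def sum_distrib_left
    by (intro sum.cong refl) (simp add: mon_Un mult_ac)
  have "mon G \<beta> \<in> valuation_ring v" for \<beta>
    unfolding mon_def using ring_G by (intro valuation_ring_prod valuation_ring_power) auto
  then have ring_P: "P \<alpha> \<in> valuation_ring v" for \<alpha>
    unfolding P_def by (intro valuation_ring_sum valuation_ring_closed)
  have P: "P \<alpha> \<noteq> 0 \<and> v (P \<alpha>) = 0" if "\<beta> \<in> exps G D" "c (\<lambda>x. \<alpha> x + \<beta> x) \<noteq> 0" for \<alpha> \<beta>
    using residue_G[where c = "\<lambda>\<beta>. c (\<lambda>x. \<alpha> x + \<beta> x)", OF that] ring_P[of \<alpha>]
    by (fold P_def) (auto simp: valuation_ideal_def valuation_ring_def)
  have P0: "P \<alpha> = 0 \<or> v (P \<alpha>) = 0" for \<alpha>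
  proof (cases "\<exists>\<beta>\<in>exps G D. c (\<lambda>x. \<alpha> x + \<beta> x) \<noteq> 0")
    case True
    then show ?thesis using P by blast
  next
    case False
    then show ?thesis by (auto simp: P_def intro: sum.neutral)
  qed
  define A where "A = {\<alpha> \<in> exps F D. P \<alpha> \<noteq> 0}"
  have finA: "finite A" unfolding A_def using finite_F by simp
  define w where "w \<alpha> = v (mon F \<alpha> * P \<alpha>)" for \<alpha>
  have w: "w \<alpha> = (\<Sum>f\<in>F. real (\<alpha> f) * v f)" if "\<alpha> \<in> A" for \<alpha>
    using that P0[of \<alpha>] by (simp add: w_def A_def v_mult mon_F_nonzero v_mon_F)
  have "A \<noteq> {}"
  proof -
    define \<alpha> \<beta> where "\<alpha> = (\<lambda>x. if x \<in> F then \<gamma>\<^sub>0 x else 0)" and "\<beta> = (\<lambda>x. if x \<in> G then \<gamma>\<^sub>0 x else 0)"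
    have "\<alpha> \<in> exps F D" "\<beta> \<in> exps G D" "(\<lambda>x. \<alpha> x + \<beta> x) = \<gamma>\<^sub>0"
      using assms(1) disjoint by (auto simp: \<alpha>_def \<beta>_def exps_def fun_eq_iff)
    then show ?thesis using P[of \<beta> \<alpha>] assms(2) unfolding A_def by auto
  qed
  then obtain \<alpha>\<^sub>0 where \<alpha>\<^sub>0: "\<alpha>\<^sub>0 \<in> A" "\<forall>\<alpha>\<in>A. w \<alpha>\<^sub>0 \<le> w \<alpha>"
    using arg_min_if_finite(1)[OF finA, of w] arg_min_least[OF finA, of _ w] by blast
  have "w \<alpha>\<^sub>0 < w \<alpha>" if \<alpha>: "\<alpha> \<in> A - {\<alpha>\<^sub>0}" for \<alpha>
  proof (rule ccontr)
    assume "\<not> w \<alpha>\<^sub>0 < w \<alpha>"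
    then have "w \<alpha> = w \<alpha>\<^sub>0" using \<alpha> \<alpha>\<^sub>0(2) by force
    then have "\<alpha> f = \<alpha>\<^sub>0 f" if "f \<in> F" for f
      using values_F[of \<alpha> \<alpha>\<^sub>0 f] w[of \<alpha>] w[OF \<alpha>\<^sub>0(1)] \<alpha> that by simp
    then have "\<alpha> x = \<alpha>\<^sub>0 x" for x using \<alpha> \<alpha>\<^sub>0(1) by (cases "x \<in> F") (auto simp: A_def exps_def)
    then have "\<alpha> = \<alpha>\<^sub>0" by (rule ext)
    then show False using \<alpha> by simp
  qed
  then have rest: "(\<Sum>\<alpha>\<in>A - {\<alpha>\<^sub>0}. mon F \<alpha> * P \<alpha>) = 0 \<or> w \<alpha>\<^sub>0 < v (\<Sum>\<alpha>\<in>A - {\<alpha>\<^sub>0}. mon F \<alpha> * P \<alpha>)"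
    by (intro v_sum_gr) (auto simp: w_def)
  have "p = (\<Sum>\<alpha>\<in>A. mon F \<alpha> * P \<alpha>)"
    unfolding p A_def using finite_F by (intro sum.mono_neutral_right) auto
  also have "\<dots> = mon F \<alpha>\<^sub>0 * P \<alpha>\<^sub>0 + (\<Sum>\<alpha>\<in>A - {\<alpha>\<^sub>0}. mon F \<alpha> * P \<alpha>)"
    by (rule sum.remove[OF finA \<alpha>\<^sub>0(1)])
  finally have "p \<noteq> 0 \<and> v p = w \<alpha>\<^sub>0"
    using v_add_eq[of "mon F \<alpha>\<^sub>0 * P \<alpha>\<^sub>0", OF _ rest[unfolded w_def]] \<alpha>\<^sub>0(1)
    by (simp add: w_def A_def mon_F_nonzero)
  moreover have "w \<alpha>\<^sub>0 \<le> real D * K"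
    using values_F_bound[of \<alpha>\<^sub>0 D] w[OF \<alpha>\<^sub>0(1)] \<alpha>\<^sub>0(1) by (simp add: A_def abs_le_iff)
  ultimately show ?thesis by simp
qed

lemma value_box:
  assumes "p \<in> box (F \<union> G) D"
  shows "p = 0 \<or> - (real D * K) \<le> v p"
proof -
  have fin: "finite (F \<union> G)" using finite_F finite_G by simp
  obtain c where p: "p = (\<Sum>\<gamma>\<in>exps (F \<union> G) D. \<iota> (c \<gamma>) * mon (F \<union> G) \<gamma>)" using box_eq[OF fin assms] by blast
  show ?thesis
    unfolding p
  proof (rule v_sum_ge)
    fix \<gamma> assume \<gamma>: "\<gamma> \<in> exps (F \<union> G) D"
    have "mon (F \<union> G) \<gamma> \<noteq> 0" using fin zero_FG by (auto simp: mon_def)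
    moreover have "v (mon (F \<union> G) \<gamma>) = (\<Sum>t\<in>F \<union> G. real (\<gamma> t) * v t)" by (rule v_mon[OF fin zero_FG])
    moreover have "\<dots> = (\<Sum>t\<in>F. real (\<gamma> t) * v t)"
      using fin value_G by (intro sum.mono_neutral_right) auto
    moreover have "\<bar>\<Sum>t\<in>F. real (\<gamma> t) * v t\<bar> \<le> real D * K" using \<gamma> by (intro values_F_bound) simp
    ultimately show "\<iota> (c \<gamma>) * mon (F \<union> G) \<gamma> = 0 \<or> - (real D * K) \<le> v (\<iota> (c \<gamma>) * mon (F \<union> G) \<gamma>)"
      by (cases "c \<gamma> = 0") (auto simp: v_mult v_const)
  qed
qed

end

text \<open>A nontrivial relation \<open>\<Sum> p\<^sub>i z\<^sup>i = 0\<close> with coefficients \<open>p\<^sub>i\<close> of degree \<open>O(d)\<close> exists for dimension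
  reasons; comparing its lowest coefficient with the others bounds the value of \<open>z\<close>.\<close>

lemma (in coordinates) saturated_value_bound:
  assumes "adapted_basis \<iota> v F G" and card: "card (F \<union> G) = n"
  shows "\<exists>B. \<forall>d\<ge>1. \<forall>z\<in>saturated d. z \<noteq> 0 \<longrightarrow> v z \<le> B * real d"
proof -
  interpret adapted_basis \<iota> v F G by fact
  let ?T = "F \<union> G"
  have fin: "finite ?T" using finite_F finite_G by simp
  obtain C where C: "\<And>d. d \<ge> 1 \<Longrightarrow> dim_at_most (saturated d) (C * d ^ n)" using saturated_dim by blast
  obtain h c where h: "h \<noteq> 0" "1 \<le> c" "h \<in> homog S c" "\<And>t. t \<in> ?T \<Longrightarrow> h * t \<in> homog S c"
    using common_denominator[OF fin] by blast
  \<comment> \<open>Makes the \<open>(e + 1) * (D + 1) ^ n\<close> products outnumber the dimension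
    \<open>C * ((1 + n * c) * D) ^ n\<close>, whatever d and z are.\<close>
  define e where "e = C * (1 + n * c) ^ n + 1"
  have K0: "K \<ge> 0" by (simp add: K_def sum_nonneg)
  have "v z \<le> 2 * real e * K * real d" if d: "d \<ge> 1" and z: "z \<in> saturated d" "z \<noteq> 0" for d z
  proof (rule ccontr)
    assume neg: "\<not> ?thesis"
    have "0 \<le> 2 * real e * K * real d" using K0 by simp
    with neg have vz: "v z > 0" by linarith
    \<comment> \<open>The degree of \<open>z ^ e\<close>; lower powers of z are padded by the
      section 1 to reach the same degree.\<close>
    define D where "D = e * d"
    have D: "D \<ge> 1" using d by (simp add: D_def e_def)
    define N where "N = D + n * D * c"
    define f where "f = (\<lambda>(i, \<gamma>). z ^ i * mon ?T \<gamma>)"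
    have "h ^ (n * D) * f p \<in> saturated N" if "p \<in> {..e} \<times> exps ?T D" for p
    proof -
      obtain i \<gamma> where p0: "p = (i, \<gamma>)" by (cases p)
      have p: "p = (i, \<gamma>)" "i \<le> e" "\<gamma> \<in> exps ?T D" using that p0 by auto
      have "h ^ (n * D) * mon ?T \<gamma> \<in> homog S (n * D * c)"
        using denominator_monomial[OF fin h(3,4) p(3)] card by simp
      then have 1: "h ^ (n * D) * mon ?T \<gamma> \<in> saturated (n * D * c)" using homog_saturated by blast
      have 2: "1 \<in> saturated ((e - i) * d)"
        using homog_saturated homog_1[OF finite_S one_S] by blast
      have "z ^ i * (h ^ (n * D) * mon ?T \<gamma>) * 1 \<in> saturated (i * d + n * D * c + (e - i) * d)"
        by (intro saturated_mult saturated_power_mem z 1 2)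
      moreover have "i * d + n * D * c + (e - i) * d = N"
        using p(2) by (simp add: N_def D_def add_mult_distrib[symmetric])
      ultimately show ?thesis by (simp add: p f_def mult_ac)
    qed
    moreover have "C * N ^ n < card ({..e} \<times> exps ?T D)"
    proof -
      have "C * N ^ n = C * ((1 + n * c) * D) ^ n" by (simp add: N_def algebra_simps)
      also have "\<dots> \<le> e * D ^ n" by (simp only: e_def power_mult_distrib) (simp add: add_mult_distrib mult.assoc)
      also have "\<dots> < (e + 1) * (D + 1) ^ n"
        using D by (intro mult_less_le_imp_less) (auto intro: power_mono)
      also have "\<dots> = card ({..e} \<times> exps ?T D)"
        using fin by (simp add: card_cartesian_product card_exps card)
      finally show ?thesis .
    qed
    moreover have "N \<ge> 1" using D by (simp add: N_def)
    ultimately obtain u where u: "\<exists>p\<in>{..e} \<times> exps ?T D. u p \<noteq> 0" "(\<Sum>p\<in>{..e} \<times> exps ?T D. \<iota> (u p) * f p) = 0"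
      using dim_at_most_relation_scaled[OF C[of N], of "{..e} \<times> exps ?T D" "h ^ (n * D)" f] h(1) fin by auto
    define p where "p i = (\<Sum>\<gamma>\<in>exps ?T D. \<iota> (u (i, \<gamma>)) * mon ?T \<gamma>)" for i
    have p_box: "p i \<in> box ?T D" for i unfolding p_def by (rule box_sumI[OF fin])
    have rel: "(\<Sum>i\<le>e. p i * z ^ i) = 0"
      using u(2) by (simp add: p_def f_def sum.cartesian_product' sum_distrib_left mult_ac)
    obtain j \<gamma> where j: "j \<le> e" "\<gamma> \<in> exps ?T D" "u (j, \<gamma>) \<noteq> 0" using u(1) by auto
    define i where "i = (LEAST i. i \<le> e \<and> (\<exists>\<gamma>\<in>exps ?T D. u (i, \<gamma>) \<noteq> 0))"
    have i: "i \<le> e \<and> (\<exists>\<gamma>\<in>exps ?T D. u (i, \<gamma>) \<noteq> 0)"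
      unfolding i_def by (rule LeastI[of _ j]) (use j in blast)
    have below: "p k = 0" if "k < i" for k
    proof -
      have "\<not> (k \<le> e \<and> (\<exists>\<gamma>\<in>exps ?T D. u (k, \<gamma>) \<noteq> 0))" using that not_less_Least unfolding i_def by blast
      then show ?thesis using that i unfolding p_def by (intro sum.neutral) auto
    qed
    have pi: "p i \<noteq> 0 \<and> v (p i) \<le> real D * K"
      using i value_polynomial[where c = "\<lambda>\<gamma>. u (i, \<gamma>)" and D = D] unfolding p_def by blast
    have "0 = (\<Sum>k\<in>{i..e}. p k * z ^ k)"
      unfolding rel[symmetric] by (rule sum.mono_neutral_right) (auto simp: below)
    also have "\<dots> = (\<Sum>k\<in>{i..e}. p k * z ^ (k - i)) * z ^ i"
      unfolding sum_distrib_right by (intro sum.cong) (auto simp: mult.assoc simp flip: power_add)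
    finally have "(\<Sum>k\<in>{i..e}. p k * z ^ (k - i)) = 0" using z(2) by simp
    then have "p i + (\<Sum>k\<in>{i<..e}. p k * z ^ (k - i)) = 0"
      using i by (simp add: sum.head)
    then have pi_eq: "- p i = (\<Sum>k\<in>{i<..e}. p k * z ^ (k - i))" by (simp add: eq_neg_iff_add_eq_0 neg_eq_iff_add_eq_0)
    have "(\<Sum>k\<in>{i<..e}. p k * z ^ (k - i)) = 0 \<or> v z - real D * K \<le> v (\<Sum>k\<in>{i<..e}. p k * z ^ (k - i))"
    proof (rule v_sum_ge)
      fix k assume k: "k \<in> {i<..e}"
      show "p k * z ^ (k - i) = 0 \<or> v z - real D * K \<le> v (p k * z ^ (k - i))"
      proof (cases "p k = 0")
        case False
        \<comment> \<open>Positivity of \<open>v z\<close> makes the term with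
          \<open>k = i + 1\<close> the weakest case.\<close>
        have "1 * v z \<le> real (k - i) * v z" using k vz by (intro mult_right_mono) auto
        moreover have "- (real D * K) \<le> v (p k)" using value_box[OF p_box[of k]] False by simp
        ultimately show ?thesis using False z(2) by (simp add: v_mult v_power)
      qed simp
    qed
    then have "v z - real D * K \<le> v (p i)" unfolding pi_eq[symmetric] using pi by (simp add: v_uminus)
    then have "v z \<le> 2 * (real D * K)" using pi by simp
    then show False using neg by (simp add: D_def mult_ac)
  qed
  then show ?thesis by blast
qed

section \<open>Adapted bases of Abhyankar valuations\<close>

context real_valued
begin

text \<open>One element of K is picked for each of r independent values; the difference of two
  natural combinations is then a rational relation between these values.\<close>

lemma rational_basis:
  assumes "rational_rank v = enat r"
  shows "\<exists>F. finite F \<and> 0 \<notin> F \<and> card F = r \<and>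
    (\<forall>a b f. (\<Sum>f\<in>F. real (a f) * v f) = (\<Sum>f\<in>F. real (b f) * v f) \<longrightarrow> f \<in> F \<longrightarrow> (a f :: nat) = b f)"
proof -
  interpret Q: vector_space "\<lambda>(q::rat) (x::real). of_rat q * x"
    by unfold_locales (auto simp: of_rat_add of_rat_mult algebra_simps)
  have "\<exists>B\<in>{B. finite B \<and> B \<subseteq> v ` (UNIV - {0}) \<and> \<not> Q.dependent B}. card B = r"
    using assms unfolding rational_rank_def
    by (rule enat_SUP_attained) (use Q.independent_empty in blast)
  then obtain B where B: "finite B" "B \<subseteq> v ` (UNIV - {0})" "\<not> Q.dependent B" "card B = r" by blast
  obtain F where F: "F \<subseteq> UNIV - {0}" "inj_on v F" "v ` F = B" using subset_image_inj[THEN iffD1, OF B(2)] by blast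
  have fin: "finite F" using B(1) F(2,3) finite_image_iff by blast
  show ?thesis
  proof (intro exI[of _ F] conjI allI impI)
    show "card F = r" using card_image[OF F(2)] F(3) B(4) by simp
    fix a b :: "'a \<Rightarrow> nat" and f
    assume eq: "(\<Sum>f\<in>F. real (a f) * v f) = (\<Sum>f\<in>F. real (b f) * v f)" and f: "f \<in> F"
    define u where "u x = (of_nat (a (inv_into F v x)) - of_nat (b (inv_into F v x)) :: rat)" for x
    have u: "of_rat (u (v f)) = real (a f) - real (b f)" if "f \<in> F" for f
      using that F(2) by (simp add: u_def inv_into_f_f of_rat_diff)
    have "(\<Sum>x\<in>B. of_rat (u x) * x) = (\<Sum>f\<in>F. of_rat (u (v f)) * v f)"
      unfolding F(3)[symmetric] using F(2) by (simp add: sum.reindex)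
    also have "\<dots> = (\<Sum>f\<in>F. real (a f) * v f - real (b f) * v f)"
      by (intro sum.cong) (auto simp: u algebra_simps)
    also have "\<dots> = 0" using eq by (simp add: sum_subtractf)
    finally have "u (v f) = 0" using B(3) Q.dependent_finite[OF B(1)] f F(3) by blast
    then show "a f = b f" using u[OF f] by simp
  qed (use F fin in auto)
qed

lemma residue_basis:
  assumes "residual_trdeg \<iota> v = enat e"
  shows "\<exists>G. finite G \<and> G \<subseteq> valuation_ring v \<and> card G = e \<and>
    (\<forall>\<gamma> D c. \<gamma> \<in> exps G D \<longrightarrow> c \<gamma> \<noteq> 0 \<longrightarrow> (\<Sum>\<gamma>\<in>exps G D. \<iota> (c \<gamma>) * mon G \<gamma>) \<notin> valuation_ideal v)"
proof -
  let ?\<psi> = "\<lambda>c. residue_class v (\<iota> c)"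
  \<comment> \<open>For positive e the supremum cannot be that of the empty family, so it is
    attained; e = 0 is served directly by the empty set.\<close>
  show ?thesis
  proof (cases "e = 0")
    case True
    have "exps {} D = {\<lambda>_. 0}" for D by (auto simp: exps_def)
    then show ?thesis
      using True by (intro exI[of _ "{}"]) (auto simp: valuation_ideal_def v_const)
  next
    case False
    have "\<exists>H\<in>{H. finite H \<and> algebraically_independent (residue_field v) ?\<psi> H}. card H = e"
      using assms unfolding residual_trdeg_def transcendence_degree_def
    proof (rule enat_SUP_attained)
      show "{H. finite H \<and> algebraically_independent (residue_field v) ?\<psi> H} \<noteq> {}"
      proof
        assume none: "{H. finite H \<and> algebraically_independent (residue_field v) ?\<psi> H} = {}"
        have "residual_trdeg \<iota> v = 0"
          unfolding residual_trdeg_def transcendence_degree_def none by (simp add: bot_enat_def)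
        then show False using assms False by (simp add: zero_enat_def)
      qed
    qed
    then obtain H where H: "finite H" "algebraically_independent (residue_field v) ?\<psi> H" "card H = e" by blast
    have "H \<subseteq> residue_class v ` valuation_ring v"
      using H(2) residue_class_surj unfolding algebraically_independent_def by blast
    then obtain G where G: "G \<subseteq> valuation_ring v" "inj_on (residue_class v) G" "residue_class v ` G = H"
      using subset_image_inj[THEN iffD1] by metis
    have fin: "finite G" using H(1) G(2,3) finite_image_iff by blast
    have "card G = e" using card_image[OF G(2)] G(3) H(3) by simp
    then show ?thesis
      using residue_independent[OF fin G(1,2) H(2)[folded G(3)]] fin G(1) by (intro exI[of _ G]) blast
  qed
qed

end

lemma (in coordinates) abhyankar_linear_growth:
  assumes "abhyankar \<iota> v"
  shows "\<exists>B. \<forall>d\<ge>1. \<forall>z\<in>saturated d. z \<noteq> 0 \<longrightarrow> v z \<le> B * real d"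
proof -
  interpret real_valued \<iota> v
    by unfold_locales (use assms in \<open>simp add: abhyankar_def\<close>)
  have sum: "rational_rank v + residual_trdeg \<iota> v = enat n"
    using assms by (simp add: abhyankar_def function_field_dim_eq)
  then obtain r e where re: "rational_rank v = enat r" "residual_trdeg \<iota> v = enat e" "r + e = n"
    by (cases "rational_rank v"; cases "residual_trdeg \<iota> v") auto
  obtain F where F: "finite F" "0 \<notin> F" "card F = r"
    and F_values: "\<forall>a b f. (\<Sum>f\<in>F. real (a f) * v f) = (\<Sum>f\<in>F. real (b f) * v f) \<longrightarrow> f \<in> F \<longrightarrow> (a f :: nat) = b f"
    using rational_basis[OF re(1)] by blast
  obtain G where G: "finite G" "G \<subseteq> valuation_ring v" "card G = e"
    and G_residues: "\<forall>\<gamma> D c. \<gamma> \<in> exps G D \<longrightarrow> c \<gamma> \<noteq> 0 \<longrightarrow> (\<Sum>\<gamma>\<in>exps G D. \<iota> (c \<gamma>) * mon G \<gamma>) \<notin> valuation_ideal v"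
    using residue_basis[OF re(2)] by blast
  interpret adapted_basis \<iota> v F G
    by unfold_locales (use F(1,2) G(1,2) F_values G_residues in blast)+
  have "card (F \<union> G) = n" using F G re(3) disjoint by (simp add: card_Un_disjoint)
  then show ?thesis by (rule saturated_value_bound[OF adapted_basis_axioms])
qed

section \<open>Affine schemes\<close>

lemma k_subalgebraD:
  fixes A :: "'a::field set"
  assumes "k_subalgebra \<iota> A"
  shows "0 \<in> A" "1 \<in> A" "x \<in> A \<Longrightarrow> y \<in> A \<Longrightarrow> x + y \<in> A" "x \<in> A \<Longrightarrow> y \<in> A \<Longrightarrow> x * y \<in> A"
    "x \<in> A \<Longrightarrow> - x \<in> A" "\<iota> c \<in> A"
proof -
  interpret R: cring "ring_of_type_algebra :: 'a ring" by (rule cring_from_type_algebra)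
  have sub: "subring A ring_of_type_algebra" "range \<iota> \<subseteq> A" using assms by (auto simp: k_subalgebra_def)
  have inv: "\<ominus>\<^bsub>ring_of_type_algebra\<^esub> x = - x" for x :: 'a
    using R.minus_equality[of "- x" x] by simp
  show "0 \<in> A" "1 \<in> A" "x \<in> A \<Longrightarrow> y \<in> A \<Longrightarrow> x + y \<in> A" "x \<in> A \<Longrightarrow> y \<in> A \<Longrightarrow> x * y \<in> A"
    "x \<in> A \<Longrightarrow> - x \<in> A"
    using subringE[OF sub(1)] inv by auto
  show "\<iota> c \<in> A" using sub(2) by auto
qed

lemma k_subalgebraI:
  fixes A :: "'a::field set"
  assumes "\<And>x y. x \<in> A \<Longrightarrow> y \<in> A \<Longrightarrow> x + y \<in> A" "\<And>x y. x \<in> A \<Longrightarrow> y \<in> A \<Longrightarrow> x * y \<in> A"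
    "\<And>x. x \<in> A \<Longrightarrow> - x \<in> A" "\<And>c. \<iota> c \<in> A" "1 \<in> A"
  shows "k_subalgebra \<iota> A"
proof -
  interpret R: cring "ring_of_type_algebra :: 'a ring" by (rule cring_from_type_algebra)
  have inv: "\<ominus>\<^bsub>ring_of_type_algebra\<^esub> x = - x" for x :: 'a
    using R.minus_equality[of "- x" x] by simp
  have "subring A ring_of_type_algebra"
    by (rule R.subringI) (use assms inv in auto)
  then show ?thesis using assms(4) by (auto simp: k_subalgebra_def)
qed

lemma k_subalgebra_prod:
  assumes "k_subalgebra \<iota> A"
  shows "(\<And>i. i \<in> I \<Longrightarrow> f i \<in> A) \<Longrightarrow> prod f I \<in> A"
  by (induction I rule: infinite_finite_induct) (auto intro: k_subalgebraD[OF assms])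

lemma k_subalgebra_power:
  assumes "k_subalgebra \<iota> A"
  shows "x \<in> A \<Longrightarrow> x ^ i \<in> A"
  by (induction i) (auto intro: k_subalgebraD[OF assms])

lemma k_subalgebra_cring:
  fixes A :: "'a::field set"
  assumes "k_subalgebra \<iota> A"
  shows "cring (ring_on A)"
proof -
  interpret R: cring "ring_of_type_algebra :: 'a ring" by (rule cring_from_type_algebra)
  have "subring A ring_of_type_algebra" using assms by (simp add: k_subalgebra_def)
  then show ?thesis using R.subcringI'[of A] R.subcring_iff[of A] by simp
qed

lemma primeideal_ring_on:
  assumes "k_subalgebra \<iota> A" "primeideal P (ring_on A)"
  shows "P \<subseteq> A" "0 \<in> P" "1 \<notin> P" "x \<in> P \<Longrightarrow> y \<in> P \<Longrightarrow> x + y \<in> P" "x \<in> A \<Longrightarrow> y \<in> P \<Longrightarrow> x * y \<in> P"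
    "x \<in> A \<Longrightarrow> y \<in> A \<Longrightarrow> x * y \<in> P \<Longrightarrow> x \<in> P \<or> y \<in> P"
proof -
  interpret P: primeideal P "ring_on A" by fact
  show "P \<subseteq> A" using P.a_subset by simp
  show "0 \<in> P" using additive_subgroup.zero_closed[OF P.additive_subgroup_axioms] by simp
  show "1 \<notin> P" using P.one_imp_carrier P.I_notcarr by auto
  show "x \<in> P \<Longrightarrow> y \<in> P \<Longrightarrow> x + y \<in> P" using additive_subgroup.a_closed[OF P.additive_subgroup_axioms, of x y] by simp
  show "x \<in> A \<Longrightarrow> y \<in> P \<Longrightarrow> x * y \<in> P" using P.I_l_closed[of y x] by simp
  show "x \<in> A \<Longrightarrow> y \<in> A \<Longrightarrow> x * y \<in> P \<Longrightarrow> x \<in> P \<or> y \<in> P" using P.I_prime[of x y] by simp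
qed

text \<open>Chevalley's theorem doubles as the source of prime ideals: the maximal ideal of the
  valuation ring contracts to a prime of A containing I.\<close>

lemma exists_primeideal:
  fixes A I :: "'a::field set"
  assumes A: "k_subalgebra \<iota> A" and AI: "sub_ideal A I"
  shows "\<exists>P. primeideal P (ring_on A) \<and> I \<subseteq> P"
proof -
  obtain V where V: "A \<subseteq> V" "1 \<in> V" "\<And>x y. x \<in> V \<Longrightarrow> y \<in> V \<Longrightarrow> x + y \<in> V"
    "\<And>x y. x \<in> V \<Longrightarrow> y \<in> V \<Longrightarrow> x * y \<in> V" "\<And>x. x \<in> V \<Longrightarrow> - x \<in> V"
    "\<And>x. x \<in> V \<or> inverse x \<in> V" and IV: "\<And>x. x \<in> I \<Longrightarrow> x \<noteq> 0 \<Longrightarrow> inverse x \<notin> V"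
    using AI by (rule chevalley) blast
  interpret valuation_subring V by (rule valuation_subring.intro) (use V in blast)+
  interpret A: cring "ring_on A" by (rule k_subalgebra_cring[OF A])
  note kA = k_subalgebraD[OF A]
  have inv: "\<ominus>\<^bsub>ring_on A\<^esub> x = - x" if "x \<in> A" for x
    using A.minus_equality[of "- x" x] kA(5)[OF that] that by simp
  have M_mult': "a * x \<in> M" if "a \<in> M" "x \<in> V" for a x
    using M_mult[OF that(2,1)] by (simp add: mult.commute)
  have "primeideal (A \<inter> M) (ring_on A)"
  proof (rule primeidealI)
    show "ideal (A \<inter> M) (ring_on A)"
    proof (rule idealI)
      show "subgroup (A \<inter> M) (add_monoid (ring_on A))"
      proof (rule A.add.subgroupI)
        show "A \<inter> M \<noteq> {}" using kA(1) M_0 by blast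
        show "\<ominus>\<^bsub>ring_on A\<^esub> a \<in> A \<inter> M" if "a \<in> A \<inter> M" for a
          using that kA(5) M_uminus inv by auto
      qed (use kA M_add in auto)
    qed (use kA M_mult M_mult' V(1) A.ring_axioms in \<open>auto simp: subset_iff\<close>)
    show "carrier (ring_on A) \<noteq> A \<inter> M" using kA(2) M_1 by auto
    fix a b assume ab: "a \<in> carrier (ring_on A)" "b \<in> carrier (ring_on A)" "a \<otimes>\<^bsub>ring_on A\<^esub> b \<in> A \<inter> M"
    then show "a \<in> A \<inter> M \<or> b \<in> A \<inter> M" using nonmember_M_mult[of a b] V(1) by auto
  qed (rule A.is_cring)
  moreover have "I \<subseteq> A \<inter> M" using sub_idealD(5)[OF AI] IV V(1) by (auto simp: M_def)
  ultimately show ?thesis by blast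
qed

definition basic_open :: "'a::field set \<Rightarrow> 'a \<Rightarrow> 'a set set" where
  "basic_open A f = {P. primeideal P (ring_on A) \<and> f \<notin> P}"

lemma spectrum_basic_open: "spectrum A = topology_generated_by (basic_open A ` A)"
  unfolding spectrum_def basic_open_def by (intro arg_cong[of _ _ topology_generated_by]) auto

lemma topspace_spectrum:
  assumes "k_subalgebra \<iota> A"
  shows "topspace (spectrum A) = {P. primeideal P (ring_on A)}"
proof -
  have "basic_open A 1 = {P. primeideal P (ring_on A)}"
    using primeideal_ring_on(3)[OF assms] by (auto simp: basic_open_def)
  then show ?thesis
    using k_subalgebraD(2)[OF assms] unfolding spectrum_basic_open topology_generated_by_topspace
    by (auto simp: basic_open_def)
qed

lemma openin_basic_open: "f \<in> A \<Longrightarrow> openin (spectrum A) (basic_open A f)"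
  unfolding spectrum_basic_open openin_topology_generated_by_iff
  by (rule generate_topology_on.Basis) simp

lemma spectrum_basis:
  assumes A: "k_subalgebra \<iota> A" and W: "openin (spectrum A) W" and P: "P \<in> W"
  shows "\<exists>f\<in>A. P \<in> basic_open A f \<and> basic_open A f \<subseteq> W"
proof -
  have "generate_topology_on (basic_open A ` A) W"
    using W by (simp add: spectrum_basic_open openin_topology_generated_by_iff)
  then show ?thesis
    using P
  proof (induction W rule: generate_topology_on.induct)
    case (Int a b)
    then obtain f g where fg: "f \<in> A" "g \<in> A" "P \<in> basic_open A f" "P \<in> basic_open A g"
      "basic_open A f \<subseteq> a" "basic_open A g \<subseteq> b" by blast
    have "basic_open A (f * g) = basic_open A f \<inter> basic_open A g"
    proof -
      have "f * g \<in> Q \<longleftrightarrow> f \<in> Q \<or> g \<in> Q" if "primeideal Q (ring_on A)" for Q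
        using primeideal_ring_on(5)[OF A that fg(1), of g] primeideal_ring_on(5)[OF A that fg(2), of f]
          primeideal_ring_on(6)[OF A that fg(1,2)] by (auto simp: mult.commute)
      then show ?thesis by (auto simp: basic_open_def)
    qed
    then show ?case using fg k_subalgebraD(4)[OF A] by (intro bexI[of _ "f * g"]) auto
  next
    case (UN K)
    then show ?case by (meson Union_iff Union_upper subset_trans)
  qed auto
qed

text \<open>I is the ideal generated by the f whose basic open set lies in a member of the cover. If
  it were proper, a prime containing it would lie in some member and hence avoid one of the
  generators. So 1 is a combination of finitely many such f, and their basic open sets
  cover.\<close>

lemma compact_spectrum:
  assumes A: "k_subalgebra \<iota> A"
  shows "compact_space (spectrum A)"
  unfolding compact_space_alt
proof (intro allI impI, elim conjE)
  fix \<U> assume op: "\<forall>U\<in>\<U>. openin (spectrum A) U" and cov: "topspace (spectrum A) \<subseteq> \<Union>\<U>"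
  define F where "F = {f \<in> A. \<exists>U\<in>\<U>. basic_open A f \<subseteq> U}"
  define I where "I = {z. \<exists>H a. finite H \<and> H \<subseteq> F \<and> (\<forall>f\<in>H. a f \<in> A) \<and> z = (\<Sum>f\<in>H. a f * f)}"
  note kA = k_subalgebraD[OF A]
  have FA: "F \<subseteq> A" by (auto simp: F_def)
  have sumA: "(\<Sum>f\<in>H. a f * f) \<in> A" if "finite H" "H \<subseteq> F" "\<forall>f\<in>H. a f \<in> A" for H a
    using that FA by (induction H rule: finite_induct) (auto intro: kA)
  have "1 \<in> I"
  proof (rule ccontr)
    assume "1 \<notin> I"
    have "sub_ideal A I"
      unfolding sub_ideal_def
    proof (intro conjI ballI)
      show "I \<subseteq> A" using sumA by (auto simp: I_def)
      show "0 \<in> I" unfolding I_def by (intro CollectI exI[of _ "{}"]) auto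
      show "x + y \<in> I" if xy: "x \<in> I" "y \<in> I" for x y
      proof -
        obtain H a where x: "finite H" "H \<subseteq> F" "\<forall>f\<in>H. a f \<in> A" "x = (\<Sum>f\<in>H. a f * f)"
          using xy(1) by (auto simp: I_def)
        obtain H' a' where y: "finite H'" "H' \<subseteq> F" "\<forall>f\<in>H'. a' f \<in> A" "y = (\<Sum>f\<in>H'. a' f * f)"
          using xy(2) by (auto simp: I_def)
        let ?a = "\<lambda>f. if f \<in> H then a f else 0" and ?a' = "\<lambda>f. if f \<in> H' then a' f else 0"
        have "x = (\<Sum>f\<in>H \<union> H'. ?a f * f)" "y = (\<Sum>f\<in>H \<union> H'. ?a' f * f)"
          unfolding x y using x(1) y(1) by (intro sum.mono_neutral_cong_left; auto)+
        then have "x + y = (\<Sum>f\<in>H \<union> H'. (?a f + ?a' f) * f)"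
          by (simp only: sum.distrib[symmetric] distrib_right)
        moreover have "\<forall>f\<in>H \<union> H'. ?a f + ?a' f \<in> A" using x(3) y(3) kA by auto
        ultimately show ?thesis unfolding I_def using x(1,2) y(1,2) by (intro CollectI exI[of _ "H \<union> H'"] exI conjI) auto
      qed
      show "x * y \<in> I" if xy: "x \<in> A" "y \<in> I" for x y
      proof -
        obtain H a where y: "finite H" "H \<subseteq> F" "\<forall>f\<in>H. a f \<in> A" "y = (\<Sum>f\<in>H. a f * f)"
          using xy(2) by (auto simp: I_def)
        have "x * y = (\<Sum>f\<in>H. (x * a f) * f)" by (simp add: y(4) sum_distrib_left mult.assoc)
        then show ?thesis unfolding I_def using y(1-3) xy(1) kA(4)
          by (intro CollectI exI[of _ H] exI[of _ "\<lambda>f. x * a f"]) auto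
      qed
    qed (use \<open>1 \<notin> I\<close> kA in auto)
    then obtain P where P: "primeideal P (ring_on A)" "I \<subseteq> P" using exists_primeideal[OF A] by blast
    then have "P \<in> \<Union>\<U>" using cov topspace_spectrum[OF A] by auto
    then obtain U where U: "U \<in> \<U>" "P \<in> U" by blast
    obtain f where f: "f \<in> A" "P \<in> basic_open A f" "basic_open A f \<subseteq> U"
      using spectrum_basis[OF A _ U(2)] op U(1) by blast
    have "f \<in> I"
      unfolding I_def using f U(1) kA(2)
      by (intro CollectI exI[of _ "{f}"] exI[of _ "\<lambda>_. 1"]) (auto simp: F_def)
    then show False using P(2) f(2) by (auto simp: basic_open_def)
  qed
  then obtain H a where H: "finite H" "H \<subseteq> F" "\<forall>f\<in>H. a f \<in> A" "1 = (\<Sum>f\<in>H. a f * f)" by (auto simp: I_def)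
  have "\<forall>f\<in>H. \<exists>U. U \<in> \<U> \<and> basic_open A f \<subseteq> U" using H(2) by (auto simp: F_def)
  then obtain u where u: "\<forall>f\<in>H. u f \<in> \<U> \<and> basic_open A f \<subseteq> u f" unfolding bchoice_iff by blast
  show "\<exists>\<F>. finite \<F> \<and> \<F> \<subseteq> \<U> \<and> topspace (spectrum A) \<subseteq> \<Union>\<F>"
  proof (intro exI[of _ "u ` H"] conjI subsetI)
    fix P assume "P \<in> topspace (spectrum A)"
    then have P: "primeideal P (ring_on A)" by (simp add: topspace_spectrum[OF A])
    note pP = primeideal_ring_on[OF A P]
    have "\<exists>f\<in>H. f \<notin> P"
    proof (rule ccontr)
      assume *: "\<not> ?thesis"
      have "(\<Sum>f\<in>H'. a f * f) \<in> P" if "finite H'" "H' \<subseteq> H" for H'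
        using that by (induction H' rule: finite_induct) (use * H(3) pP in auto)
      from this[OF H(1) order_refl] show False using pP(3) H(4) by simp
    qed
    then show "P \<in> \<Union>(u ` H)" using u P by (auto simp: basic_open_def)
  qed (use H(1) u in auto)
qed

section \<open>Sections of line bundles on a projective model\<close>

text \<open>z is the index of a coordinate that is not identically zero; division by
  \<open>x z\<close> turns homogeneous coordinates into the elements \<open>y j\<close> used
  throughout.\<close>

locale projective_model = ground_field \<iota> for \<iota> :: "'k::alg_closed_field \<Rightarrow> 'a::field" +
  fixes Y :: "('p, 'a) ringed_space" and N :: nat and x :: "nat \<Rightarrow> 'a" and z :: nat
  assumes scheme: "integral_scheme \<iota> Y" and normal: "normal_scheme Y"
    and immersion: "closed_immersion_into_projective_space \<iota> Y N x"
    and z: "z \<le> N" "x z \<noteq> 0"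
begin

section \<open>Structure sheaf and standard charts\<close>

abbreviation "points \<equiv> topspace (space_of Y)"

lemma opens_meet: "nonempty_open Y U \<Longrightarrow> nonempty_open Y U' \<Longrightarrow> U \<inter> U' \<noteq> {}"
  and regular_subalgebra: "nonempty_open Y U \<Longrightarrow> k_subalgebra \<iota> (regular Y U)"
  and regular_anti: "nonempty_open Y U \<Longrightarrow> nonempty_open Y U' \<Longrightarrow> U \<subseteq> U' \<Longrightarrow> regular Y U' \<subseteq> regular Y U"
  and regular_sheaf: "\<U> \<noteq> {} \<Longrightarrow> (\<And>U. U \<in> \<U> \<Longrightarrow> nonempty_open Y U) \<Longrightarrow> (\<Inter>U\<in>\<U>. regular Y U) \<subseteq> regular Y (\<Union>\<U>)"
  and points_nonempty: "points \<noteq> {}"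
  and generic_stalk: "(\<Union>U\<in>{U. nonempty_open Y U}. regular Y U) = UNIV"
proof -
  note S = scheme[unfolded integral_scheme_def]
  show "nonempty_open Y U \<Longrightarrow> nonempty_open Y U' \<Longrightarrow> U \<inter> U' \<noteq> {}"
    using conjunct1[OF S] by simp
  show "nonempty_open Y U \<Longrightarrow> k_subalgebra \<iota> (regular Y U)"
    using S[THEN conjunct2, THEN conjunct1] by simp
  show "nonempty_open Y U \<Longrightarrow> nonempty_open Y U' \<Longrightarrow> U \<subseteq> U' \<Longrightarrow> regular Y U' \<subseteq> regular Y U"
    using S[THEN conjunct2, THEN conjunct2, THEN conjunct1] by simp
  show "\<U> \<noteq> {} \<Longrightarrow> (\<And>U. U \<in> \<U> \<Longrightarrow> nonempty_open Y U) \<Longrightarrow> (\<Inter>U\<in>\<U>. regular Y U) \<subseteq> regular Y (\<Union>\<U>)"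
    using S[THEN conjunct2, THEN conjunct2, THEN conjunct2, THEN conjunct1] by simp
  show "points \<noteq> {}" "(\<Union>U\<in>{U. nonempty_open Y U}. regular Y U) = UNIV"
    using S by blast+
qed

lemma stalk_iff: "f \<in> stalk Y p \<longleftrightarrow> (\<exists>U. openin (space_of Y) U \<and> p \<in> U \<and> f \<in> regular Y U)"
  by (auto simp: stalk_def)

lemma stalk_pair:
  assumes "f \<in> stalk Y p" "g \<in> stalk Y p"
  shows "\<exists>U. nonempty_open Y U \<and> p \<in> U \<and> f \<in> regular Y U \<and> g \<in> regular Y U"
proof -
  obtain U U' where U: "openin (space_of Y) U" "p \<in> U" "f \<in> regular Y U"
    and U': "openin (space_of Y) U'" "p \<in> U'" "g \<in> regular Y U'"
    using assms unfolding stalk_iff by blast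
  have "nonempty_open Y (U \<inter> U')" using U U' by auto
  moreover have "regular Y U \<subseteq> regular Y (U \<inter> U')" "regular Y U' \<subseteq> regular Y (U \<inter> U')"
    using U U' by (intro regular_anti; auto)+
  ultimately show ?thesis using U U' by (intro exI[of _ "U \<inter> U'"]) blast
qed

lemma stalk_subalgebra:
  assumes p: "p \<in> points"
  shows "k_subalgebra \<iota> (stalk Y p)"
proof (rule k_subalgebraI)
  fix f g assume "f \<in> stalk Y p" "g \<in> stalk Y p"
  then obtain U where U: "nonempty_open Y U" "p \<in> U" "f \<in> regular Y U" "g \<in> regular Y U"
    using stalk_pair by blast
  note R = k_subalgebraD[OF regular_subalgebra[OF U(1)]]
  show "f + g \<in> stalk Y p" "f * g \<in> stalk Y p"
    using R(3,4)[OF U(3,4)] U(1,2) unfolding stalk_iff by blast+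
next
  fix f assume "f \<in> stalk Y p"
  then obtain U where U: "nonempty_open Y U" "p \<in> U" "f \<in> regular Y U"
    using stalk_pair by blast
  show "- f \<in> stalk Y p"
    using k_subalgebraD(5)[OF regular_subalgebra[OF U(1)] U(3)] U(1,2) unfolding stalk_iff by blast
next
  have "nonempty_open Y points" using points_nonempty by simp
  from k_subalgebraD[OF regular_subalgebra[OF this]] show "\<iota> c \<in> stalk Y p" "1 \<in> stalk Y p" for c
    using p unfolding stalk_iff by (intro exI[of _ points]; simp)+
qed

lemma regular_stalk: "openin (space_of Y) U \<Longrightarrow> p \<in> U \<Longrightarrow> f \<in> regular Y U \<Longrightarrow> f \<in> stalk Y p"
  unfolding stalk_iff by blast

lemma regular_of_stalks:
  assumes U: "nonempty_open Y U" and f: "\<And>p. p \<in> U \<Longrightarrow> f \<in> stalk Y p"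
  shows "f \<in> regular Y U"
proof -
  define \<U> where "\<U> = {W. nonempty_open Y W \<and> W \<subseteq> U \<and> f \<in> regular Y W}"
  have ex: "\<exists>W\<in>\<U>. p \<in> W" if p: "p \<in> U" for p
  proof -
    obtain W where W: "openin (space_of Y) W" "p \<in> W" "f \<in> regular Y W" using f[OF p] unfolding stalk_iff by blast
    have "nonempty_open Y (W \<inter> U)" using W U p by auto
    moreover from this have "regular Y W \<subseteq> regular Y (W \<inter> U)" using W by (intro regular_anti) auto
    ultimately show ?thesis using W p by (intro bexI[of _ "W \<inter> U"]) (auto simp: \<U>_def)
  qed
  then have "\<Union>\<U> = U" "\<U> \<noteq> {}" using U by (auto simp: \<U>_def)
  moreover have "f \<in> (\<Inter>W\<in>\<U>. regular Y W)" by (auto simp: \<U>_def)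
  moreover have "(\<Inter>W\<in>\<U>. regular Y W) \<subseteq> regular Y (\<Union>\<U>)"
    using \<open>\<U> \<noteq> {}\<close> by (rule regular_sheaf) (simp add: \<U>_def)
  ultimately show ?thesis by auto
qed

text \<open>Allows passing to finitely many patches of a line bundle over each chart.\<close>

lemma affine_compact:
  assumes "affine_open Y U"
  shows "compactin (space_of Y) U"
proof -
  have U: "nonempty_open Y U"
    and hom: "homeomorphic_map (subtopology (space_of Y) U) (spectrum (regular Y U)) (prime_of_point Y U)"
    using assms by (auto simp: affine_open_def)
  have "compact_space (subtopology (space_of Y) U)"
    using homeomorphic_compact_space[OF homeomorphic_map_imp_homeomorphic_space[OF hom]]
      compact_spectrum[OF regular_subalgebra[OF U]] by simp
  then show ?thesis using U openin_subset by (auto simp: compactin_subspace)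
qed

text \<open>K is the fraction field of the ring of an affine open set: a neighbourhood on which f is
  regular contains a nonempty basic open set, given by some g, over which \<open>affine_open\<close>
  makes f a fraction with denominator a power of g.\<close>

lemma affine_fraction:
  assumes "affine_open Y U"
  shows "\<exists>g\<in>regular Y U. g \<noteq> 0 \<and> g * f \<in> regular Y U"
proof -
  let ?A = "regular Y U" and ?\<phi> = "prime_of_point Y U"
  have U: "nonempty_open Y U"
    and hom: "homeomorphic_map (subtopology (space_of Y) U) (spectrum ?A) ?\<phi>"
    and loc: "\<And>g. g \<in> ?A \<Longrightarrow> g \<noteq> 0 \<Longrightarrow> regular Y {p \<in> U. g \<notin> ?\<phi> p} = {a / g ^ n | a n. a \<in> ?A}"
    using assms by (auto simp: affine_open_def)
  note A = regular_subalgebra[OF U]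
  have US: "U \<subseteq> points" using U openin_subset by auto
  then have tU: "topspace (subtopology (space_of Y) U) = U" by auto
  obtain U' where U': "nonempty_open Y U'" "f \<in> regular Y U'" using generic_stalk by blast
  obtain p where p: "p \<in> U" "p \<in> U'" using opens_meet[OF U U'(1)] by blast
  have "openin (subtopology (space_of Y) U) (U \<inter> U')" using U U' by (simp add: openin_open_subtopology openin_Int)
  then have "openin (spectrum ?A) (?\<phi> ` (U \<inter> U'))"
    using homeomorphic_imp_open_map[OF hom] by (simp add: open_map_def)
  then obtain g where g: "g \<in> ?A" "?\<phi> p \<in> basic_open ?A g" "basic_open ?A g \<subseteq> ?\<phi> ` (U \<inter> U')"
    using spectrum_basis[OF A, of "?\<phi> ` (U \<inter> U')" "?\<phi> p"] p by blast
  have prime: "primeideal (?\<phi> q) (ring_on ?A)" if "q \<in> U" for q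
    using homeomorphic_imp_surjective_map[OF hom] topspace_spectrum[OF A] tU that by auto
  have inj: "inj_on ?\<phi> U" using homeomorphic_imp_injective_map[OF hom] tU by simp
  define W where "W = {q \<in> U. g \<notin> ?\<phi> q}"
  have W: "W = {q \<in> U. ?\<phi> q \<in> basic_open ?A g}" using prime by (auto simp: W_def basic_open_def)
  have "openin (subtopology (space_of Y) U) W"
    using openin_continuous_map_preimage[OF homeomorphic_imp_continuous_map[OF hom] openin_basic_open[OF g(1)]]
    unfolding tU W .
  then have "openin (space_of Y) W" using U by (simp add: openin_open_subtopology)
  moreover have "p \<in> W" using g(2) p(1) by (simp add: W)
  ultimately have "nonempty_open Y W" by auto
  moreover have "W \<subseteq> U'"
  proof
    fix q assume q: "q \<in> W"
    then obtain q' where "q' \<in> U" "q' \<in> U'" "?\<phi> q = ?\<phi> q'" using g(3) by (auto simp: W)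
    then show "q \<in> U'" using inj q by (auto simp: W dest: inj_onD)
  qed
  ultimately have "f \<in> regular Y W" using regular_anti[OF _ U'(1)] U'(2) by blast
  moreover have "g \<noteq> 0" using g(2) primeideal_ring_on(2)[OF A prime[OF p(1)]] by (auto simp: basic_open_def)
  ultimately obtain a m where "a \<in> ?A" "f = a / g ^ m" using loc[OF g(1)] unfolding W_def by blast
  then have "g ^ m * f \<in> ?A" using \<open>g \<noteq> 0\<close> by simp
  then show ?thesis using \<open>g \<noteq> 0\<close> k_subalgebra_power[OF A g(1)] by (intro bexI[of _ "g ^ m"]) auto
qed

definition y :: "nat \<Rightarrow> 'a" where "y j = x j / x z"
definition S :: "'a set" where "S = y ` {..N}"
definition J :: "nat set" where "J = {i. i \<le> N \<and> x i \<noteq> 0}"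
abbreviation U :: "nat \<Rightarrow> 'p set" where "U i \<equiv> chart Y N x i"

lemma finite_J: "finite J" and finite_S: "finite S" and y_z: "y z = 1" and one_S: "1 \<in> S"
  and y_nonzero: "i \<in> J \<Longrightarrow> y i \<noteq> 0" and ratio: "x j / x i = y j / y i" and z_J: "z \<in> J"
proof -
  show "finite J" "finite S" "y z = 1" "z \<in> J" using z by (auto simp: J_def S_def y_def)
  then show "1 \<in> S" using z unfolding S_def by (metis atMost_iff image_eqI)
  show "i \<in> J \<Longrightarrow> y i \<noteq> 0" "x j / x i = y j / y i" using z by (auto simp: J_def y_def)
qed

lemma S_cases:
  assumes "s \<in> S" "s \<noteq> 0"
  obtains i where "i \<in> J" "s = y i"
  using assms unfolding S_def J_def y_def by auto

lemma chart_cover: "p \<in> points \<Longrightarrow> \<exists>i\<in>J. p \<in> U i"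
proof -
  assume p: "p \<in> points"
  then have "p \<in> (\<Union>i\<le>N. U i)" using immersion by (simp add: closed_immersion_into_projective_space_def)
  then obtain i where i: "i \<le> N" "p \<in> U i" by auto
  then have "x i \<noteq> 0" by (auto simp: chart_def split: if_splits)
  then show ?thesis using i by (auto simp: J_def)
qed

lemma affine_chart: "i \<in> J \<Longrightarrow> affine_open Y (U i)"
  and regular_chart_hull: "i \<in> J \<Longrightarrow> regular Y (U i) = k_subalgebra \<iota> hull ((\<lambda>j. y j / y i) ` {..N})"
  using immersion unfolding closed_immersion_into_projective_space_def J_def ratio by blast+

lemma chart_open: "i \<in> J \<Longrightarrow> nonempty_open Y (U i)"
  using affine_chart by (simp add: affine_open_def)

lemma chart_subset: "U i \<subseteq> points"
  by (auto simp: chart_def)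

lemma chart_ratio: "p \<in> U i \<Longrightarrow> j \<le> N \<Longrightarrow> y j / y i \<in> stalk Y p"
  by (auto simp: chart_def ratio split: if_splits)

text \<open>The right side is the degree 0 part of the coordinate ring localized at the i-th
  coordinate. It is an algebra containing the generators; conversely, a monomial of degree M divided
  by \<open>y i ^ M\<close> is a product of generators \<open>s / y i\<close>.\<close>

lemma regular_chart:
  assumes i: "i \<in> J"
  shows "regular Y (U i) = {f. \<exists>M. f * y i ^ M \<in> homog S M}" (is "?A = ?B")
proof
  have yi: "y i \<noteq> 0" "y i \<in> homog S 1"
    using y_nonzero[OF i] i homog_generator[OF finite_S] by (auto simp: S_def J_def)
  have raise: "f * y i ^ M' \<in> homog S M'" if "f * y i ^ M \<in> homog S M" "M \<le> M'" for f M M'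
  proof -
    have "f * y i ^ M * y i ^ (M' - M) \<in> homog S (M + (M' - M) * 1)"
      by (rule homog_mult[OF that(1) homog_power[OF yi(2)]])
    then show ?thesis using that(2) by (simp add: mult.assoc flip: power_add)
  qed
  have "k_subalgebra \<iota> ?B"
  proof (rule k_subalgebraI)
    fix f g assume "f \<in> ?B" "g \<in> ?B"
    then obtain M M' where f: "f * y i ^ M \<in> homog S M" and g: "g * y i ^ M' \<in> homog S M'" by auto
    have "f * y i ^ (M + M') + g * y i ^ (M + M') \<in> homog S (M + M')"
      by (intro lin.subspace_add[OF homog_subspace] raise[OF f] raise[OF g]) auto
    then have "(f + g) * y i ^ (M + M') \<in> homog S (M + M')" by (simp add: distrib_right)
    then show "f + g \<in> ?B" by blast
    have "(f * g) * y i ^ (M + M') \<in> homog S (M + M')"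
      using homog_mult[OF f g] by (simp add: power_add mult_ac)
    then show "f * g \<in> ?B" by blast
  next
    fix f assume "f \<in> ?B"
    then obtain M where "f * y i ^ M \<in> homog S M" by auto
    from lin.subspace_neg[OF homog_subspace this] show "- f \<in> ?B" by auto
  next
    have 1: "1 \<in> homog S 0" by (rule homog_1[OF finite_S one_S])
    then show "1 \<in> ?B" by (auto intro!: exI[of _ 0])
    from lin.subspace_scale[OF homog_subspace 1] show "\<iota> c \<in> ?B" for c by (auto intro!: exI[of _ 0])
  qed
  moreover have "(\<lambda>j. y j / y i) ` {..N} \<subseteq> ?B"
    using yi(1) homog_generator[OF finite_S] by (auto simp: S_def intro!: exI[of _ 1])
  ultimately show "?A \<subseteq> ?B" unfolding regular_chart_hull[OF i] by (intro hull_minimal)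
  note A = regular_subalgebra[OF chart_open[OF i]]
  show "?B \<subseteq> ?A"
  proof
    fix f assume "f \<in> ?B"
    then obtain M where M: "f * y i ^ M \<in> homog S M" by auto
    have "inverse (y i ^ M) * (f * y i ^ M) \<in> lin.span ?A"
    proof (rule span_mult[OF lin.span_base[OF singletonI] M[unfolded homog_def]])
      fix a b assume "a \<in> {inverse (y i ^ M)}" "b \<in> {mon S \<alpha> |\<alpha>. sum \<alpha> S = M}"
      then obtain \<alpha> where a: "a = inverse (y i ^ M)" and b: "b = mon S \<alpha>" and \<alpha>: "sum \<alpha> S = M" by auto
      have "(\<Prod>s\<in>S. (s / y i) ^ \<alpha> s) = mon S \<alpha> / (\<Prod>s\<in>S. y i ^ \<alpha> s)"
        by (simp add: mon_def power_divide prod_dividef)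
      also have "(\<Prod>s\<in>S. y i ^ \<alpha> s) = y i ^ M" by (simp add: \<alpha> power_sum[symmetric])
      finally have "a * b = (\<Prod>s\<in>S. (s / y i) ^ \<alpha> s)" by (simp add: a b field_simps)
      also have "\<dots> \<in> ?A"
      proof (intro k_subalgebra_prod[OF A] k_subalgebra_power[OF A])
        fix s assume "s \<in> S"
        then show "s / y i \<in> ?A" unfolding regular_chart_hull[OF i] S_def by (auto intro: hull_inc)
      qed
      finally show "a * b \<in> lin.span ?A" by (rule lin.span_base)
    qed
    moreover have "lin.subspace ?A"
      using k_subalgebraD[OF A] by (auto simp: lin.subspace_def)
    moreover have "inverse (y i ^ M) * (f * y i ^ M) = f" using yi(1) by (simp add: field_simps)
    ultimately show "f \<in> ?A" by (simp only: lin.span_eq_iff[THEN iffD2])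
  qed
qed

sublocale coordinates \<iota> S
proof unfold_locales
  show "finite S" "1 \<in> S" by (rule finite_S one_S)+
  fix f
  \<comment> \<open>In the chart where \<open>y z = 1\<close>, regular functions are polynomials in
    S, so fractions of regular functions have the required form.\<close>
  obtain g where g: "g \<in> regular Y (U z)" "g \<noteq> 0" "g * f \<in> regular Y (U z)"
    using affine_fraction[OF affine_chart[OF z_J]] by blast
  then obtain M M' where M: "g \<in> homog S M" "g * f \<in> homog S M'"
    unfolding regular_chart[OF z_J] y_z by auto
  have "g \<in> homog S (M + M')" "g * f \<in> homog S (M + M')"
    by (rule homog_mono[OF finite_S one_S _ M(1)], simp, rule homog_mono[OF finite_S one_S _ M(2)], simp)
  then show "\<exists>h c. h \<noteq> 0 \<and> h \<in> homog S c \<and> h * f \<in> homog S c" using g(2) by blast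
qed

end

locale bundle_model = projective_model \<iota> Y N x z
  for \<iota> :: "'k::alg_closed_field \<Rightarrow> 'a::field" and Y :: "('p, 'a) ringed_space" and N x z +
  fixes L :: "('i, 'p, 'a) line_bundle" and base :: 'i
  assumes line_bundle: "is_line_bundle Y L" and base: "base \<in> idx L"
begin

text \<open>Embeds L into the constant sheaf K: a section with component f at \<open>base\<close>
  has component \<open>f / g a\<close> at a.\<close>

definition g :: "'i \<Rightarrow> 'a" where
  "g a = transition L base a"

text \<open>For \<open>\<kappa> = g ^ m\<close>, these are the global sections of \<open>m L + k D\<close>, where \<open>D\<close> is the hyperplane
  section \<open>x\<^sub>z = 0\<close>, written in the trivialization of \<open>L\<close> with index \<open>base\<close>.\<close>

definition sections :: "('i \<Rightarrow> 'a) \<Rightarrow> int \<Rightarrow> 'a set" where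
  "sections \<kappa> k = {f. \<forall>p\<in>points. \<forall>a\<in>idx L. \<forall>i\<in>J. p \<in> patch L a \<longrightarrow> p \<in> U i \<longrightarrow>
     f * inverse (\<kappa> a) * y i powi (- k) \<in> stalk Y p}"

lemma sectionsD: "f \<in> sections \<kappa> k \<Longrightarrow> p \<in> points \<Longrightarrow> a \<in> idx L \<Longrightarrow> i \<in> J \<Longrightarrow> p \<in> patch L a \<Longrightarrow> p \<in> U i \<Longrightarrow>
    f * inverse (\<kappa> a) * y i powi (- k) \<in> stalk Y p"
  unfolding sections_def by blast

lemma patch_open: "a \<in> idx L \<Longrightarrow> nonempty_open Y (patch L a)"
  and patch_cover: "p \<in> points \<Longrightarrow> \<exists>a\<in>idx L. p \<in> patch L a"
  and transition_nonzero: "a \<in> idx L \<Longrightarrow> b \<in> idx L \<Longrightarrow> transition L a b \<noteq> 0"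
  and transition_regular: "a \<in> idx L \<Longrightarrow> b \<in> idx L \<Longrightarrow> transition L a b \<in> regular Y (patch L a \<inter> patch L b)"
  and cocycle: "a \<in> idx L \<Longrightarrow> b \<in> idx L \<Longrightarrow> c \<in> idx L \<Longrightarrow>
    transition L a b * transition L b c = transition L a c"
  using line_bundle unfolding is_line_bundle_def by blast+

lemma g_nonzero: "a \<in> idx L \<Longrightarrow> g a \<noteq> 0"
  using transition_nonzero base by (simp add: g_def)

lemma g_base: "g base = 1"
  using cocycle[OF base base base] transition_nonzero[OF base base] by (simp add: g_def)

lemma g_ratio: "a \<in> idx L \<Longrightarrow> b \<in> idx L \<Longrightarrow> g a = g b * transition L b a"
  using cocycle[OF base] by (simp add: g_def)

lemma g_unit:
  assumes "a \<in> idx L" "b \<in> idx L" "p \<in> patch L a" "p \<in> patch L b"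
  shows "g a * inverse (g b) \<in> stalk Y p"
proof -
  have "g a * inverse (g b) = transition L b a"
    using g_ratio[OF assms(1,2)] g_nonzero[OF assms(2)] by simp
  moreover have "transition L b a \<in> regular Y (patch L b \<inter> patch L a)"
    by (rule transition_regular[OF assms(2,1)])
  moreover have "openin (space_of Y) (patch L b \<inter> patch L a)" using patch_open assms(1,2) by auto
  ultimately show ?thesis using assms(3,4) by (auto intro: regular_stalk)
qed

lemma sections_mult:
  assumes "f \<in> sections \<kappa> k" "f' \<in> sections \<kappa>' k'"
  shows "f * f' \<in> sections (\<lambda>a. \<kappa> a * \<kappa>' a) (k + k')"
  unfolding sections_def
proof (intro CollectI ballI impI)
  fix p a i assume *: "p \<in> points" "a \<in> idx L" "i \<in> J" "p \<in> patch L a" "p \<in> U i"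
  have "(f * inverse (\<kappa> a) * y i powi (- k)) * (f' * inverse (\<kappa>' a) * y i powi (- k')) \<in> stalk Y p"
    by (intro k_subalgebraD(4)[OF stalk_subalgebra[OF *(1)]] sectionsD[OF assms(1) *] sectionsD[OF assms(2) *])
  moreover have "y i powi (- (k + k')) = y i powi (- k) * y i powi (- k')"
    using y_nonzero[OF *(3)] by (simp flip: power_int_add)
  ultimately show "f * f' * inverse (\<kappa> a * \<kappa>' a) * y i powi (- (k + k')) \<in> stalk Y p"
    by (simp add: mult_ac)
qed

lemma one_sections: "1 \<in> sections (\<lambda>_. 1) 0"
  unfolding sections_def using k_subalgebraD(2)[OF stalk_subalgebra] by simp

lemma sections_power:
  assumes "f \<in> sections \<kappa> k"
  shows "f ^ m \<in> sections (\<lambda>a. \<kappa> a ^ m) (int m * k)"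
proof (induction m)
  case 0
  show ?case using one_sections by simp
next
  case (Suc m)
  show ?case using sections_mult[OF assms Suc] by (simp add: algebra_simps)
qed

lemma coordinate_section: "j \<le> N \<Longrightarrow> y j \<in> sections (\<lambda>_. 1) 1"
  unfolding sections_def using chart_ratio by (auto simp: power_int_minus field_simps)

lemma sections_subspace: "lin.subspace (sections \<kappa> k)"
  unfolding lin.subspace_def
proof (intro conjI ballI allI)
  show "0 \<in> sections \<kappa> k"
    unfolding sections_def using k_subalgebraD(1)[OF stalk_subalgebra] by simp
  fix f f' c assume f: "f \<in> sections \<kappa> k"
  show "\<iota> c * f \<in> sections \<kappa> k"
    unfolding sections_def
  proof (intro CollectI ballI impI)
    fix p a i assume *: "p \<in> points" "a \<in> idx L" "i \<in> J" "p \<in> patch L a" "p \<in> U i"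
    show "\<iota> c * f * inverse (\<kappa> a) * y i powi (- k) \<in> stalk Y p"
      using k_subalgebraD(4)[OF stalk_subalgebra[OF *(1)] k_subalgebraD(6)[OF stalk_subalgebra[OF *(1)]] sectionsD[OF f *]]
      by (simp add: mult.assoc)
  qed
  assume f': "f' \<in> sections \<kappa> k"
  show "f + f' \<in> sections \<kappa> k"
    unfolding sections_def
  proof (intro CollectI ballI impI)
    fix p a i assume *: "p \<in> points" "a \<in> idx L" "i \<in> J" "p \<in> patch L a" "p \<in> U i"
    show "(f + f') * inverse (\<kappa> a) * y i powi (- k) \<in> stalk Y p"
      using k_subalgebraD(3)[OF stalk_subalgebra[OF *(1)] sectionsD[OF f *] sectionsD[OF f' *]]
      by (simp add: distrib_right)
  qed
qed

text \<open>On the i-th chart \<open>f / y i ^ d\<close> is regular, and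
  \<open>regular_chart\<close> translates this into the condition of \<open>saturated\<close> at
  \<open>y i\<close>.\<close>

lemma sections_saturated:
  assumes "f \<in> sections (\<lambda>_. 1) (int d)"
  shows "f \<in> saturated d"
  unfolding saturated_def
proof (intro CollectI ballI impI)
  fix s assume "s \<in> S" "s \<noteq> 0"
  then obtain i where i: "i \<in> J" "s = y i" by (rule S_cases)
  have "f * y i powi (- int d) \<in> regular Y (U i)"
  proof (rule regular_of_stalks[OF chart_open[OF i(1)]])
    fix p assume p: "p \<in> U i"
    then have "p \<in> points" using chart_subset by blast
    then show "f * y i powi (- int d) \<in> stalk Y p"
      using patch_cover[of p] sectionsD[OF assms _ _ i(1) _ p] by auto
  qed
  then obtain M where M: "f * y i powi (- int d) * y i ^ M \<in> homog S M"
    unfolding regular_chart[OF i(1)] by blast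
  have yi: "y i \<in> homog S 1" using i(1) homog_generator[OF finite_S] by (auto simp: S_def J_def)
  have "(f * y i powi (- int d) * y i ^ M) * y i ^ d \<in> homog S (M + d * 1)"
    by (rule homog_mult[OF M homog_power[OF yi]])
  moreover have "(f * y i powi (- int d) * y i ^ M) * y i ^ d = f * s ^ M"
    using y_nonzero[OF i(1)] by (simp add: i(2) power_int_minus field_simps)
  ultimately show "\<exists>M. f * s ^ M \<in> homog S (d + M)" by (auto simp: add.commute)
qed

text \<open>By compactness finitely many patches cover the chart. The denominators of the
  corresponding \<kappa> a are multiplied, and at each point any other \<kappa> b differs from one
  of these by a unit.\<close>

lemma local_denominator:
  assumes i: "i \<in> J" and \<kappa>: "\<And>a b p. a \<in> idx L \<Longrightarrow> b \<in> idx L \<Longrightarrow> p \<in> patch L a \<Longrightarrow> p \<in> patch L b \<Longrightarrow>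
      \<kappa> a * inverse (\<kappa> b) \<in> stalk Y p" and nz: "\<And>a. a \<in> idx L \<Longrightarrow> \<kappa> a \<noteq> 0"
  shows "\<exists>w\<in>regular Y (U i). w \<noteq> 0 \<and> (\<forall>p\<in>U i. \<forall>a\<in>idx L. p \<in> patch L a \<longrightarrow> w * \<kappa> a \<in> stalk Y p)"
proof -
  have "U i \<subseteq> \<Union>(patch L ` idx L)"
  proof
    fix p assume "p \<in> U i"
    then have "p \<in> points" using chart_subset by blast
    from patch_cover[OF this] show "p \<in> \<Union>(patch L ` idx L)" by blast
  qed
  then obtain \<F> where \<F>: "finite \<F>" "\<F> \<subseteq> patch L ` idx L" "U i \<subseteq> \<Union>\<F>"
    using affine_compact[OF affine_chart[OF i]] patch_open unfolding compactin_def by (metis (no_types, lifting) imageE)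
  obtain I where I: "I \<subseteq> idx L" "finite I" "\<F> = patch L ` I" using finite_subset_image[OF \<F>(1,2)] by blast
  let ?A = "regular Y (U i)"
  note A = regular_subalgebra[OF chart_open[OF i]]
  have "\<forall>a\<in>I. \<exists>h. h \<in> ?A \<and> h \<noteq> 0 \<and> h * \<kappa> a \<in> ?A"
    using affine_fraction[OF affine_chart[OF i]] by blast
  then obtain h where h: "\<forall>a\<in>I. h a \<in> ?A \<and> h a \<noteq> 0 \<and> h a * \<kappa> a \<in> ?A" unfolding bchoice_iff by blast
  have wA: "prod h I \<in> ?A" using h by (intro k_subalgebra_prod[OF A]) auto
  have w\<kappa>: "prod h I * \<kappa> a \<in> ?A" if a: "a \<in> I" for a
  proof -
    have "prod h (I - {a}) * (h a * \<kappa> a) \<in> ?A"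
    proof (rule k_subalgebraD(4)[OF A k_subalgebra_prod[OF A]])
      show "h a * \<kappa> a \<in> ?A" using h a by blast
    qed (use h in auto)
    then show ?thesis using prod.remove[OF I(2) a, of h] by (simp add: mult_ac)
  qed
  have "prod h I * \<kappa> b \<in> stalk Y p" if p: "p \<in> U i" "b \<in> idx L" "p \<in> patch L b" for p b
  proof -
    obtain a where a: "a \<in> I" "p \<in> patch L a" using p(1) \<F>(3) I(3) by auto
    have "p \<in> points" using p(1) chart_subset by blast
    note st = k_subalgebraD(4)[OF stalk_subalgebra[OF this]]
    have aL: "a \<in> idx L" using a I by blast
    have "prod h I * \<kappa> a \<in> stalk Y p"
      using chart_open[OF i] p(1) w\<kappa>[OF a(1)] by (auto intro: regular_stalk)
    note st[OF this \<kappa>[OF p(2) aL p(3) a(2)]]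
    moreover have "prod h I * \<kappa> a * (\<kappa> b * inverse (\<kappa> a)) = prod h I * \<kappa> b"
      using nz[OF aL] by (simp add: field_simps)
    ultimately show ?thesis by (simp only:)
  qed
  moreover have "prod h I \<noteq> 0" using h I(2) by simp
  ultimately show ?thesis using wA by blast
qed

text \<open>Multiplication by w embeds the line bundle described by \<kappa> into O(E). The local
  denominators of all charts are made into forms of degree \<open>M i\<close> and multiplied: on the
  i-th chart the i-th factor clears \<kappa>, and the others are regular after division by powers of
  \<open>y i\<close>.\<close>

lemma denominator:
  assumes \<kappa>: "\<And>a b p. a \<in> idx L \<Longrightarrow> b \<in> idx L \<Longrightarrow> p \<in> patch L a \<Longrightarrow> p \<in> patch L b \<Longrightarrow>
      \<kappa> a * inverse (\<kappa> b) \<in> stalk Y p" and nz: "\<And>a. a \<in> idx L \<Longrightarrow> \<kappa> a \<noteq> 0"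
  shows "\<exists>E\<ge>1. \<exists>w. w \<noteq> 0 \<and> w \<in> sections (\<lambda>a. inverse (\<kappa> a)) (int E)"
proof -
  have "\<forall>i\<in>J. \<exists>w. w \<in> regular Y (U i) \<and> w \<noteq> 0 \<and> (\<forall>p\<in>U i. \<forall>a\<in>idx L. p \<in> patch L a \<longrightarrow> w * \<kappa> a \<in> stalk Y p)"
  proof
    fix i assume i: "i \<in> J"
    have "\<exists>w\<in>regular Y (U i). w \<noteq> 0 \<and> (\<forall>p\<in>U i. \<forall>a\<in>idx L. p \<in> patch L a \<longrightarrow> w * \<kappa> a \<in> stalk Y p)"
      by (rule local_denominator[where \<kappa> = \<kappa>, OF i \<kappa> nz])
    then show "\<exists>w. w \<in> regular Y (U i) \<and> w \<noteq> 0 \<and> (\<forall>p\<in>U i. \<forall>a\<in>idx L. p \<in> patch L a \<longrightarrow> w * \<kappa> a \<in> stalk Y p)"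
      by blast
  qed
  then obtain w where w: "\<forall>i\<in>J. w i \<in> regular Y (U i) \<and> w i \<noteq> 0 \<and>
    (\<forall>p\<in>U i. \<forall>a\<in>idx L. p \<in> patch L a \<longrightarrow> w i * \<kappa> a \<in> stalk Y p)" unfolding bchoice_iff by blast
  have "\<forall>i\<in>J. \<exists>M. w i * y i ^ M \<in> homog S M" using w regular_chart by blast
  then obtain M where M: "\<forall>i\<in>J. w i * y i ^ M i \<in> homog S (M i)" unfolding bchoice_iff by blast
  define W where "W = (\<Prod>i\<in>J. w i * y i ^ M i)"
  have "W \<in> sections (\<lambda>a. inverse (\<kappa> a)) (int (sum M J))"
    unfolding sections_def
  proof (intro CollectI ballI impI)
    fix p a i assume *: "p \<in> points" "a \<in> idx L" "i \<in> J" "p \<in> patch L a" "p \<in> U i"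
    note st = stalk_subalgebra[OF *(1)]
    have yi: "y i \<noteq> 0" by (rule y_nonzero[OF *(3)])
    have factor: "w j * y j ^ M j / y i ^ M j \<in> stalk Y p" if "j \<in> J" for j
    proof -
      have "(w j * y j ^ M j / y i ^ M j) * y i ^ M j \<in> homog S (M j)" using M that yi by simp
      then have "w j * y j ^ M j / y i ^ M j \<in> regular Y (U i)" unfolding regular_chart[OF *(3)] by blast
      then show ?thesis using chart_open[OF *(3)] *(5) by (auto intro: regular_stalk)
    qed
    have "(w i * \<kappa> a) * (\<Prod>j\<in>J - {i}. w j * y j ^ M j / y i ^ M j) \<in> stalk Y p"
    proof (rule k_subalgebraD(4)[OF st _ k_subalgebra_prod[OF st]])
      show "w i * \<kappa> a \<in> stalk Y p" using w * by blast
    qed (use factor in auto)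
    also have "(w i * \<kappa> a) * (\<Prod>j\<in>J - {i}. w j * y j ^ M j / y i ^ M j) =
      \<kappa> a * (\<Prod>j\<in>J. w j * y j ^ M j / y i ^ M j)"
      using yi by (simp add: prod.remove[OF finite_J *(3)] mult_ac)
    also have "(\<Prod>j\<in>J. w j * y j ^ M j / y i ^ M j) = W / y i ^ sum M J"
      by (simp add: W_def prod_dividef power_sum)
    also have "\<kappa> a * (W / y i ^ sum M J) = W * inverse (inverse (\<kappa> a)) * y i powi (- int (sum M J))"
      by (simp only: power_int_minus power_int_of_nat inverse_inverse_eq divide_inverse mult_ac)
    finally show "W * inverse (inverse (\<kappa> a)) * y i powi (- int (sum M J)) \<in> stalk Y p" .
  qed
  \<comment> \<open>The coordinate \<open>y z = 1\<close> is a section of O(1); multiplying by it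
    changes nothing in K but makes E positive.\<close>
  from sections_mult[OF coordinate_section[OF z(1)] this]
  have "W \<in> sections (\<lambda>a. inverse (\<kappa> a)) (int (sum M J + 1))" by (simp add: y_z add.commute)
  moreover have "W \<noteq> 0" unfolding W_def using finite_J w y_nonzero by auto
  ultimately show ?thesis by (intro exI[of _ "sum M J + 1"]) auto
qed

text \<open>This is where normality enters: \<open>q f\<close> satisfies a monic equation over each local ring.\<close>

lemma sections_integral:
  assumes q: "q \<in> sections \<kappa> 0" and p: "\<And>i. i < e \<Longrightarrow> p i \<in> sections \<kappa> 0" and "0 < e"
    and rel: "q * f ^ e = (\<Sum>i<e. p i * f ^ i)" and nz: "\<And>a. a \<in> idx L \<Longrightarrow> \<kappa> a \<noteq> 0"
  shows "q * f \<in> sections \<kappa> 0"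
  unfolding sections_def
proof (intro CollectI ballI impI)
  fix pt a i assume *: "pt \<in> points" "a \<in> idx L" "i \<in> J" "pt \<in> patch L a" "pt \<in> U i"
  let ?R = "stalk Y pt" and ?\<kappa> = "inverse (\<kappa> a)"
  note st = stalk_subalgebra[OF *(1)]
  note R = k_subalgebraD[OF st]
  have q\<kappa>: "q * ?\<kappa> \<in> ?R" using sectionsD[OF q *] by simp
  have p\<kappa>: "p j * ?\<kappa> \<in> ?R" if "j < e" for j using sectionsD[OF p[OF that] *] by simp
  \<comment> \<open>Multiplying the relation by \<open>q ^ (e - 1)\<close> and dividing by
    \<open>\<kappa> a ^ e\<close> gives a monic equation for \<open>q * f / \<kappa> a\<close> with
    these lower coefficients.\<close>
  define c where "c j = - (p j * ?\<kappa> * (q * ?\<kappa>) ^ (e - 1 - j))" for j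
  define P where "P = Polynomial.monom 1 e + (\<Sum>j<e. Polynomial.monom (c j) j)"
  have coeff: "Polynomial.coeff P j = (if j = e then 1 else if j < e then c j else 0)" for j
    unfolding P_def by (auto simp: coeff_sum)
  have "Polynomial.degree P = e"
    by (rule antisym) (auto intro: degree_le le_degree simp: coeff)
  then have "Polynomial.lead_coeff P = 1" by (simp add: coeff)
  moreover have "Polynomial.coeff P j \<in> ?R" for j
  proof -
    have "c j \<in> ?R" if "j < e"
      unfolding c_def by (intro R(5) R(4) p\<kappa> that k_subalgebra_power[OF st] q\<kappa>)
    then show ?thesis unfolding coeff using R(1,2) by simp
  qed
  moreover have "Polynomial.poly P (q * f * ?\<kappa>) = 0"
  proof -
    have e: "e = Suc (e - 1)" using \<open>0 < e\<close> by simp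
    have "(\<Sum>j<e. c j * (q * f * ?\<kappa>) ^ j) = (\<Sum>j<e. - ((q * ?\<kappa>) ^ (e - 1) * ?\<kappa> * (p j * f ^ j)))"
    proof (rule sum.cong[OF refl])
      fix j assume "j \<in> {..<e}"
      then have "(q * ?\<kappa>) ^ (e - 1) = (q * ?\<kappa>) ^ (e - 1 - j) * (q * ?\<kappa>) ^ j"
        by (simp flip: power_add)
      moreover have "(q * f * ?\<kappa>) ^ j = (q * ?\<kappa>) ^ j * f ^ j"
        by (simp only: power_mult_distrib mult_ac)
      ultimately show "c j * (q * f * ?\<kappa>) ^ j = - ((q * ?\<kappa>) ^ (e - 1) * ?\<kappa> * (p j * f ^ j))"
        unfolding c_def by (simp only: mult_ac minus_mult_left[symmetric] minus_mult_right[symmetric])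
    qed
    also have "\<dots> = - ((q * ?\<kappa>) ^ (e - 1) * ?\<kappa> * (q * f ^ e))"
      by (simp only: rel sum_negf sum_distrib_left)
    also have "(q * ?\<kappa>) ^ (e - 1) * ?\<kappa> * (q * f ^ e) = (q * ?\<kappa>) ^ (e - 1) * (q * ?\<kappa>) * f ^ e"
      by (simp only: mult_ac)
    also have "(q * ?\<kappa>) ^ (e - 1) * (q * ?\<kappa>) = (q * ?\<kappa>) ^ e"
      by (subst (2) e) (simp only: power_Suc2)
    also have "(q * ?\<kappa>) ^ e * f ^ e = (q * f * ?\<kappa>) ^ e" by (simp only: power_mult_distrib mult_ac)
    finally show ?thesis by (simp add: P_def poly_sum poly_monom)
  qed
  moreover have "integrally_closed ?R" using normal *(1) by (simp add: normal_scheme_def)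
  ultimately have "q * f * ?\<kappa> \<in> ?R" unfolding integrally_closed_def by blast
  then show "q * f * ?\<kappa> * y i powi (- 0) \<in> ?R" by simp
qed


section \<open>Sections of the powers of L\<close>

abbreviation H :: "nat \<Rightarrow> 'a set" where
  "H m \<equiv> sections (\<lambda>a. g a ^ m) 0"

lemma sections_cong: "(\<And>a. a \<in> idx L \<Longrightarrow> \<kappa> a = \<kappa>' a) \<Longrightarrow> sections \<kappa> k = sections \<kappa>' k"
  by (simp add: sections_def)

lemma H_mult: "f \<in> H m \<Longrightarrow> f' \<in> H m' \<Longrightarrow> f * f' \<in> H (m + m')"
  using sections_mult[of f "\<lambda>a. g a ^ m" 0 f' "\<lambda>a. g a ^ m'" 0] by (simp add: power_add)

lemma one_section: "1 \<in> sections (\<lambda>_. 1) (int k)"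
  using sections_power[OF coordinate_section[OF z(1)], of k] by (simp add: y_z)

lemma sections_prod:
  "finite A \<Longrightarrow> (\<And>j. j \<in> A \<Longrightarrow> f j \<in> H m) \<Longrightarrow> prod f A \<in> H (card A * m)"
proof (induction A rule: finite_induct)
  case empty
  show ?case using one_sections by simp
next
  case (insert j A)
  then show ?case using H_mult[of "f j" m "prod f A" "card A * m"] by simp
qed

text \<open>Powers of one embedding of L into O(E) serve all m at once, so the degree grows linearly
  with m.\<close>

lemma sections_in_saturated:
  "\<exists>E\<ge>1. \<exists>w. w \<noteq> 0 \<and> (\<forall>m. \<forall>f\<in>H m. w ^ m * f \<in> saturated (m * E))"
proof -
  obtain E w where E: "E \<ge> 1" "w \<noteq> 0" "w \<in> sections (\<lambda>a. inverse (g a)) (int E)"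
    using denominator[of g] g_unit g_nonzero by blast
  have "w ^ m * f \<in> saturated (m * E)" if f: "f \<in> H m" for m f
  proof -
    have "w ^ m * f \<in> sections (\<lambda>a. inverse (g a) ^ m * g a ^ m) (int m * int E + 0)"
      by (rule sections_mult[OF sections_power[OF E(3)] f])
    also have "sections (\<lambda>a. inverse (g a) ^ m * g a ^ m) (int m * int E + 0) = sections (\<lambda>_. 1) (int m * int E + 0)"
      by (rule sections_cong) (use g_nonzero in \<open>simp flip: power_mult_distrib\<close>)
    also have "int m * int E + 0 = int (m * E)" by simp
    finally show ?thesis by (rule sections_saturated)
  qed
  then show ?thesis using E by blast
qed

text \<open>Kodaira's lemma: for dimension reasons the coordinate \<open>y j\<close> satisfies an equation with
  coefficients in some \<open>H m\<close>, and normality makes its leading coefficient a denominator of \<open>y j\<close>.\<close>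

lemma section_times_coordinate:
  assumes "\<epsilon> > 0" and large: "\<And>m\<^sub>0. \<exists>m\<ge>m\<^sub>0. \<exists>I\<subseteq>H m. finite I \<and> \<not> lin.dependent I \<and> \<epsilon> * real m ^ n \<le> real (card I)"
  shows "\<exists>m\<ge>1. \<forall>j\<in>{..N}. \<exists>q. q \<noteq> 0 \<and> q \<in> H m \<and> q * y j \<in> H m"
proof -
  obtain E w where E: "E \<ge> 1" "w \<noteq> 0" and w: "\<forall>m. \<forall>f\<in>H m. w ^ m * f \<in> saturated (m * E)"
    using sections_in_saturated by blast
  obtain C where C: "\<And>d. d \<ge> 1 \<Longrightarrow> dim_at_most (saturated d) (C * d ^ n)" using saturated_dim by blast
  \<comment> \<open>With this e, \<open>I \<times> {..e}\<close> outnumbers the dimension of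
    \<open>saturated (m * E + e)\<close>: as m exceeds e, the degree of the powers of the coordinate
    only replaces E by \<open>E + 1\<close>.\<close>
  obtain e :: nat where e: "real C * real (E + 1) ^ n / \<epsilon> < real e" using reals_Archimedean2 by blast
  obtain m I where m: "m \<ge> e + 1" and I: "I \<subseteq> H m" "finite I" "\<not> lin.dependent I" "\<epsilon> * real m ^ n \<le> real (card I)"
    using large by blast
  have "\<exists>q. q \<noteq> 0 \<and> q \<in> H m \<and> q * y j \<in> H m" if j: "j \<le> N" for j
  proof -
    let ?d = "m * E + e"
    define f where "f = (\<lambda>(p, i). p * y j ^ i)"
    have "C * ?d ^ n < card (I \<times> {..e})"
    proof -
      have "real (C * ?d ^ n) \<le> real C * (real m * real (E + 1)) ^ n"
        unfolding of_nat_mult of_nat_power using m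
        by (intro mult_left_mono power_mono) (auto simp: algebra_simps)
      also have "\<dots> = (real C * real (E + 1) ^ n) * real m ^ n" by (simp only: power_mult_distrib mult_ac)
      also have "\<dots> < (\<epsilon> * real (e + 1)) * real m ^ n"
        using e \<open>\<epsilon> > 0\<close> m by (intro mult_strict_right_mono) (auto simp: field_simps intro: less_trans)
      also have "\<dots> \<le> real (card I) * real (e + 1)"
        using mult_right_mono[OF I(4), of "real (e + 1)"] by (simp add: mult_ac)
      also have "\<dots> = real (card (I \<times> {..e}))" by (simp add: card_cartesian_product algebra_simps)
      finally show ?thesis by linarith
    qed
    moreover have "w ^ m * f pi \<in> saturated ?d" if "pi \<in> I \<times> {..e}" for pi
    proof -
      obtain p i where pi0: "pi = (p, i)" by (cases pi)
      with that have pi: "p \<in> I" "i \<le> e" by auto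
      have "y j \<in> homog S 1" using j homog_generator[OF finite_S] by (auto simp: S_def)
      then have "y j ^ i \<in> saturated i" using homog_power[of "y j" S 1 i] homog_saturated by auto
      moreover have "1 \<in> saturated (e - i)" using homog_1[OF finite_S one_S] homog_saturated by blast
      ultimately have "w ^ m * p * y j ^ i * 1 \<in> saturated (m * E + i + (e - i))"
        using w I(1) pi by (intro saturated_mult) auto
      then show ?thesis using pi by (simp add: pi0 f_def mult_ac)
    qed
    moreover have "?d \<ge> 1" using m E(1) by (simp add: Suc_leI)
    moreover have "finite (I \<times> {..e})" using I(2) by simp
    ultimately obtain u where u: "\<exists>pi\<in>I \<times> {..e}. u pi \<noteq> 0" "(\<Sum>pi\<in>I \<times> {..e}. \<iota> (u pi) * f pi) = 0"
      using dim_at_most_relation_scaled[OF C[of ?d], of "I \<times> {..e}" "w ^ m" f] E(2) by auto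
    define P where "P i = (\<Sum>p\<in>I. \<iota> (u (p, i)) * p)" for i
    have PH: "P i \<in> H m" for i
      unfolding P_def using I(1)
      by (intro lin.subspace_sum[OF sections_subspace] lin.subspace_scale[OF sections_subspace]) auto
    have "(\<Sum>i\<le>e. P i * y j ^ i) = (\<Sum>i\<le>e. \<Sum>p\<in>I. \<iota> (u (p, i)) * f (p, i))"
      by (simp add: P_def f_def sum_distrib_right sum_distrib_left mult_ac)
    also have "\<dots> = (\<Sum>p\<in>I. \<Sum>i\<le>e. \<iota> (u (p, i)) * f (p, i))" by (rule sum.swap)
    also have "\<dots> = 0" using u(2) by (simp add: sum.cartesian_product)
    finally have rel: "(\<Sum>i\<le>e. P i * y j ^ i) = 0" .
    obtain p i where pi: "p \<in> I" "i \<le> e" "u (p, i) \<noteq> 0" using u(1) by auto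
    have "P i \<noteq> 0"
    proof
      assume "P i = 0"
      then have "lin.dependent I"
        unfolding lin.dependent_finite[OF I(2)] P_def using pi by (intro exI[of _ "\<lambda>p. u (p, i)"]) auto
      then show False using I(3) by simp
    qed
    from leading_coefficient[OF rel pi(2) this] obtain e' where
      e': "0 < e'" "P e' \<noteq> 0" "P e' * y j ^ e' = (\<Sum>i<e'. - P i * y j ^ i)" by metis
    have "P e' * y j \<in> H m"
      by (rule sections_integral[OF PH _ e'(1,3)])
         (use lin.subspace_neg[OF sections_subspace PH] g_nonzero in auto)
    then show ?thesis using PH e'(2) by blast
  qed
  then show ?thesis using m by (intro exI[of _ m]) auto
qed

text \<open>The product of the denominators of all coordinates is a denominator for each of them.
  That all its products with coordinates are sections of a multiple of L means that it is a section
  of this multiple minus the hyperplane section.\<close>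

lemma kodaira:
  assumes "\<epsilon> > 0" and large: "\<And>m\<^sub>0. \<exists>m\<ge>m\<^sub>0. \<exists>I\<subseteq>H m. finite I \<and> \<not> lin.dependent I \<and> \<epsilon> * real m ^ n \<le> real (card I)"
  shows "\<exists>m\<ge>1. \<exists>P. P \<noteq> 0 \<and> P \<in> sections (\<lambda>a. g a ^ m) (- 1)"
proof -
  obtain m where m: "m \<ge> 1" "\<forall>j\<in>{..N}. \<exists>q. q \<noteq> 0 \<and> q \<in> H m \<and> q * y j \<in> H m"
    using section_times_coordinate[OF assms] by blast
  then obtain q where q: "\<forall>j\<in>{..N}. q j \<noteq> 0 \<and> q j \<in> H m \<and> q j * y j \<in> H m" unfolding bchoice_iff by blast
  let ?M = "card {..N} * m" and ?P = "prod q {..N}"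
  have Py: "?P * y j \<in> H ?M" if "j \<le> N" for j
  proof -
    have "(\<Prod>k\<in>{..N}. if k = j then q k * y k else q k) \<in> H ?M"
      using q by (intro sections_prod) auto
    moreover have "(\<Prod>k\<in>{..N}. if k = j then q k * y k else q k) = (q j * y j) * prod q ({..N} - {j})"
      using that by (subst prod.remove[of _ j]) (auto intro!: prod.cong)
    moreover have "?P = q j * prod q ({..N} - {j})" using that by (intro prod.remove) auto
    ultimately show ?thesis by (simp add: mult_ac)
  qed
  have "?P \<in> sections (\<lambda>a. g a ^ ?M) (- 1)"
    unfolding sections_def
  proof (intro CollectI ballI impI)
    fix p a i assume *: "p \<in> points" "a \<in> idx L" "i \<in> J" "p \<in> patch L a" "p \<in> U i"
    have "i \<le> N" using *(3) by (simp add: J_def)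
    from sectionsD[OF Py[OF this] *] show "?P * inverse (g a ^ ?M) * y i powi (- (- 1)) \<in> stalk Y p"
      by (simp add: mult_ac)
  qed
  moreover have "?P \<noteq> 0" using q by simp
  moreover have "?M \<ge> 1" using m(1) by simp
  ultimately show ?thesis by blast
qed

text \<open>Write m = j + M q with j < M. With D the hyperplane section, the j-th power of a section
  u of L + E D times the q-th power of the section of M L - D from \<open>kodaira\<close> is a
  section of m L + (j E - q) D; for q \<ge> j E the missing multiple of D is supplied by the section
  1.\<close>

lemma eventually_sections:
  assumes "\<epsilon> > 0" and large: "\<And>m\<^sub>0. \<exists>m\<ge>m\<^sub>0. \<exists>I\<subseteq>H m. finite I \<and> \<not> lin.dependent I \<and> \<epsilon> * real m ^ n \<le> real (card I)"
  shows "\<exists>m\<^sub>0\<ge>1. \<forall>m\<ge>m\<^sub>0. \<exists>f\<in>H m. f \<noteq> 0"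
proof -
  obtain M P where P: "M \<ge> 1" "P \<noteq> 0" "P \<in> sections (\<lambda>a. g a ^ M) (- 1)"
    using kodaira[OF assms] by blast
  have unit: "inverse (g a) * inverse (inverse (g b)) \<in> stalk Y p"
    if "a \<in> idx L" "b \<in> idx L" "p \<in> patch L a" "p \<in> patch L b" for a b p
    using g_unit[OF that(2,1,4,3)] by (simp add: mult.commute)
  have nz: "inverse (g a) \<noteq> 0" if "a \<in> idx L" for a using g_nonzero[OF that] by simp
  obtain E u where u: "E \<ge> 1" "u \<noteq> 0" "u \<in> sections (\<lambda>a. inverse (inverse (g a))) (int E)"
    using denominator[where \<kappa> = "\<lambda>a. inverse (g a)", OF unit nz] by blast
  \<comment> \<open>The threshold forces \<open>q \<ge> M * E\<close>, which is at least
    \<open>j * E\<close> for every remainder j.\<close>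
  have "\<exists>f\<in>H m. f \<noteq> 0" if m: "m \<ge> M * (M * E)" for m
  proof -
    define j q where "j = m mod M" and "q = m div M"
    have jM: "j < M" using P(1) by (simp add: j_def)
    have "M * E \<le> q" using m P(1) by (simp add: q_def less_eq_div_iff_mult_less_eq mult.commute)
    then have jq: "j * E \<le> q" using mult_le_mono1[of j M E] jM by linarith
    have "u ^ j * P ^ q * 1 \<in> sections (\<lambda>a. inverse (inverse (g a)) ^ j * (g a ^ M) ^ q * 1)
        (int j * int E + int q * - 1 + int (q - j * E))"
      by (intro sections_mult sections_power u(3) P(3) one_section)
    also have "int j * int E + int q * - 1 + int (q - j * E) = 0" using jq by (simp add: of_nat_diff)
    also have "sections (\<lambda>a. inverse (inverse (g a)) ^ j * (g a ^ M) ^ q * 1) 0 = H (j + M * q)"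
      by (rule sections_cong) (simp add: power_add power_mult)
    also have "j + M * q = m" by (simp add: j_def q_def)
    finally show ?thesis using u(2) P(2) by (intro bexI[of _ "u ^ j * P ^ q * 1"]) auto
  qed
  then show ?thesis using P(1) u(1) by (intro exI[of _ "M * (M * E)"]) auto
qed

section \<open>Comparison with \<open>global_sections\<close>, \<open>h0\<close> and
  \<open>big\<close>\<close>

lemma idx_tensor [simp]: "idx (tensor_power m L) = idx L" "patch (tensor_power m L) = patch L"
  "transition (tensor_power m L) a b = transition L a b ^ m"
  by (simp_all add: tensor_power_def)

lemma global_sectionsD:
  assumes "s \<in> global_sections Y (tensor_power m L)"
  shows "s base \<in> H m" "a \<in> idx L \<Longrightarrow> s a = s base * inverse (g a ^ m)" "a \<notin> idx L \<Longrightarrow> s a = 0"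
proof -
  have 1: "\<forall>i\<in>idx L. s i \<in> regular Y (patch L i)"
    and 2: "\<forall>i\<in>idx L. \<forall>j\<in>idx L. s i = transition L i j ^ m * s j"
    and 3: "\<forall>i. i \<notin> idx L \<longrightarrow> s i = 0"
    using assms unfolding global_sections_def mem_Collect_eq idx_tensor by blast+
  have s: "a \<in> idx L \<Longrightarrow> s a \<in> regular Y (patch L a)" "a \<in> idx L \<Longrightarrow> s base = g a ^ m * s a"
    "a \<notin> idx L \<Longrightarrow> s a = 0" for a
    using 1 2[rule_format, OF base] 3 unfolding g_def by blast+
  show eq: "s a = s base * inverse (g a ^ m)" if "a \<in> idx L" for a
    using s(2)[OF that] g_nonzero[OF that] by simp
  show "a \<notin> idx L \<Longrightarrow> s a = 0" by (rule s(3))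
  show "s base \<in> H m"
    unfolding sections_def
  proof (intro CollectI ballI impI)
    fix p a i assume *: "p \<in> points" "a \<in> idx L" "i \<in> J" "p \<in> patch L a" "p \<in> U i"
    have "s a \<in> stalk Y p" using s(1)[OF *(2)] patch_open[OF *(2)] *(4) by (auto intro: regular_stalk)
    then show "s base * inverse (g a ^ m) * y i powi (- 0) \<in> stalk Y p" using eq[OF *(2)] by simp
  qed
qed

lemma global_sectionsI:
  assumes f: "f \<in> H m"
  shows "(\<lambda>a. if a \<in> idx L then f * inverse (g a ^ m) else 0) \<in> global_sections Y (tensor_power m L)"
  unfolding global_sections_def
proof (intro CollectI conjI ballI allI impI)
  fix a assume a: "a \<in> idx (tensor_power m L)"
  then have a': "a \<in> idx L" by simp
  have "f * inverse (g a ^ m) \<in> regular Y (patch L a)"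
  proof (rule regular_of_stalks[OF patch_open[OF a']])
    fix p assume p: "p \<in> patch L a"
    have pp: "p \<in> points" using patch_open[OF a'] p openin_subset by blast
    obtain i where i: "i \<in> J" "p \<in> U i" using chart_cover[OF pp] by blast
    show "f * inverse (g a ^ m) \<in> stalk Y p" using sectionsD[OF f pp a' i(1) p i(2)] by simp
  qed
  then show "(if a \<in> idx L then f * inverse (g a ^ m) else 0) \<in> regular Y (patch (tensor_power m L) a)"
    using a by simp
  fix b assume b: "b \<in> idx (tensor_power m L)"
  have "g b ^ m = g a ^ m * transition L a b ^ m"
    using g_ratio[of b a] a b by (simp add: power_mult_distrib)
  then have "inverse (g a ^ m) = transition L a b ^ m * inverse (g b ^ m)"
    using g_nonzero transition_nonzero a b by (simp add: field_simps)
  then show "(if a \<in> idx L then f * inverse (g a ^ m) else 0) =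
      transition (tensor_power m L) a b * (if b \<in> idx L then f * inverse (g b ^ m) else 0)"
    using a b by (simp add: mult_ac)
qed simp

lemma global_sections_eq_zero:
  assumes s: "s \<in> global_sections Y (tensor_power m L)"
  shows "s = 0 \<longleftrightarrow> s base = 0"
proof
  show "s = 0" if 0: "s base = 0"
  proof
    fix a show "s a = 0 a"
      using global_sectionsD(2,3)[OF s, of a] 0 by (cases "a \<in> idx L") auto
  qed
qed simp

lemma image_global_sections:
  "(\<lambda>s. s base) ` (global_sections Y (tensor_power m L) - {0}) = H m - {0}"
proof (intro equalityI subsetI)
  fix f assume "f \<in> (\<lambda>s. s base) ` (global_sections Y (tensor_power m L) - {0})"
  then show "f \<in> H m - {0}" using global_sectionsD(1) global_sections_eq_zero by auto
next
  fix f assume f: "f \<in> H m - {0}"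
  let ?s = "\<lambda>a. if a \<in> idx L then f * inverse (g a ^ m) else 0"
  have "?s base = f" using base by (simp add: g_base)
  moreover have s: "?s \<in> global_sections Y (tensor_power m L)" using f by (intro global_sectionsI) simp
  moreover have "?s \<noteq> 0"
  proof
    assume "?s = 0"
    then have "?s base = 0" by (rule fun_cong[where g = 0, simplified zero_fun_apply])
    then show False using \<open>?s base = f\<close> f by simp
  qed
  ultimately show "f \<in> (\<lambda>s. s base) ` (global_sections Y (tensor_power m L) - {0})"
    by (intro image_eqI[of _ _ ?s]) auto
qed

text \<open>The component at \<open>base\<close> determines a section linearly, so a basis is mapped
  to an independent set. Positivity of \<open>h0\<close> excludes an infinite basis, whose
  \<open>card\<close> would be 0.\<close>

lemma h0_independent:
  assumes "h0 \<iota> Y (tensor_power m L) > 0"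
  shows "\<exists>I\<subseteq>H m. finite I \<and> \<not> lin.dependent I \<and> card I = h0 \<iota> Y (tensor_power m L)"
proof -
  interpret FS: vector_space "\<lambda>(c::'k) (s::'i \<Rightarrow> 'a). (\<lambda>i. \<iota> c * s i)"
    by unfold_locales (auto simp: \<iota>_add \<iota>_mult algebra_simps fun_eq_iff)
  let ?G = "global_sections Y (tensor_power m L)"
  obtain B where B: "B \<subseteq> ?G" "FS.independent B" "?G \<subseteq> FS.span B" "card B = FS.dim ?G"
    by (rule FS.basis_exists)
  then have cB: "card B = h0 \<iota> Y (tensor_power m L)" by (simp add: h0_def)
  have fin: "finite B" by (rule card_ge_0_finite) (use assms cB in simp)
  have sum_apply: "(\<Sum>s\<in>B'. F s) a = (\<Sum>s\<in>B'. F s a)" if "finite B'" for F :: "('i \<Rightarrow> 'a) \<Rightarrow> 'i \<Rightarrow> 'a" and B' a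
    using that by (induction B' rule: finite_induct) auto
  have inj: "inj_on (\<lambda>s. s base) B"
  proof (rule inj_onI)
    fix s t assume st: "s \<in> B" "t \<in> B" "s base = t base"
    show "s = t"
    proof
      have G: "s \<in> ?G" "t \<in> ?G" using st(1,2) B(1) by auto
      fix a show "s a = t a"
        using global_sectionsD(2,3)[OF G(1), of a] global_sectionsD(2,3)[OF G(2), of a] st(3)
        by (cases "a \<in> idx L") auto
    qed
  qed
  have "\<not> lin.dependent ((\<lambda>s. s base) ` B)"
  proof
    assume "lin.dependent ((\<lambda>s. s base) ` B)"
    then obtain u where u: "\<exists>v\<in>(\<lambda>s. s base) ` B. u v \<noteq> 0" "(\<Sum>v\<in>(\<lambda>s. s base) ` B. \<iota> (u v) * v) = 0"
      unfolding lin.dependent_finite[OF finite_imageI[OF fin]] by (elim exE conjE)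
    have 0: "(\<Sum>s\<in>B. \<iota> (u (s base)) * s base) = 0" using u(2) inj by (simp add: sum.reindex)
    have "(\<Sum>s\<in>B. (\<lambda>i. \<iota> (u (s base)) * s i)) = 0"
    proof
      fix a
      show "(\<Sum>s\<in>B. (\<lambda>i. \<iota> (u (s base)) * s i)) a = 0 a"
      proof (cases "a \<in> idx L")
        case True
        have "(\<Sum>s\<in>B. \<iota> (u (s base)) * s a) = (\<Sum>s\<in>B. \<iota> (u (s base)) * s base) * inverse (g a ^ m)"
          unfolding sum_distrib_right using global_sectionsD(2)[OF _ True] B(1)
          by (intro sum.cong) (auto simp: mult.assoc)
        then show ?thesis by (simp add: sum_apply[OF fin] 0)
      next
        case False
        have "s a = 0" if "s \<in> B" for s using global_sectionsD(3)[OF _ False, of s m] that B(1) by blast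
        then have "(\<Sum>s\<in>B. \<iota> (u (s base)) * s a) = 0" by (intro sum.neutral) simp
        then show ?thesis by (simp add: sum_apply[OF fin])
      qed
    qed
    then have "FS.dependent B"
      unfolding FS.dependent_finite[OF fin] using u(1) by (intro exI[of _ "\<lambda>s. u (s base)"]) auto
    then show False using B(2) by simp
  qed
  moreover have "(\<lambda>s. s base) ` B \<subseteq> H m" using B(1) global_sectionsD(1) by blast
  ultimately show ?thesis
    using fin cB card_image[OF inj] by (intro exI[of _ "(\<lambda>s. s base) ` B"]) auto
qed

lemma big_sections:
  assumes "big \<iota> Y L"
  shows "\<exists>\<epsilon>>0. \<forall>m\<^sub>0. \<exists>m\<ge>m\<^sub>0. \<exists>I\<subseteq>H m. finite I \<and> \<not> lin.dependent I \<and> \<epsilon> * real m ^ n \<le> real (card I)"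
proof -
  define h where "h m = h0 \<iota> Y (tensor_power m L)" for m
  let ?X = "\<lambda>m. ereal (fact n * real (h m) / real m ^ n)"
  have "0 < limsup ?X" using assms by (simp add: big_def volume_def Let_def n_def h_def)
  then obtain c where c: "0 < ereal c" "ereal c < limsup ?X" using ereal_dense2 by blast
  have "\<exists>m\<ge>m\<^sub>0. \<exists>I\<subseteq>H m. finite I \<and> \<not> lin.dependent I \<and> c / fact n * real m ^ n \<le> real (card I)" for m\<^sub>0
  proof -
    \<comment> \<open>The shift by 1 keeps m positive, so that the division by
      \<open>real m ^ n\<close> can be undone.\<close>
    have "\<exists>m\<ge>m\<^sub>0 + 1. ereal c < ?X m"
    proof (rule ccontr)
      assume "\<not> ?thesis"
      then have "eventually (\<lambda>m. ?X m \<le> ereal c) sequentially"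
        unfolding eventually_sequentially by (intro exI[of _ "m\<^sub>0 + 1"]) (auto simp: not_less)
      then have "limsup ?X \<le> ereal c" by (rule Limsup_bounded)
      then show False using c(2) by simp
    qed
    then obtain m where m: "m \<ge> m\<^sub>0 + 1" "c < fact n * real (h m) / real m ^ n" by auto
    then have "c * real m ^ n < fact n * real (h m)" by (simp add: pos_less_divide_eq)
    then have *: "c / fact n * real m ^ n \<le> real (h m)" by (simp add: field_simps)
    moreover have "0 < c / fact n * real m ^ n" using c(1) m(1) by simp
    ultimately have "h m > 0" by linarith
    then obtain I where "I \<subseteq> H m" "finite I" "\<not> lin.dependent I" "card I = h m"
      using h0_independent[of m] unfolding h_def by blast
    then show ?thesis using * m(1) by (intro exI[of _ m] conjI exI[of _ I]) auto
  qed
  then show ?thesis using c(1) by (intro exI[of _ "c / fact n"]) auto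
qed

lemma value_bound:
  assumes "abhyankar \<iota> v"
  shows "\<exists>B. \<forall>m\<ge>1. \<forall>f\<in>H m. f \<noteq> 0 \<longrightarrow> v f \<le> B * real m"
proof -
  interpret real_valued \<iota> v
    by unfold_locales (use assms in \<open>simp add: abhyankar_def\<close>)
  obtain E w where E: "E \<ge> 1" "w \<noteq> 0" and w: "\<forall>m. \<forall>f\<in>H m. w ^ m * f \<in> saturated (m * E)"
    using sections_in_saturated by blast
  obtain B where B: "\<forall>d\<ge>1. \<forall>z\<in>saturated d. z \<noteq> 0 \<longrightarrow> v z \<le> B * real d"
    using abhyankar_linear_growth[OF assms] by blast
  have "v f \<le> (B * real E - v w) * real m" if "m \<ge> 1" "f \<in> H m" "f \<noteq> 0" for m f
  proof -
    have "m * E \<ge> 1" using that(1) E(1) by simp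
    moreover have "w ^ m * f \<in> saturated (m * E)" using w that(2) by blast
    moreover have "w ^ m * f \<noteq> 0" using that(3) E(2) by simp
    ultimately have "v (w ^ m * f) \<le> B * real (m * E)" using B by blast
    then show ?thesis using that(3) E(2) by (simp add: v_mult v_power algebra_simps)
  qed
  then show ?thesis by blast
qed

end

text \<open>Fekete's lemma with superadditivity only from \<open>m\<^sub>0\<close> on. To compare a
  large m with a fixed k, the remainder modulo k is taken between \<open>m\<^sub>0\<close> and
  \<open>m\<^sub>0 + k\<close>, where superadditivity holds and only finitely many values of a
  occur.\<close>

lemma superadditive_limit:
  fixes a :: "nat \<Rightarrow> real"
  assumes m0: "m\<^sub>0 \<ge> 1" and super: "\<And>m m'. m \<ge> m\<^sub>0 \<Longrightarrow> m' \<ge> m\<^sub>0 \<Longrightarrow> a m + a m' \<le> a (m + m')"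
    and bound: "\<And>m. m \<ge> m\<^sub>0 \<Longrightarrow> a m \<le> B * real m"
  shows "\<exists>l. (\<lambda>m. a m / real m) \<longlonglongrightarrow> l"
proof -
  define l where "l = (SUP m\<in>{m\<^sub>0..}. a m / real m)"
  have bdd: "bdd_above ((\<lambda>m. a m / real m) ` {m\<^sub>0..})"
    using bound m0 by (intro bdd_aboveI2[of _ _ B]) (auto simp: field_simps)
  have upper: "a m / real m \<le> l" if "m \<ge> m\<^sub>0" for m
    unfolding l_def using that by (intro cSUP_upper bdd) auto
  have mult: "real q * a k + a r \<le> a (q * k + r)" if "k \<ge> m\<^sub>0" "r \<ge> m\<^sub>0" for q k r
  proof (induction q)
    case (Suc q)
    have "a k + a (q * k + r) \<le> a (k + (q * k + r))" using that by (intro super) auto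
    then show ?case using Suc by (simp add: algebra_simps)
  qed simp
  have "(\<lambda>m. a m / real m) \<longlonglongrightarrow> l"
  proof (rule LIMSEQ_I)
    fix \<epsilon> :: real assume "\<epsilon> > 0"
    then obtain k where k: "k \<ge> m\<^sub>0" "l - \<epsilon> / 2 < a k / real k"
      using less_cSUP_iff[OF _ bdd, of "l - \<epsilon> / 2"] unfolding l_def[symmetric] by auto
    define t where "t = a k / real k"
    define c where "c = (\<Sum>r\<in>{m\<^sub>0..<m\<^sub>0 + k}. \<bar>a r\<bar>)"
    \<comment> \<open>Bounds the error due to the remainder r: the term \<open>t * r\<close>, of
      unknown sign, and the value of a at r.\<close>
    define D where "D = \<bar>t\<bar> * real (m\<^sub>0 + k) + c"
    have kpos: "k > 0" using k m0 by simp
    have lower: "t - D / real m \<le> a m / real m" if m: "m \<ge> m\<^sub>0" for m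
    proof -
      define q r where "q = (m - m\<^sub>0) div k" and "r = m\<^sub>0 + (m - m\<^sub>0) mod k"
      have qr: "q * k + r = m" using m unfolding q_def r_def
        by (metis add.assoc add.commute div_mult_mod_eq le_add_diff_inverse)
      have r: "m\<^sub>0 \<le> r" "r < m\<^sub>0 + k" using kpos by (auto simp: r_def)
      have "\<bar>a r\<bar> \<le> c" unfolding c_def using r by (intro member_le_sum) auto
      then have "real q * a k - c \<le> a m" using mult[OF k(1) r(1), of q] qr by simp
      moreover have "real q * a k = t * real (q * k)" using kpos by (simp add: t_def)
      moreover have "t * real (q * k) = t * real m - t * real r"
      proof -
        have "real (q * k) = real m - real r" using qr by linarith
        then show ?thesis by (simp only: right_diff_distrib)
      qed
      moreover have "t * real r \<le> \<bar>t\<bar> * real (m\<^sub>0 + k)" using r by (intro mult_mono) auto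
      ultimately have "t * real m - D \<le> a m" unfolding D_def by linarith
      then show ?thesis using m m0 by (simp add: field_simps)
    qed
    obtain m\<^sub>1 :: nat where m1: "2 * \<bar>D\<bar> / \<epsilon> < real m\<^sub>1" using reals_Archimedean2 by blast
    show "\<exists>no. \<forall>m\<ge>no. norm (a m / real m - l) < \<epsilon>"
    proof (intro exI[of _ "m\<^sub>0 + m\<^sub>1"] allI impI)
      fix m assume m: "m \<ge> m\<^sub>0 + m\<^sub>1"
      then have mpos: "real m > 0" using m0 by simp
      have "2 * \<bar>D\<bar> / \<epsilon> < real m" using m1 m by linarith
      then have "2 * \<bar>D\<bar> < \<epsilon> * real m" using \<open>\<epsilon> > 0\<close> by (simp add: field_simps)
      then have "D / real m < \<epsilon> / 2" using mpos by (simp add: field_simps)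
      then show "norm (a m / real m - l) < \<epsilon>"
        using lower[of m] upper[of m] m k(2) \<open>\<epsilon> > 0\<close> unfolding t_def real_norm_def by linarith
    qed
  qed
  then show ?thesis by blast
qed

text \<open>\<open>a_max_asymptotic\<close> is a \<open>lim\<close>, whose value is unspecified for
  divergent sequences. A bound on the quotients would therefore not suffice; convergence to a real
  number is proved.\<close>

theorem proposition2p12:
  fixes \<iota> :: "'k::alg_closed_field \<Rightarrow> 'a::field"
    and v :: "'a \<Rightarrow> real"
    and Y :: "('p, 'a) ringed_space"
    and L :: "('i, 'p, 'a) line_bundle"
  assumes "field_extension \<iota>"
    and "abhyankar \<iota> v"
    and "normal_projective_model \<iota> Y"
    and "is_line_bundle Y L"
    and "big \<iota> Y L"
  shows "a_max_asymptotic Y L v < \<infinity>"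
proof -
  have scheme: "integral_scheme \<iota> Y" and normal: "normal_scheme Y" and "projective \<iota> Y"
    using assms(3) by (auto simp: normal_projective_model_def algebraic_variety_def)
  then obtain N x where imm: "closed_immersion_into_projective_space \<iota> Y N x" by (auto simp: projective_def)
  have ne: "topspace (space_of Y) \<noteq> {}" using scheme by (simp add: integral_scheme_def)
  then obtain p where p: "p \<in> topspace (space_of Y)" by blast
  have "p \<in> (\<Union>i\<le>N. chart Y N x i)" using imm p by (simp add: closed_immersion_into_projective_space_def)
  then obtain z where z: "z \<le> N" "x z \<noteq> 0" by (auto simp: chart_def split: if_splits)
  have "(\<Union>i\<in>idx L. patch L i) = topspace (space_of Y)" using assms(4) unfolding is_line_bundle_def by blast
  then have "idx L \<noteq> {}" using ne by (metis UN_empty)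
  then obtain i\<^sub>1 where i\<^sub>1: "i\<^sub>1 \<in> idx L" by blast
  \<comment> \<open>The index at which \<open>section_value\<close> evaluates a section, the same
    for all powers of L. Taking it as \<open>base\<close> makes the value of s equal to
    \<open>v (s base)\<close>.\<close>
  define i\<^sub>0 where "i\<^sub>0 = (SOME i. i \<in> idx L \<and> center Y v \<in> patch L i)"
  define base where "base = (if i\<^sub>0 \<in> idx L then i\<^sub>0 else i\<^sub>1)"
  interpret bundle_model \<iota> Y N x z L base
    by unfold_locales (use assms(1,4) scheme normal imm z i\<^sub>1 in \<open>auto simp: base_def\<close>)
  interpret real_valued \<iota> v
    by unfold_locales (use assms(2) in \<open>simp add: abhyankar_def\<close>)
  obtain m\<^sub>0 where m0: "m\<^sub>0 \<ge> 1" and sec: "\<forall>m\<ge>m\<^sub>0. \<exists>f\<in>H m. f \<noteq> 0"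
  proof -
    obtain \<epsilon> where \<epsilon>: "\<epsilon> > 0" "\<forall>m\<^sub>0. \<exists>m\<ge>m\<^sub>0. \<exists>I\<subseteq>H m. finite I \<and> \<not> lin.dependent I \<and> \<epsilon> * real m ^ n \<le> real (card I)"
      using big_sections[OF assms(5)] by blast
    show thesis using eventually_sections[OF \<epsilon>(1) spec[OF \<epsilon>(2)]] that by blast
  qed
  let ?G = "\<lambda>m. global_sections Y (tensor_power m L)"
  have sval: "section_value Y (tensor_power m L) v s = v (s i\<^sub>0)" for m s
    by (simp add: section_value_def i\<^sub>0_def)
  have "\<exists>a l. (\<forall>m\<ge>m\<^sub>0. a_max Y (tensor_power m L) v = ereal (a m)) \<and> (\<lambda>m. a m / real m) \<longlonglongrightarrow> l"
  proof (cases "i\<^sub>0 \<in> idx L")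
    case True
    then have o: "base = i\<^sub>0" by (simp add: base_def)
    obtain B where B: "\<forall>m\<ge>1. \<forall>f\<in>H m. f \<noteq> 0 \<longrightarrow> v f \<le> B * real m" using value_bound[OF assms(2)] by blast
    define a where "a m = (SUP f\<in>H m - {0}. v f)" for m
    have ne: "H m - {0} \<noteq> {}" if "m \<ge> m\<^sub>0" for m using sec that by blast
    have vB: "v f \<le> B * real m" if "f \<in> H m - {0}" "m \<ge> m\<^sub>0" for f m using B that m0 by simp
    have bdd: "bdd_above (v ` (H m - {0}))" if "m \<ge> m\<^sub>0" for m
      using vB that by (intro bdd_aboveI2) blast
    have "a_max Y (tensor_power m L) v = ereal (a m)" if m: "m \<ge> m\<^sub>0" for m
    proof -
      have "a_max Y (tensor_power m L) v = (SUP f\<in>(\<lambda>s. s base) ` (?G m - {0}). ereal (v f))"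
        by (simp add: a_max_def sval o image_image)
      also have "\<dots> = ereal (a m)"
        unfolding image_global_sections a_def
      proof (rule SUP_eqI)
        fix f assume "f \<in> H m - {0}"
        then show "ereal (v f) \<le> ereal (SUP f\<in>H m - {0}. v f)" using cSUP_upper[OF _ bdd[OF m]] by simp
      next
        fix y assume y: "\<And>f. f \<in> H m - {0} \<Longrightarrow> ereal (v f) \<le> y"
        show "ereal (SUP f\<in>H m - {0}. v f) \<le> y"
        proof (cases y)
          case (real r)
          have "(SUP f\<in>H m - {0}. v f) \<le> r" by (rule cSUP_least[OF ne[OF m]]) (use y real in force)
          then show ?thesis using real by simp
        next
          case MInf
          then show ?thesis using y ne[OF m] by fastforce
        qed simp
      qed
      finally show ?thesis .
    qed
    moreover have "\<exists>l. (\<lambda>m. a m / real m) \<longlonglongrightarrow> l"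
    proof (rule superadditive_limit[OF m0])
      show "a m \<le> B * real m" if "m \<ge> m\<^sub>0" for m
        unfolding a_def using vB that by (intro cSUP_least ne) auto
      fix m m' assume m: "m \<ge> m\<^sub>0" "m' \<ge> m\<^sub>0"
      have sum: "v f + v f' \<le> a (m + m')" if "f \<in> H m - {0}" "f' \<in> H m' - {0}" for f f'
      proof -
        have "v (f * f') \<le> a (m + m')"
          unfolding a_def using H_mult[of f m f' m'] that m by (intro cSUP_upper bdd) auto
        then show ?thesis using that by (simp add: v_mult)
      qed
      have "a m \<le> a (m + m') - v f'" if "f' \<in> H m' - {0}" for f'
        unfolding a_def[of m]
      proof (rule cSUP_least[OF ne[OF m(1)]])
        fix f assume "f \<in> H m - {0}"
        from sum[OF this that] show "v f \<le> a (m + m') - v f'" by simp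
      qed
      then have "a m' \<le> a (m + m') - a m"
        unfolding a_def[of m'] by (intro cSUP_least ne m(2)) (simp add: algebra_simps)
      then show "a m + a m' \<le> a (m + m')" by simp
    qed
    ultimately show ?thesis by blast
  next
    case False
    \<comment> \<open>If no patch contained \<open>center Y v\<close>, the choice operator could return an index outside \<open>idx L\<close>, where
      all sections are \<open>0\<close>; treating this junk case makes the existence of the center unnecessary.\<close>
    have "a_max Y (tensor_power m L) v = ereal (v 0)" if m: "m \<ge> m\<^sub>0" for m
    proof -
      have "H m - {0} \<noteq> {}" using sec m by blast
      then have "?G m - {0} \<noteq> {}" unfolding image_global_sections[of m, symmetric] by simp
      moreover have "section_value Y (tensor_power m L) v s = v 0" if "s \<in> ?G m - {0}" for s
        using global_sectionsD(3)[of s m i\<^sub>0] that False by (simp add: sval)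
      ultimately show ?thesis by (simp add: a_max_def cong: SUP_cong_simp)
    qed
    moreover have "(\<lambda>m. v 0 / real m) \<longlonglongrightarrow> 0" by (rule lim_const_over_n)
    ultimately show ?thesis by (intro exI[of _ "\<lambda>_. v 0"] exI[of _ 0]) auto
  qed
  then obtain a l where a: "\<forall>m\<ge>m\<^sub>0. a_max Y (tensor_power m L) v = ereal (a m)" and l: "(\<lambda>m. a m / real m) \<longlonglongrightarrow> l"
    by blast
  have "eventually (\<lambda>m. ereal (a m / real m) = a_max Y (tensor_power m L) v / ereal (real m)) sequentially"
    unfolding eventually_sequentially using a m0 by (intro exI[of _ m\<^sub>0]) auto
  moreover have "(\<lambda>m. ereal (a m / real m)) \<longlonglongrightarrow> ereal l" using l by simp
  ultimately have "(\<lambda>m. a_max Y (tensor_power m L) v / ereal (real m)) \<longlonglongrightarrow> ereal l"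
    by (rule Lim_transform_eventually[rotated])
  then have "a_max_asymptotic Y L v = ereal l" unfolding a_max_asymptotic_def by (rule limI)
  then show ?thesis by simp
qed

end
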